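(* Suppose that the $T$-periodic system $\dot x(t)=A(t)x(t)+B(t)u(t)$ with unconstrained controls is controllable. Then there exists a unique control set $D^a$ with nonvoid interior of the autonomized system on $\mathbb{S}^1\times\mathbb{R}^d$ with controls $u\in\mathcal{U}$. It is given by $D^a=\overline{\mathbf{R}^a(0,0)}\cap\mathbf{C}^a(0,0)$ and satisfies $\mathbb{S}^1\times\{0\}\subset\mathrm{int}\,D^a$ and, with $Y(\tau):=X(dT+\tau,\tau)$, $\tau\in\mathbb{S}^1$, and $\mathcal{K}^\pm=\{(\tau,x):x\in K^\pm_\tau\}$, where $K^-_\tau:=\mathrm{int}\,\mathbf{R}_{\mathbb{N}T+\tau}(0,0)\cap E^-_\tau$ and $K^+_\tau:=\mathrm{int}\,\mathbf{C}_{-\mathbb{N}T+\tau}(0,0)\cap E^+_\tau$, $$Y(\cdot)\mathcal{K}^-\oplus\mathcal{E}^0\oplus Y(\cdot)^{-1}\mathcal{K}^+\subset\mathrm{int}\,D^a\subset D^a\subset Y(\cdot)^{-1}\overline{\mathcal{K}^-}\oplus\mathcal{E}^0\oplus Y(\cdot)\mathcal{K}^+.$$ In particular, $\mathrm{int}\,D^a$ is unbounded if and only if the center subbundle $\mathcal{E}^0$ is nontrivial.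
   Context: Setting. Let $T>0$, let $A\in L^\infty(\mathbb{R},\mathbb{R}^{d\times d})$ and $B\in L^\infty(\mathbb{R},\mathbb{R}^{d\times m})$ be $T$-periodic, let $U\subset\mathbb{R}^m$ be a bounded convex neighborhood of the origin, and $\mathcal{U}=\{u\in L^\infty(\mathbb{R},\mathbb{R}^m): u(t)\in U\text{ for a.a. }t\}$. For the control system $\dot x(t)=A(t)x(t)+B(t)u(t)$ let $\varphi(t;t_0,x_0,u)$, $t\in\mathbb{R}$, be the (Carathéodory) solution with $x(t_0)=x_0$. $X(t,s)$ is the principal fundamental solution of $\dot x=A(t)x$: $\frac{d}{dt}X(t,s)=A(t)X(t,s)$, $X(s,s)=I_d$. $\mathbb{N}=\{0,1,2,\ldots\}$. Reachable and controllable sets: $\mathbf{R}_t(t_0,x)=\{\varphi(t;t_0,x,u): u\in\mathcal{U}\}$ for $t\ge t_0$, and $\mathbf{C}_t(t_0,x)=\{y\in\mathbb{R}^d: \exists u\in\mathcal{U},\ \varphi(t_0;t,y,u)=x\}$ for $t\le t_0$. Further $\mathbf{R}_{\mathbb{N}T+\tau}(0,0)=\bigcup_{k\in\mathbb{N}}\mathbf{R}_{kT+\tau}(0,0)$ and $\mathbf{C}_{-\mathbb{N}T+\tau}(0,0)=\bigcup_k\mathbf{C}_{-kT+\tau}(0,0)$, the latter union over $k\in\mathbb{N}$ with $-kT+\tau\le0$. The system with unconstrained controls is called controllable if for any $x_1,x_2\in\mathbb{R}^d$ and $t_0\in\mathbb{R}$ there are $t_1>t_0$ and $u\in L^\infty([t_0,t_1],\mathbb{R}^m)$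 with $\varphi(t_1;t_0,x_1,u)=x_2$. Autonomized system. $\mathbb{S}^1$ is the circle parametrized by $\tau\in[0,T)$ (i.e. $\mathbb{R}/T\mathbb{Z}$). The autonomized system $\dot\tau=1\bmod T$, $\dot x=A(\tau)x+B(\tau)u$ on $\mathbb{S}^1\times\mathbb{R}^d$ has solutions $\varphi^a(t;(\tau_0,x_0),u)=(\tau_0+t\bmod T,\ \varphi(\tau_0+t;\tau_0,x_0,u))$, $u\in\mathcal{U}$. Its reachable and controllable sets are $\mathbf{R}^a(\tau,x)=\{\varphi^a(t;(\tau,x),u): t\ge0,u\in\mathcal{U}\}$ and $\mathbf{C}^a(\tau,x)=\{(\sigma,y): \exists t\ge0,u\in\mathcal{U},\ \varphi^a(t;(\sigma,y),u)=(\tau,x)\}$. Control set. A nonvoid set $D^a\subset\mathbb{S}^1\times\mathbb{R}^d$ is a control set of the autonomized system if (i) for all $(\tau,x)\in D^a$ there is $u\in\mathcal{U}$ with $\varphi^a(t;(\tau,x),u)\in D^a$ for all $t\ge0$; (ii) for all $(\tau,x)\in D^a$ one has $D^a\subset\overline{\mathbf{R}^a(\tau,x)}$; (iii) $D^a$ is maximal with these properties, i.e. if $D'\supset D^a$ satisfies (i) and (ii), then $D'=D^a$. Spectral subbundles. For $\tau\in[0,T)$ the Floquet multipliers are the eigenvalues $\mu$ of $X(T+\tau,\tau)$ (independent of $\tau$). Let $E^-_\tau,E^0_\tau,E^+_\tau\subset\mathbb{R}^d$ be the direct sums of the real generalized eigenspaces of $X(T+\tau,\tau)$ for the $\mu$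 with $|\mu|<1$, $|\mu|=1$, $|\mu|>1$, respectively. The center subbundle is $\mathcal{E}^0=\{(\tau,x)\in\mathbb{S}^1\times\mathbb{R}^d: x\in E^0_\tau\}$; it is nontrivial iff there is a Floquet multiplier of modulus $1$. Notation. For sets $\mathcal{K}=\{(\tau,x):x\in K_\tau\}$, $\mathcal{L}=\{(\tau,x):x\in L_\tau\}$ and matrices $Y(\tau)$: $Y(\cdot)\mathcal{K}=\{(\tau,x): x\in Y(\tau)K_\tau\}$ and $\mathcal{K}\oplus\mathcal{L}=\{(\tau,x+y): x\in K_\tau,y\in L_\tau\}$. Closures and interiors of subsets of $\mathbb{S}^1\times\mathbb{R}^d$ are taken in $\mathbb{S}^1\times\mathbb{R}^d$; those of $\mathbf{R}_{\mathbb{N}T+\tau}(0,0)$, $\mathbf{C}_{-\mathbb{N}T+\tau}(0,0)$ in $\mathbb{R}^d$. *)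

theory Defs
  imports "HOL-Analysis.Analysis" "HOL-Library.Real_Mod"
begin

section \<open>Essentially bounded functions and Caratheodory solutions\<close>

text \<open>Elements of \<open>L\<^sup>\<infinity>(S)\<close> are represented by Lebesgue measurable functions; accordingly, properties
  of coefficients and controls (periodicity, values in \<open>U\<close>) are only required almost everywhere.\<close>

definition Linf_on :: "real set \<Rightarrow> (real \<Rightarrow> 'a::euclidean_space) \<Rightarrow> bool" where
  "Linf_on S f \<longleftrightarrow> set_borel_measurable lebesgue S f \<and>
     (\<exists>M. AE t in lebesgue. t \<in> S \<longrightarrow> norm (f t) \<le> M)"

definition ae_periodic :: "real \<Rightarrow> (real \<Rightarrow> 'a) \<Rightarrow> bool" where
  "ae_periodic T f \<longleftrightarrow> (AE t in lebesgue. f (t + T) = f t)"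

text \<open>Solutions on all of \<open>\<real>\<close> of \<open>x' = f(t,x)\<close>, \<open>x(t\<^sub>0) = x\<^sub>0\<close> in the sense of Caratheodory, that is, of
  the integral equation \<open>x(t) = x\<^sub>0 + \<integral> f(s,x(s)) ds\<close> (integral from \<open>t\<^sub>0\<close> to \<open>t\<close>). The interval integral
  is oriented, so this covers \<open>t < t\<^sub>0\<close>. It is taken with respect to \<open>lebesgue\<close> rather than
  \<open>lborel\<close> because the coefficients are only Lebesgue measurable.\<close>

definition caratheodory_solution ::
    "(real \<Rightarrow> 'a \<Rightarrow> 'a::euclidean_space) \<Rightarrow> real \<Rightarrow> 'a \<Rightarrow> (real \<Rightarrow> 'a) \<Rightarrow> bool" where
  "caratheodory_solution f t0 x0 x \<longleftrightarrow>
     continuous_on UNIV x \<and>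
     (\<forall>t. interval_lebesgue_integrable lebesgue (ereal t0) (ereal t) (\<lambda>s. f s (x s)) \<and>
          x t = x0 + interval_lebesgue_integral lebesgue (ereal t0) (ereal t) (\<lambda>s. f s (x s)))"

text \<open>\<open>traj A B t t0 x0 u\<close> is \<open>\<phi>(t; t\<^sub>0, x\<^sub>0, u)\<close>. For \<open>A\<close>, \<open>B\<close>, \<open>u\<close> in \<open>L\<^sup>\<infinity>\<close> the solution exists on \<open>\<real>\<close> and is
  unique, so the description operator is well defined there; likewise for \<open>fund_sol A t s\<close>,
  which is the principal fundamental solution \<open>X(t,s)\<close>.\<close>

definition traj :: "(real \<Rightarrow> real^'n^'n) \<Rightarrow> (real \<Rightarrow> real^'m^'n) \<Rightarrow>
    real \<Rightarrow> real \<Rightarrow> real^'n \<Rightarrow> (real \<Rightarrow> real^'m) \<Rightarrow> real^'n" where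
  "traj A B t t0 x0 u =
     (THE x. caratheodory_solution (\<lambda>s y. A s *v y + B s *v u s) t0 x0 x) t"

definition fund_sol :: "(real \<Rightarrow> real^'n^'n) \<Rightarrow> real \<Rightarrow> real \<Rightarrow> real^'n^'n" where
  "fund_sol A t s = (THE X. caratheodory_solution (\<lambda>r Y. A r ** Y) s (mat 1) X) t"

section \<open>The periodic control system\<close>

definition controls :: "(real^'m) set \<Rightarrow> (real \<Rightarrow> real^'m) set" where
  "controls U = {u. Linf_on UNIV u \<and> (AE t in lebesgue. u t \<in> U)}"

text \<open>A control on \<open>[t\<^sub>0,t\<^sub>1]\<close> is extended by zero, since \<open>traj\<close> expects controls on \<open>\<real>\<close>; the value at
  \<open>t\<^sub>1\<close> does not depend on the extension.\<close>

definition controllable :: "(real \<Rightarrow> real^'n^'n) \<Rightarrow> (real \<Rightarrow> real^'m^'n) \<Rightarrow> bool" where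
  "controllable A B \<longleftrightarrow>
     (\<forall>x1 x2 t0. \<exists>t1>t0. \<exists>u. Linf_on {t0..t1} u \<and>
        traj A B t1 t0 x1 (\<lambda>t. indicator {t0..t1} t *\<^sub>R u t) = x2)"

text \<open>\<open>\<^bold>R\<^sub>t(t\<^sub>0,x)\<close>, meant for \<open>t \<ge> t\<^sub>0\<close>, and \<open>\<^bold>C\<^sub>t(t\<^sub>0,x)\<close>, meant for \<open>t \<le> t\<^sub>0\<close>.\<close>

definition reach :: "(real \<Rightarrow> real^'n^'n) \<Rightarrow> (real \<Rightarrow> real^'m^'n) \<Rightarrow> (real^'m) set \<Rightarrow>
    real \<Rightarrow> real \<Rightarrow> real^'n \<Rightarrow> (real^'n) set" where
  "reach A B U t t0 x = {traj A B t t0 x u | u. u \<in> controls U}"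

definition contr :: "(real \<Rightarrow> real^'n^'n) \<Rightarrow> (real \<Rightarrow> real^'m^'n) \<Rightarrow> (real^'m) set \<Rightarrow>
    real \<Rightarrow> real \<Rightarrow> real^'n \<Rightarrow> (real^'n) set" where
  "contr A B U t t0 x = {y. \<exists>u \<in> controls U. traj A B t0 t y u = x}"

text \<open>\<open>\<^bold>R\<close> at the times \<open>\<nat>T + \<tau>\<close> and \<open>\<^bold>C\<close> at the times \<open>-\<nat>T + \<tau>\<close>, both for the point \<open>(0,0)\<close> and
  \<open>\<tau> \<in> [0,T)\<close>.\<close>

definition reach_per :: "real \<Rightarrow> (real \<Rightarrow> real^'n^'n) \<Rightarrow> (real \<Rightarrow> real^'m^'n) \<Rightarrow>
    (real^'m) set \<Rightarrow> real \<Rightarrow> (real^'n) set" where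
  "reach_per T A B U \<tau> = (\<Union>k::nat. reach A B U (real k * T + \<tau>) 0 0)"

definition contr_per :: "real \<Rightarrow> (real \<Rightarrow> real^'n^'n) \<Rightarrow> (real \<Rightarrow> real^'m^'n) \<Rightarrow>
    (real^'m) set \<Rightarrow> real \<Rightarrow> (real^'n) set" where
  "contr_per T A B U \<tau> =
     (\<Union>k \<in> {k::nat. - real k * T + \<tau> \<le> 0}. contr A B U (- real k * T + \<tau>) 0 0)"

section \<open>The autonomized system\<close>

text \<open>The circle \<open>\<real>/T\<int>\<close>, with \<open>[0,T)\<close> as its set of points. The topology is the quotient topology,
  not the one induced from \<open>\<real>\<close>: neighborhoods of \<open>0\<close> contain points close to \<open>T\<close>.\<close>

definition circle :: "real \<Rightarrow> real topology" where
  "circle T = topology (\<lambda>S. S \<subseteq> {0..<T} \<and> open {t. t rmod T \<in> S})"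

lemma openin_circle: "openin (circle T) S \<longleftrightarrow> S \<subseteq> {0..<T} \<and> open {t. t rmod T \<in> S}"
proof -
  have "istopology (\<lambda>S. S \<subseteq> {0..<T} \<and> open {t. t rmod T \<in> S})"
    unfolding istopology_def
  proof (intro conjI allI impI)
    fix S S' assume "S \<subseteq> {0..<T} \<and> open {t. t rmod T \<in> S}"
      and "S' \<subseteq> {0..<T} \<and> open {t. t rmod T \<in> S'}"
    moreover have "{t. t rmod T \<in> S \<inter> S'} = {t. t rmod T \<in> S} \<inter> {t. t rmod T \<in> S'}" by auto
    ultimately show "S \<inter> S' \<subseteq> {0..<T}" "open {t. t rmod T \<in> S \<inter> S'}" by auto
  next
    fix \<K> assume *: "\<forall>K\<in>\<K>. K \<subseteq> {0..<T} \<and> open {t. t rmod T \<in> K}"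
    then show "\<Union>\<K> \<subseteq> {0..<T}" by blast
    have "{t. t rmod T \<in> \<Union>\<K>} = (\<Union>K\<in>\<K>. {t. t rmod T \<in> K})" by auto
    then show "open {t. t rmod T \<in> \<Union>\<K>}" using * by auto
  qed
  then show ?thesis
    by (simp add: circle_def)
qed

lemma topspace_circle: "T > 0 \<Longrightarrow> topspace (circle T) = {0..<T}"
proof -
  assume T: "T > 0"
  have "{t. t rmod T \<in> {0..<T}} = UNIV"
    using T by (auto simp: rmod_less rmod_nonneg)
  then have "openin (circle T) {0..<T}"
    by (simp add: openin_circle)
  then show ?thesis
    by (metis openin_circle openin_subset openin_topspace subset_antisym)
qed

lemma quotient_map_circle: "T > 0 \<Longrightarrow> quotient_map euclideanreal (circle T) (\<lambda>t. t rmod T)"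
proof -
  assume T: "T > 0"
  have "range (\<lambda>t. t rmod T) = {0..<T}"
  proof (intro subset_antisym subsetI)
    fix x assume "x \<in> {0..<T}"
    then have "x rmod T = x" using T by simp
    then show "x \<in> range (\<lambda>t. t rmod T)" by (metis rangeI)
  qed (use T in \<open>auto simp: rmod_less rmod_nonneg\<close>)
  then show ?thesis
    using T by (auto simp: quotient_map_def topspace_circle openin_circle)
qed

definition phase_space :: "real \<Rightarrow> (real \<times> (real^'n)) topology" where
  "phase_space T = prod_topology (circle T) euclidean"

definition traj_aut :: "real \<Rightarrow> (real \<Rightarrow> real^'n^'n) \<Rightarrow> (real \<Rightarrow> real^'m^'n) \<Rightarrow>
    real \<Rightarrow> real \<times> (real^'n) \<Rightarrow> (real \<Rightarrow> real^'m) \<Rightarrow> real \<times> (real^'n)" where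
  "traj_aut T A B t p u =
     ((fst p + t) rmod T, traj A B (fst p + t) (fst p) (snd p) u)"

definition reach_aut :: "real \<Rightarrow> (real \<Rightarrow> real^'n^'n) \<Rightarrow> (real \<Rightarrow> real^'m^'n) \<Rightarrow>
    (real^'m) set \<Rightarrow> real \<times> (real^'n) \<Rightarrow> (real \<times> (real^'n)) set" where
  "reach_aut T A B U p = {traj_aut T A B t p u | t u. t \<ge> 0 \<and> u \<in> controls U}"

definition contr_aut :: "real \<Rightarrow> (real \<Rightarrow> real^'n^'n) \<Rightarrow> (real \<Rightarrow> real^'m^'n) \<Rightarrow>
    (real^'m) set \<Rightarrow> real \<times> (real^'n) \<Rightarrow> (real \<times> (real^'n)) set" where
  "contr_aut T A B U p =
     {q \<in> {0..<T} \<times> UNIV. \<exists>t\<ge>0. \<exists>u \<in> controls U. traj_aut T A B t q u = p}"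

definition pre_control_set :: "real \<Rightarrow> (real \<Rightarrow> real^'n^'n) \<Rightarrow> (real \<Rightarrow> real^'m^'n) \<Rightarrow>
    (real^'m) set \<Rightarrow> (real \<times> (real^'n)) set \<Rightarrow> bool" where
  "pre_control_set T A B U D \<longleftrightarrow>
     D \<subseteq> {0..<T} \<times> UNIV \<and>
     (\<forall>p\<in>D. \<exists>u \<in> controls U. \<forall>t\<ge>0. traj_aut T A B t p u \<in> D) \<and>
     (\<forall>p\<in>D. D \<subseteq> phase_space T closure_of reach_aut T A B U p)"

definition control_set :: "real \<Rightarrow> (real \<Rightarrow> real^'n^'n) \<Rightarrow> (real \<Rightarrow> real^'m^'n) \<Rightarrow>
    (real^'m) set \<Rightarrow> (real \<times> (real^'n)) set \<Rightarrow> bool" where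
  "control_set T A B U D \<longleftrightarrow>
     D \<noteq> {} \<and> pre_control_set T A B U D \<and>
     (\<forall>D'. D \<subseteq> D' \<and> pre_control_set T A B U D' \<longrightarrow> D' = D)"

section \<open>Floquet multipliers and spectral subbundles\<close>

definition complexify :: "real^'n^'n \<Rightarrow> complex^'n^'n" where
  "complexify M = map_matrix complex_of_real M"

definition complex_eigenvalue :: "real^'n^'n \<Rightarrow> complex \<Rightarrow> bool" where
  "complex_eigenvalue M \<mu> \<longleftrightarrow> (\<exists>v. v \<noteq> 0 \<and> complexify M *v v = \<mu> *s v)"

definition gen_eigenspace :: "complex^'n^'n \<Rightarrow> complex \<Rightarrow> (complex^'n) set" where
  "gen_eigenspace M \<mu> = {v. \<exists>k::nat. ((\<lambda>w. M *v w - \<mu> *s w) ^^ k) v = 0}"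

text \<open>The real generalized eigenspace of \<open>\<mu>\<close> (for nonreal \<open>\<mu>\<close>: of the pair \<open>\<mu>\<close> and its conjugate)
  consists of the real parts of the complex generalized eigenvectors. This includes the
  imaginary parts, since the complex space is invariant under multiplication by \<open>-\<i>\<close>.\<close>

definition real_gen_eigenspace :: "real^'n^'n \<Rightarrow> complex \<Rightarrow> (real^'n) set" where
  "real_gen_eigenspace M \<mu> = {\<chi> i. Re (v $ i) | v. v \<in> gen_eigenspace (complexify M) \<mu>}"

text \<open>The sum of the real generalized eigenspaces for the eigenvalues \<open>\<mu>\<close> with \<open>P \<bar>\<mu>\<bar>\<close> is the span of
  their union (\<open>{0}\<close> if there are none).\<close>

definition spectral_subspace :: "(real \<Rightarrow> bool) \<Rightarrow> real^'n^'n \<Rightarrow> (real^'n) set" where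
  "spectral_subspace P M =
     span (\<Union>\<mu> \<in> {\<mu>. complex_eigenvalue M \<mu> \<and> P (cmod \<mu>)}. real_gen_eigenspace M \<mu>)"

definition E_minus :: "real \<Rightarrow> (real \<Rightarrow> real^'n^'n) \<Rightarrow> real \<Rightarrow> (real^'n) set" where
  "E_minus T A \<tau> = spectral_subspace (\<lambda>r. r < 1) (fund_sol A (T + \<tau>) \<tau>)"

definition E_zero :: "real \<Rightarrow> (real \<Rightarrow> real^'n^'n) \<Rightarrow> real \<Rightarrow> (real^'n) set" where
  "E_zero T A \<tau> = spectral_subspace (\<lambda>r. r = 1) (fund_sol A (T + \<tau>) \<tau>)"

definition E_plus :: "real \<Rightarrow> (real \<Rightarrow> real^'n^'n) \<Rightarrow> real \<Rightarrow> (real^'n) set" where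
  "E_plus T A \<tau> = spectral_subspace (\<lambda>r. r > 1) (fund_sol A (T + \<tau>) \<tau>)"

definition center_bundle :: "real \<Rightarrow> (real \<Rightarrow> real^'n^'n) \<Rightarrow> (real \<times> (real^'n)) set" where
  "center_bundle T A = (SIGMA \<tau>:{0..<T}. E_zero T A \<tau>)"

definition nontrivial_bundle :: "real \<Rightarrow> (real \<times> (real^'n)) set \<Rightarrow> bool" where
  "nontrivial_bundle T V \<longleftrightarrow> V \<noteq> {0..<T} \<times> {0}"

definition K_minus :: "real \<Rightarrow> (real \<Rightarrow> real^'n^'n) \<Rightarrow> (real \<Rightarrow> real^'m^'n) \<Rightarrow>
    (real^'m) set \<Rightarrow> (real \<times> (real^'n)) set" where
  "K_minus T A B U = (SIGMA \<tau>:{0..<T}. interior (reach_per T A B U \<tau>) \<inter> E_minus T A \<tau>)"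

definition K_plus :: "real \<Rightarrow> (real \<Rightarrow> real^'n^'n) \<Rightarrow> (real \<Rightarrow> real^'m^'n) \<Rightarrow>
    (real^'m) set \<Rightarrow> (real \<times> (real^'n)) set" where
  "K_plus T A B U = (SIGMA \<tau>:{0..<T}. interior (contr_per T A B U \<tau>) \<inter> E_plus T A \<tau>)"

definition Y_mat :: "real \<Rightarrow> (real \<Rightarrow> real^'n^'n) \<Rightarrow> real \<Rightarrow> real^'n^'n" where
  "Y_mat T A \<tau> = fund_sol A (real CARD('n) * T + \<tau>) \<tau>"

definition fiber_image :: "(real \<Rightarrow> real^'n^'n) \<Rightarrow> (real \<times> (real^'n)) set \<Rightarrow> (real \<times> (real^'n)) set" where
  "fiber_image Y K = {(\<tau>, Y \<tau> *v x) | \<tau> x. (\<tau>, x) \<in> K}"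

definition fiber_sum ::
    "(real \<times> (real^'n)) set \<Rightarrow> (real \<times> (real^'n)) set \<Rightarrow> (real \<times> (real^'n)) set" (infixl \<open>\<oplus>\<^sub>f\<close> 65) where
  "K \<oplus>\<^sub>f L = {(\<tau>, x + y) | \<tau> x y. (\<tau>, x) \<in> K \<and> (\<tau>, y) \<in> L}"

end

theory Submission
  imports Defs "HOL-Computational_Algebra.Fundamental_Theorem_Algebra"
begin

text \<open>
  Over the fiber at \<open>\<tau>\<close> the system sampled at the times \<open>\<tau> + kT\<close> is a discrete-time linear system with
  invertible matrix \<open>M = X(T+\<tau>,\<tau>)\<close>. Its reachable set \<open>R\<close> is convex, satisfies \<open>M R \<subseteq> R\<close> and, by
  controllability, contains a neighborhood of \<open>0\<close> that is reached in \<open>d\<close> periods; the controllable set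
  \<open>C\<close> is the reachable set of the backward system with matrix \<open>M\<inverse>\<close>. A functional \<open>p\<close> that is bounded
  on \<open>R\<close> satisfies \<open>p M\<^sup>k \<rightarrow> 0\<close> and therefore vanishes on \<open>E\<^sup>0\<close> and \<open>E\<^sup>+\<close>; by separation
  \<open>E\<^sup>0 \<oplus> E\<^sup>+\<close> lies in the interior of \<open>R\<close>, and both the interior and the closure of \<open>R\<close> are invariant under
  adding it. The same holds for \<open>C\<close> and \<open>E\<^sup>- \<oplus> E\<^sup>0\<close>, and the two inclusions of the theorem follow
  from the spectral decomposition, the powers \<open>M\<^sup>d\<close> being needed since \<open>M\<^sup>-\<^sup>d C\<close> lies in the interior of \<open>C\<close>.
  Since every point of a control set is approximately recurrent in arbitrarily long time, the
  same functionals show that the fibers of any control set lie in the closures of \<open>R\<close> and of \<open>C\<close>, which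
  yields uniqueness. If \<open>E\<^sup>0\<close> is trivial, the functionals in the stable spectral subspace of the transpose
  of \<open>M\<close> are bounded on \<open>R\<close> and those in the unstable one on \<open>C\<close>.
\<close>

section \<open>Caratheodory differential equations\<close>

text \<open>The main obstacle is topological. The spectral and convexity arguments live in a single
  fiber, whereas interiors and closures are taken over the circle times \<open>real^'n\<close>, and
  a point interior to its fiber need not be interior to the whole set. For interiors, monotonicity
  of the convex fibers in suitable coordinates lets one neighborhood serve all nearby times. For
  closures, short trajectories displace points little, uniformly in the control, so points of nearby
  fibers can be carried into the given one. The number d of periods has a Kalman-type origin: the
  spans of the sets reached in k periods increase and can grow strictly at most d times. A
  functional p bounded on R is stable because in each block of d periods a small contribution can be
  added with either sign, which makes a series of absolute values of p along an orbit converge. The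
  control set carries a closure on the reachable side only, since a whole neighborhood of the origin
  is controllable to it: an approximate return to the origin can be made exact.\<close>

definition loc_bdd :: "(real \<Rightarrow> 'a::euclidean_space) \<Rightarrow> bool" where
  "loc_bdd g \<longleftrightarrow> g \<in> borel_measurable lebesgue \<and>
     (\<forall>a b. \<exists>M. AE s in lebesgue. s \<in> {a..b} \<longrightarrow> norm (g s) \<le> M)"

abbreviation lint :: "real \<Rightarrow> real \<Rightarrow> (real \<Rightarrow> 'a::euclidean_space) \<Rightarrow> 'a" where
  "lint a b g \<equiv> interval_lebesgue_integral lebesgue (ereal a) (ereal b) g"

lemma loc_bdd_set_integrable:
  assumes "loc_bdd g" "S \<in> sets lebesgue" "S \<subseteq> {a..b}"
  shows "set_integrable lebesgue S g"
proof -
  obtain M where M: "AE s in lebesgue. s \<in> {a..b} \<longrightarrow> norm (g s) \<le> M"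
    using assms(1) unfolding loc_bdd_def by blast
  have "emeasure lebesgue S \<le> emeasure lebesgue {a..b}"
    using assms by (intro emeasure_mono) auto
  also have "\<dots> < \<infinity>" by (cases "a \<le> b") auto
  finally have "emeasure lebesgue S < \<infinity>" .
  moreover have "AE s in lebesgue. s \<in> S \<longrightarrow> norm (g s) \<le> M"
    using M by eventually_elim (use assms(3) in auto)
  ultimately show ?thesis
    unfolding set_integrable_def
    using assms by (intro integrableI_bounded_set_indicator) (auto simp: loc_bdd_def)
qed

lemma greaterThanLessThan_subseteq_Icc: "{a<..<b} \<subseteq> {a..b::real}"
  by auto

lemma loc_bdd_integrable_on: "loc_bdd g \<Longrightarrow> g integrable_on {a..b}"
  using loc_bdd_set_integrable[of g "{a..b}" a b] set_lebesgue_integral_eq_integral(1) by auto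

lemma loc_bdd_interval_integrable:
  "loc_bdd g \<Longrightarrow> interval_lebesgue_integrable lebesgue (ereal a) (ereal b) g"
  unfolding interval_lebesgue_integrable_def
  by (simp add: loc_bdd_set_integrable[OF _ _ greaterThanLessThan_subseteq_Icc])

lemma lint_eq_integral:
  assumes "loc_bdd g"
  shows "lint a b g = (if a \<le> b then integral {a..b} g else - integral {b..a} g)"
proof -
  have *: "(LINT x:{a<..<b}|lebesgue. g x) = integral {a..b} g" for a b
    using set_lebesgue_integral_eq_integral(2)[of "{a<..<b}" g]
      loc_bdd_set_integrable[OF assms _ greaterThanLessThan_subseteq_Icc]
    by (simp add: integral_open_interval_real)
  show ?thesis
    unfolding interval_lebesgue_integral_def using * by auto
qed

lemma lint_same [simp]: "lint a a g = 0"
  by (simp add: interval_lebesgue_integral_def set_lebesgue_integral_def)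

lemma lint_combine:
  assumes "loc_bdd g"
  shows "lint a b g + lint b c g = lint a c g"
proof -
  have *: "integral {a..b} g + integral {b..c} g = integral {a..c} g" if "a \<le> b" "b \<le> c" for a b c
    using Henstock_Kurzweil_Integration.integral_combine[of a b c g] that loc_bdd_integrable_on[OF assms] by simp
  consider "a \<le> b" "b \<le> c" | "a \<le> c" "c < b" | "b < a" "a \<le> c" | "b \<le> c" "c < a"
    | "c < a" "a \<le> b" | "c < b" "b < a" by linarith
  then show ?thesis
    using *[of a b c] *[of a c b] *[of b a c] *[of b c a] *[of c a b] *[of c b a]
    by cases (auto simp: lint_eq_integral[OF assms] algebra_simps)
qed

lemma lint_norm_le:
  assumes g: "loc_bdd g" and h: "h integrable_on {min a b..max a b}"
    and le: "AE s in lebesgue. s \<in> {min a b..max a b} \<longrightarrow> norm (g s) \<le> h s"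
  shows "norm (lint a b g) \<le> integral {min a b..max a b} h"
proof -
  let ?J = "{min a b..max a b}"
  obtain N where N: "N \<in> null_sets lebesgue" "{s. \<not> (s \<in> ?J \<longrightarrow> norm (g s) \<le> h s)} \<subseteq> N"
    using le by (auto simp: eventually_ae_filter)
  then have neg: "negligible N" by (simp add: negligible_iff_null_sets)
  \<comment> \<open>The bound holds only off the null set \<open>N\<close>, while
    \<open>integral_norm_bound_integral\<close> asks for it at every point; both functions are
    therefore set to 0 on \<open>N\<close>, which leaves their integrals unchanged.\<close>
  define g' where "g' s = (if s \<in> N then 0 else g s)" for s
  define h' where "h' s = (if s \<in> N then 0 else h s)" for s
  have "g integrable_on ?J" by (rule loc_bdd_integrable_on[OF g])
  then have "g' integrable_on ?J" 
    by (rule integrable_spike[OF _ neg]) (auto simp: g'_def)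
  moreover have "h' integrable_on ?J"
    using h by (rule integrable_spike[OF _ neg]) (auto simp: h'_def)
  ultimately have "norm (integral ?J g') \<le> integral ?J h'"
    using N(2) by (intro integral_norm_bound_integral) (auto simp: g'_def h'_def)
  moreover have "integral ?J g' = integral ?J g" "integral ?J h' = integral ?J h"
    by (rule integral_spike[OF neg], simp add: g'_def h'_def)+
  ultimately show ?thesis
    by (auto simp: lint_eq_integral[OF g] min_def max_def)
qed

lemma lint_norm_le_const:
  assumes "loc_bdd g" "AE s in lebesgue. s \<in> {min a b..max a b} \<longrightarrow> norm (g s) \<le> M"
  shows "norm (lint a b g) \<le> M * \<bar>b - a\<bar>"
proof -
  have "norm (lint a b g) \<le> integral {min a b..max a b} (\<lambda>_. M)"
    using assms by (intro lint_norm_le) auto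
  also have "\<dots> = M * \<bar>b - a\<bar>"
    by (auto simp: min_def max_def)
  finally show ?thesis .
qed

text \<open>Integrating exp(L |s - a|) away from a gains the factor 1/L. This gain makes the Picard
  operator a contraction in the weighted norm.\<close>

lemma lint_norm_le_exp:
  fixes L M :: real
  assumes g: "loc_bdd g" and L: "L > 0" and M: "M \<ge> 0"
    and le: "AE s in lebesgue. norm (g s) \<le> M * exp (L * \<bar>s - a\<bar>)"
  shows "norm (lint a b g) \<le> M / L * exp (L * \<bar>b - a\<bar>)"
proof -
  have "((\<lambda>s. M * exp (L * \<bar>s - a\<bar>)) has_integral (M / L * exp (L * \<bar>b - a\<bar>) - M / L)) {min a b..max a b}"
  proof (cases "a \<le> b")
    case True
    have "((\<lambda>s. M * exp (L * (s - a))) has_integral (M / L * exp (L * (b - a)) - M / L * exp (L * (a - a)))) {a..b}"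
      using True L
      by (intro fundamental_theorem_of_calculus)
         (auto intro!: derivative_eq_intros simp flip: has_real_derivative_iff_has_vector_derivative)
    then have "((\<lambda>s. M * exp (L * \<bar>s - a\<bar>)) has_integral (M / L * exp (L * (b - a)) - M / L)) {a..b}"
      by (subst has_integral_cong[where g = "\<lambda>s. M * exp (L * (s - a))"]) auto
    with True show ?thesis by (simp add: min_def max_def)
  next
    case False
    have "((\<lambda>s. M * exp (L * (a - s))) has_integral (- M / L * exp (L * (a - a)) - (- M / L) * exp (L * (a - b)))) {b..a}"
      using False L
      by (intro fundamental_theorem_of_calculus)
         (auto intro!: derivative_eq_intros simp flip: has_real_derivative_iff_has_vector_derivative)
    then have "((\<lambda>s. M * exp (L * \<bar>s - a\<bar>)) has_integral (M / L * exp (L * (a - b)) - M / L)) {b..a}"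
      by (subst has_integral_cong[where g = "\<lambda>s. M * exp (L * (a - s))"]) auto
    with False show ?thesis by (simp add: min_def max_def)
  qed
  then have "norm (lint a b g) \<le> M / L * exp (L * \<bar>b - a\<bar>) - M / L"
    using lint_norm_le[OF g, of "\<lambda>s. M * exp (L * \<bar>s - a\<bar>)" a b, OF _ AE_mp[OF le AE_I2]]
    by (auto simp: has_integral_iff)
  moreover have "M / L \<ge> 0" using L M by simp
  ultimately show ?thesis by linarith
qed

lemma loc_bdd_add:
  assumes "loc_bdd f" "loc_bdd g"
  shows "loc_bdd (\<lambda>s. f s + g s)"
  unfolding loc_bdd_def
proof (intro conjI allI)
  fix a b
  obtain M M' where "AE s in lebesgue. s \<in> {a..b} \<longrightarrow> norm (f s) \<le> M"
      "AE s in lebesgue. s \<in> {a..b} \<longrightarrow> norm (g s) \<le> M'"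
    using assms unfolding loc_bdd_def by meson
  then have "AE s in lebesgue. s \<in> {a..b} \<longrightarrow> norm (f s + g s) \<le> M + M'"
    by eventually_elim (auto intro: norm_triangle_mono)
  then show "\<exists>M. AE s in lebesgue. s \<in> {a..b} \<longrightarrow> norm (f s + g s) \<le> M" by blast
qed (use assms in \<open>auto simp: loc_bdd_def\<close>)

lemma loc_bdd_bounded_linear:
  assumes "loc_bdd f" "bounded_linear h"
  shows "loc_bdd (\<lambda>s. h (f s))"
  unfolding loc_bdd_def
proof (intro conjI allI)
  obtain K where K: "\<And>x. norm (h x) \<le> norm x * K" "K > 0"
    using bounded_linear.pos_bounded[OF assms(2)] by blast
  fix a b
  obtain M where "AE s in lebesgue. s \<in> {a..b} \<longrightarrow> norm (f s) \<le> M"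
    using assms unfolding loc_bdd_def by meson
  then have "AE s in lebesgue. s \<in> {a..b} \<longrightarrow> norm (h (f s)) \<le> M * K"
    by eventually_elim (meson K mult_right_mono less_imp_le order_trans)
  then show "\<exists>M. AE s in lebesgue. s \<in> {a..b} \<longrightarrow> norm (h (f s)) \<le> M" by blast
next
  have "continuous_on UNIV h"
    using assms(2) by (simp add: linear_continuous_on)
  then have "h \<in> borel_measurable borel" by (rule borel_measurable_continuous_onI)
  then show "(\<lambda>s. h (f s)) \<in> borel_measurable lebesgue"
    using assms by (intro measurable_compose[of f lebesgue borel h]) (auto simp: loc_bdd_def)
qed

lemma loc_bdd_scaleR: "loc_bdd f \<Longrightarrow> loc_bdd (\<lambda>s. c *\<^sub>R f s)"
  by (rule loc_bdd_bounded_linear[OF _ bounded_linear_scaleR_right])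

lemma lint_add:
  assumes "loc_bdd f" "loc_bdd g"
  shows "lint a b (\<lambda>s. f s + g s) = lint a b f + lint a b g"
  using assms by (intro interval_lebesgue_integral_add loc_bdd_interval_integrable)

lemma lint_bounded_linear:
  assumes "loc_bdd f" "bounded_linear h"
  shows "lint a b (\<lambda>s. h (f s)) = h (lint a b f)"
proof -
  have *: "integral {a..b} (\<lambda>s. h (f s)) = h (integral {a..b} f)" for a b
    using integral_linear[OF loc_bdd_integrable_on[OF assms(1)] assms(2), of a b] by (simp add: o_def)
  show ?thesis
    using assms by (simp add: lint_eq_integral loc_bdd_bounded_linear * linear_neg bounded_linear.linear)
qed

lemma AE_lebesgue_shift:
  assumes "AE t in lebesgue. P t"
  shows "AE t in lebesgue. P (t + (T::real))"
proof -
  obtain N where N: "N \<in> null_sets lebesgue" "{t. \<not> P t} \<subseteq> N"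
    using assms by (auto simp: eventually_ae_filter)
  then have "negligible ((+) (- T) ` N)"
    using negligible_translation negligible_iff_null_sets by blast
  moreover have "{t. \<not> P (t + T)} \<subseteq> (+) (- T) ` N"
  proof
    fix t assume "t \<in> {t. \<not> P (t + T)}"
    then have "t + T \<in> N" using N by auto
    then have "- T + (t + T) \<in> (+) (- T) ` N" by blast
    then show "t \<in> (+) (- T) ` N" by simp
  qed
  ultimately show ?thesis
    unfolding eventually_ae_filter negligible_iff_null_sets by (intro bexI) auto
qed

lemma borel_measurable_lebesgue_shift:
  fixes g :: "real \<Rightarrow> 'a::euclidean_space"
  assumes "g \<in> borel_measurable lebesgue"
  shows "(\<lambda>s. g (s + T)) \<in> borel_measurable lebesgue"
proof -
  have "(\<lambda>s. T + (1::real) *\<^sub>R s) \<in> lebesgue \<rightarrow>\<^sub>M lebesgue"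
    using lebesgue_affine_measurable[of "\<lambda>_. 1::real" T] by simp
  from measurable_compose[OF this assms] show ?thesis by (simp add: add.commute)
qed

lemma loc_bdd_shift:
  assumes "loc_bdd g"
  shows "loc_bdd (\<lambda>s. g (s + T))"
  unfolding loc_bdd_def
proof (intro conjI allI)
  fix a b
  obtain M where "AE s in lebesgue. s \<in> {a+T..b+T} \<longrightarrow> norm (g s) \<le> M"
    using assms unfolding loc_bdd_def by meson
  from AE_lebesgue_shift[OF this, of T]
  have "AE s in lebesgue. s \<in> {a..b} \<longrightarrow> norm (g (s + T)) \<le> M" by auto
  then show "\<exists>M. AE s in lebesgue. s \<in> {a..b} \<longrightarrow> norm (g (s + T)) \<le> M" by blast
qed (use assms borel_measurable_lebesgue_shift in \<open>auto simp: loc_bdd_def\<close>)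

lemma lint_shift:
  assumes "loc_bdd g"
  shows "lint (a + T) (b + T) g = lint a b (\<lambda>s. g (s + T))"
  using integral_shift_Icc_real[of a b g T] integral_shift_Icc_real[of b a g T]
  by (simp add: lint_eq_integral assms loc_bdd_shift o_def add.commute)

lemma continuous_lint:
  assumes "loc_bdd g"
  shows "continuous_on UNIV (\<lambda>t. lint a t g)"
proof -
  have "isCont (\<lambda>t. lint a t g) t" for t
  proof -
    obtain M where M: "AE s in lebesgue. s \<in> {t-1..t+1} \<longrightarrow> norm (g s) \<le> M"
      using assms unfolding loc_bdd_def by meson
    have "norm (lint a s g - lint a t g) \<le> M * \<bar>s - t\<bar>" if "\<bar>s - t\<bar> < 1" for s
    proof -
      have "lint a s g - lint a t g = lint t s g"
        using lint_combine[OF assms, of a t s] by (simp add: algebra_simps)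
      moreover have "AE r in lebesgue. r \<in> {min t s..max t s} \<longrightarrow> norm (g r) \<le> M"
        using M by eventually_elim (use that in \<open>auto simp: min_def max_def split: if_splits\<close>)
      ultimately show ?thesis using lint_norm_le_const[OF assms] by metis
    qed
    then have "\<forall>\<^sub>F s in at t. norm (lint a s g - lint a t g) \<le> M * \<bar>s - t\<bar>"
      unfolding eventually_at by (auto intro!: exI[of _ 1] simp: dist_real_def)
    moreover have "((\<lambda>s. M * \<bar>s - t\<bar>) \<longlongrightarrow> 0) (at t)"
      by (rule tendsto_eq_intros | simp)+
    ultimately have "((\<lambda>s. lint a s g - lint a t g) \<longlongrightarrow> 0) (at t)"
      by (rule Lim_null_comparison)
    then show ?thesis
      unfolding isCont_def by (rule LIM_zero_cancel)
  qed
  then show ?thesis by (simp add: continuous_at_imp_continuous_on)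
qed

section \<open>Lipschitz right-hand sides: global solutions and quantitative bounds\<close>

text \<open>The exceptional null sets are fixed before the states, so the bounds may be inserted
  along any curve. Measurability is demanded along continuous curves, which is what the integral
  equation uses.\<close>

locale lip_rhs =
  fixes f :: "real \<Rightarrow> 'a::euclidean_space \<Rightarrow> 'a" and K C :: real
  assumes meas: "continuous_on UNIV x \<Longrightarrow> (\<lambda>s. f s (x s)) \<in> borel_measurable lebesgue"
    and lip: "AE s in lebesgue. \<forall>x y. norm (f s x - f s y) \<le> K * norm (x - y)"
    and bdd: "AE s in lebesgue. norm (f s 0) \<le> C"
    and K_pos: "K > 0" and C_nonneg: "C \<ge> 0"
begin

lemma growth: "AE s in lebesgue. \<forall>x. norm (f s x) \<le> K * norm x + C"
  using lip bdd
proof eventually_elim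
  case (elim s)
  have "norm (f s x) \<le> K * norm x + C" for x
    using norm_triangle_ineq[of "f s x - f s 0" "f s 0"] elim(1)[rule_format, of x 0] elim(2) by simp
  then show ?case by blast
qed

lemma loc_bdd_comp:
  assumes "continuous_on UNIV x"
  shows "loc_bdd (\<lambda>s. f s (x s))"
  unfolding loc_bdd_def
proof (intro conjI allI)
  fix a b
  have "compact (x ` {a..b})"
    using assms by (intro compact_continuous_image) (auto intro: continuous_on_subset)
  then obtain B where B: "\<And>s. s \<in> {a..b} \<Longrightarrow> norm (x s) \<le> B"
    by (metis bounded_iff compact_imp_bounded imageI)
  have "AE s in lebesgue. s \<in> {a..b} \<longrightarrow> norm (f s (x s)) \<le> K * B + C"
    using growth
  proof eventually_elim
    case (elim s)
    show ?case
    proof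
      assume "s \<in> {a..b}"
      then have "K * norm (x s) \<le> K * B" using B K_pos by simp
      then show "norm (f s (x s)) \<le> K * B + C" using elim[rule_format, of "x s"] by linarith
    qed
  qed
  then show "\<exists>M. AE s in lebesgue. s \<in> {a..b} \<longrightarrow> norm (f s (x s)) \<le> M" by blast
qed (rule meas[OF assms])

lemma caratheodory_solution_iff:
  "caratheodory_solution f t0 x0 x \<longleftrightarrow>
     continuous_on UNIV x \<and> (\<forall>t. x t = x0 + lint t0 t (\<lambda>s. f s (x s)))"
  unfolding caratheodory_solution_def using loc_bdd_comp loc_bdd_interval_integrable by blast

text \<open>Contraction for the sup norm weighted with \<open>exp (- 2 * K * \<bar>t - t0\<bar>)\<close>, which gives the
  solution on all of \<open>\<real>\<close> at once.\<close>

lemma existence: "\<exists>x. caratheodory_solution f t0 x0 x"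
proof -
  define e where "e t = exp (2 * K * \<bar>t - t0\<bar>)" for t
  have e: "e t \<ge> 1" "e t > 0" for t
    using K_pos by (auto simp: e_def)
  have e_cont: "continuous_on UNIV e"
    unfolding e_def by (intro continuous_intros)
  define F where "F y s = f s (e s *\<^sub>R apply_bcontfun y s)" for y :: "real \<Rightarrow>\<^sub>C 'a" and s
  have c: "continuous_on UNIV (\<lambda>s. e s *\<^sub>R apply_bcontfun y s)" for y :: "real \<Rightarrow>\<^sub>C 'a"
    by (intro continuous_on_scaleR e_cont continuous_on_apply_bcontfun)
  have lb: "loc_bdd (F y)" for y
    unfolding F_def by (rule loc_bdd_comp[OF c])
  \<comment> \<open>The Picard operator conjugated with the weight: \<open>y\<close> is a bounded
    function and \<open>e t *\<^sub>R apply_bcontfun y t\<close> is the candidate for the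
    solution.\<close>
  define \<Phi> where "\<Phi> y t = (1 / e t) *\<^sub>R (x0 + lint t0 t (F y))" for y t
  have \<Phi>: "\<Phi> y \<in> bcontfun" for y
  proof (rule bcontfun_normI)
    have "\<forall>t\<in>UNIV. e t \<noteq> 0" using e(2) by (metis less_irrefl)
    then show "continuous_on UNIV (\<Phi> y)"
      unfolding \<Phi>_def by (intro continuous_intros e_cont continuous_lint lb)
    fix t
    have "AE s in lebesgue. norm (F y s) \<le> (C + K * norm y) * exp (2 * K * \<bar>s - t0\<bar>)"
      using growth
    proof eventually_elim
      case (elim s)
      have "norm (F y s) \<le> K * (e s * norm (apply_bcontfun y s)) + C"
        using elim[rule_format, of "e s *\<^sub>R apply_bcontfun y s"] e(2)[of s] by (simp add: F_def)
      also have "\<dots> \<le> K * (e s * norm y) + C * e s"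
        using K_pos e[of s] norm_bounded[where x=s and f=y] C_nonneg
        by (intro add_mono mult_left_mono) (auto simp: mult_le_cancel_left1)
      finally show ?case by (simp add: e_def algebra_simps)
    qed
    then have "norm (lint t0 t (F y)) \<le> (C + K * norm y) / (2 * K) * e t"
      unfolding e_def using K_pos C_nonneg by (intro lint_norm_le_exp lb) auto
    then have "norm (x0 + lint t0 t (F y)) \<le> norm x0 * e t + (C + K * norm y) / (2 * K) * e t"
      using e[of t] by (intro norm_triangle_mono) (auto simp: mult_le_cancel_left1)
    then have "norm (x0 + lint t0 t (F y)) \<le> (norm x0 + (C + K * norm y) / (2 * K)) * e t"
      by (simp add: distrib_right)
    then show "norm (\<Phi> y t) \<le> norm x0 + (C + K * norm y) / (2 * K)"
      using e(2)[of t] by (simp add: \<Phi>_def pos_divide_le_eq)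
  qed
  \<comment> \<open>The weight grows at rate \<open>2 * K\<close> against the Lipschitz constant
    \<open>K\<close>, hence the contraction factor 1/2.\<close>
  have contr: "dist (Bcontfun (\<Phi> y)) (Bcontfun (\<Phi> z)) \<le> 1/2 * dist y z" for y z
  proof (rule dist_bound)
    fix t
    have lbd: "loc_bdd (\<lambda>s. F y s - F z s)"
      using loc_bdd_add[OF lb loc_bdd_scaleR[OF lb, of "-1"]] by simp
    have "AE s in lebesgue. norm (F y s - F z s) \<le> (K * dist y z) * exp (2 * K * \<bar>s - t0\<bar>)"
      using lip
    proof eventually_elim
      case (elim s)
      have "norm (F y s - F z s) \<le> K * norm (e s *\<^sub>R apply_bcontfun y s - e s *\<^sub>R apply_bcontfun z s)"
        using elim by (simp add: F_def)
      also have "norm (e s *\<^sub>R apply_bcontfun y s - e s *\<^sub>R apply_bcontfun z s)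
          = e s * dist (apply_bcontfun y s) (apply_bcontfun z s)"
        using e(2)[of s] by (simp add: dist_norm flip: scaleR_diff_right)
      also have "K * \<dots> \<le> K * (e s * dist y z)"
        using K_pos e(2)[of s] dist_bounded[where x=s and f=y and g=z] by simp
      finally show ?case by (simp add: e_def algebra_simps)
    qed
    then have "norm (lint t0 t (\<lambda>s. F y s - F z s)) \<le> K * dist y z / (2 * K) * e t"
      unfolding e_def using K_pos C_nonneg by (intro lint_norm_le_exp lbd) auto
    also have "lint t0 t (\<lambda>s. F y s - F z s) = lint t0 t (F y) - lint t0 t (F z)"
      by (intro interval_lebesgue_integral_diff loc_bdd_interval_integrable lb)
    finally have "norm (lint t0 t (F y) - lint t0 t (F z)) \<le> dist y z / 2 * e t"
      using K_pos by simp
    moreover have "dist (\<Phi> y t) (\<Phi> z t) = norm (lint t0 t (F y) - lint t0 t (F z)) / e t"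
      using e(2)[of t] by (simp add: \<Phi>_def dist_norm flip: scaleR_diff_right)
    ultimately have "dist (\<Phi> y t) (\<Phi> z t) \<le> 1/2 * dist y z"
      using e(2)[of t] by (simp add: pos_divide_le_eq)
    then show "dist (apply_bcontfun (Bcontfun (\<Phi> y)) t) (apply_bcontfun (Bcontfun (\<Phi> z)) t) \<le> 1/2 * dist y z"
      by (simp add: Bcontfun_inverse \<Phi>)
  qed
  obtain y where y: "Bcontfun (\<Phi> y) = y"
    using banach_fix_type[of "1/2" "\<lambda>y. Bcontfun (\<Phi> y)"] contr by auto
  define x where "x t = e t *\<^sub>R apply_bcontfun y t" for t
  have "x t = x0 + lint t0 t (\<lambda>s. f s (x s))" for t
  proof -
    have "apply_bcontfun y t = \<Phi> y t" using y \<Phi>[of y] by (metis Bcontfun_inverse)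
    moreover have "F y = (\<lambda>s. f s (x s))" by (simp add: F_def x_def fun_eq_iff)
    ultimately show ?thesis using e(2)[of t] by (simp add: x_def \<Phi>_def)
  qed
  moreover have "continuous_on UNIV x" using c[of y] by (simp add: x_def[abs_def])
  ultimately show ?thesis
    unfolding caratheodory_solution_iff by blast
qed

lemma caratheodory_solution_restart:
  assumes "caratheodory_solution f t0 x0 x"
  shows "caratheodory_solution f t1 (x t1) x"
proof -
  have "loc_bdd (\<lambda>s. f s (x s))" using assms caratheodory_solution_iff loc_bdd_comp by blast
  from lint_combine[OF this, of t0 t1] show ?thesis
    using assms unfolding caratheodory_solution_iff by (metis add.assoc)
qed

end

text \<open>Within distance 1/(2K) of a time where the solutions agree, the maximum of |x - y| is
  bounded by half of itself; such steps then cover \<open>{a..b}\<close>. The two right-hand sides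
  need to agree only almost everywhere on \<open>{a..b}\<close>, so the same lemma shows that a
  trajectory depends only on the control between its end times and that it is compatible with
  periodic shifts.\<close>

lemma caratheodory_solution_local_unique:
  assumes f: "lip_rhs f K C" and g: "lip_rhs g K' C'"
    and fg: "AE s in lebesgue. s \<in> {a..b} \<longrightarrow> f s = g s"
    and x: "caratheodory_solution f t0 x0 x" and y: "caratheodory_solution g t0 x0 y"
    and t0: "t0 \<in> {a..b}" and t: "t \<in> {a..b}"
  shows "x t = y t"
proof -
  interpret f: lip_rhs f K C by fact
  interpret g: lip_rhs g K' C' by fact
  define h where "h = 1 / (2 * K)"
  have h: "h > 0" "K * h = 1/2" using f.K_pos by (auto simp: h_def)
  have cont: "continuous_on UNIV x" "continuous_on UNIV y"
    using x y f.caratheodory_solution_iff g.caratheodory_solution_iff by blast+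
  have step: "x t = y t" if t1: "t1 \<in> {a..b}" "x t1 = y t1" and t: "t \<in> {a..b}" "\<bar>t - t1\<bar> \<le> h" for t t1
  proof -
    define J where "J = {max a (t1 - h)..min b (t1 + h)}"
    have J: "compact J" "t1 \<in> J" "t \<in> J"
      using t1 t h(1) by (simp_all add: J_def abs_le_iff)
    have "continuous_on J (\<lambda>s. norm (x s - y s))"
      using cont by (intro continuous_intros) (auto intro: continuous_on_subset)
    then obtain s where s: "s \<in> J" "\<And>r. r \<in> J \<Longrightarrow> norm (x r - y r) \<le> norm (x s - y s)"
      using continuous_attains_sup[of J "\<lambda>s. norm (x s - y s)"] J by blast
    have lb: "loc_bdd (\<lambda>s. f s (x s))" "loc_bdd (\<lambda>s. g s (y s))"
      using f.loc_bdd_comp g.loc_bdd_comp cont by auto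
    then have lbd: "loc_bdd (\<lambda>s. f s (x s) - g s (y s))"
      using loc_bdd_add[OF lb(1) loc_bdd_scaleR[OF lb(2), of "-1"]] by simp
    have sub: "{min t1 s..max t1 s} \<subseteq> J"
      using s(1) J(2) by (simp add: J_def)
    have "AE r in lebesgue. r \<in> {min t1 s..max t1 s} \<longrightarrow> norm (f r (x r) - g r (y r)) \<le> K * norm (x s - y s)"
      using fg f.lip
    proof eventually_elim
      case (elim r)
      show ?case
      proof
        assume "r \<in> {min t1 s..max t1 s}"
        then have r: "r \<in> J" using sub by blast
        then have "f r = g r" using elim by (auto simp: J_def)
        then have "norm (f r (x r) - g r (y r)) \<le> K * norm (x r - y r)"
          using elim(2) by metis
        also have "\<dots> \<le> K * norm (x s - y s)" using s(2)[OF r] f.K_pos by simp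
        finally show "norm (f r (x r) - g r (y r)) \<le> K * norm (x s - y s)" .
      qed
    qed
    then have *: "norm (lint t1 s (\<lambda>r. f r (x r) - g r (y r))) \<le> K * norm (x s - y s) * \<bar>s - t1\<bar>"
      by (rule lint_norm_le_const[OF lbd])
    have "x s - y s = lint t1 s (\<lambda>s. f s (x s)) - lint t1 s (\<lambda>s. g s (y s))"
      using f.caratheodory_solution_restart[OF x, of t1] g.caratheodory_solution_restart[OF y, of t1] t1(2)
      unfolding f.caratheodory_solution_iff g.caratheodory_solution_iff
      by (metis add_diff_cancel_left)
    also have "\<dots> = lint t1 s (\<lambda>r. f r (x r) - g r (y r))"
      by (intro interval_lebesgue_integral_diff(2)[symmetric] loc_bdd_interval_integrable lb)
    finally have "norm (x s - y s) \<le> K * norm (x s - y s) * \<bar>s - t1\<bar>" using * by simp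
    also have "\<dots> \<le> K * norm (x s - y s) * h"
      using s(1) f.K_pos by (intro mult_left_mono) (simp_all add: J_def abs_le_iff)
    also have "\<dots> = norm (x s - y s) / 2" using h by (simp add: algebra_simps)
    finally have "norm (x s - y s) = 0" by simp
    then show ?thesis using s(2)[OF J(3)] by simp
  qed
  have start: "x t0 = y t0"
    using x y unfolding f.caratheodory_solution_iff g.caratheodory_solution_iff
    by (metis add.right_neutral lint_same)
  have "\<forall>t \<in> {a..b}. \<bar>t - t0\<bar> \<le> real n * h \<longrightarrow> x t = y t" for n
  proof (induction n)
    case 0
    then show ?case using start by auto
  next
    case (Suc n)
    show ?case
    proof (intro ballI impI)
      fix t assume t: "t \<in> {a..b}" "\<bar>t - t0\<bar> \<le> real (Suc n) * h"
      \<comment> \<open>The point one step \<open>h\<close> closer to \<open>t0\<close>, or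
        \<open>t0\<close> itself, where the induction hypothesis applies.\<close>
      define s where "s = (if \<bar>t - t0\<bar> \<le> h then t0 else if t \<ge> t0 then t - h else t + h)"
      have "s \<in> {a..b}" "\<bar>s - t0\<bar> \<le> real n * h" "\<bar>t - s\<bar> \<le> h"
        using t t0 h(1) by (auto simp: s_def distrib_right abs_if split: if_splits)
      then show "x t = y t" using Suc step[of s t] t(1) by auto
    qed
  qed
  moreover obtain n where "\<bar>t - t0\<bar> / h \<le> real n" using real_arch_simple by blast
  ultimately show ?thesis using t h by (auto simp: divide_simps)
qed

text \<open>The description used in \<open>traj\<close> and \<open>fund_sol\<close> with the
  right-hand side left abstract, so that both are instances by unfolding.\<close>

definition flow :: "(real \<Rightarrow> 'a::euclidean_space \<Rightarrow> 'a) \<Rightarrow> real \<Rightarrow> real \<Rightarrow> 'a \<Rightarrow> 'a" where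
  "flow f t t0 x0 = (THE x. caratheodory_solution f t0 x0 x) t"

context lip_rhs
begin

lemma caratheodory_solution_unique:
  assumes "caratheodory_solution f t0 x0 x" "caratheodory_solution f t0 x0 y"
  shows "x = y"
proof
  fix t show "x t = y t"
    using caratheodory_solution_local_unique[of f K C f K C "min t t0" "max t t0"] assms lip_rhs_axioms
    by auto
qed

lemma flow_eqI: "caratheodory_solution f t0 x0 x \<Longrightarrow> flow f t t0 x0 = x t"
  unfolding flow_def using caratheodory_solution_unique by (metis the_equality)

lemma flow_solution: "caratheodory_solution f t0 x0 (\<lambda>t. flow f t t0 x0)"
proof -
  obtain x where x: "caratheodory_solution f t0 x0 x" using existence by blast
  then have "(\<lambda>t. flow f t t0 x0) = x" using flow_eqI by blast
  with x show ?thesis by simp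
qed

lemma flow_same [simp]: "flow f t t x = x"
  using flow_solution[of t x] unfolding caratheodory_solution_iff
  by (metis add.right_neutral lint_same)

lemma flow_continuous: "continuous_on UNIV (\<lambda>t. flow f t t0 x0)"
  using flow_solution caratheodory_solution_iff by blast

lemma flow_flow: "flow f t t1 (flow f t1 t0 x) = flow f t t0 x"
  by (rule flow_eqI) (rule caratheodory_solution_restart[OF flow_solution])

text \<open>The constants involve only \<open>K\<close> and \<open>C\<close>, so the estimate is
  uniform over all admissible controls. The maximum of the norm along the way is absorbed on the
  left because \<open>2 * K * \<bar>t - t0\<bar>\<close> is at most 1.\<close>

lemma flow_near:
  assumes "2 * K * \<bar>t - t0\<bar> \<le> 1"
  shows "norm (flow f t t0 x - x) \<le> (2 * K * norm x + 2 * C) * \<bar>t - t0\<bar>"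
proof -
  define J where "J = {min t0 t..max t0 t}"
  define y where "y r = flow f r t0 x" for r
  have "continuous_on J (\<lambda>s. norm (y s))"
    using flow_continuous unfolding y_def by (intro continuous_intros) (auto intro: continuous_on_subset)
  moreover have "compact J" "J \<noteq> {}" by (auto simp: J_def)
  ultimately obtain s where s: "s \<in> J" "\<And>r. r \<in> J \<Longrightarrow> norm (y r) \<le> norm (y s)"
    using continuous_attains_sup[of J "\<lambda>s. norm (y s)"] by blast
  have lb: "loc_bdd (\<lambda>s. f s (y s))"
    unfolding y_def by (intro loc_bdd_comp flow_continuous)
  have est: "norm (y r - x) \<le> (K * norm (y s) + C) * \<bar>r - t0\<bar>" if r: "r \<in> J" for r
  proof -
    have "AE q in lebesgue. q \<in> {min t0 r..max t0 r} \<longrightarrow> norm (f q (y q)) \<le> K * norm (y s) + C"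
      using growth
    proof eventually_elim
      case (elim q)
      show ?case
      proof
        assume "q \<in> {min t0 r..max t0 r}"
        then have "q \<in> J" using r by (auto simp: J_def)
        then have "K * norm (y q) \<le> K * norm (y s)" using s(2) K_pos by simp
        then show "norm (f q (y q)) \<le> K * norm (y s) + C" using elim[rule_format, of "y q"] by linarith
      qed
    qed
    then have "norm (lint t0 r (\<lambda>s. f s (y s))) \<le> (K * norm (y s) + C) * \<bar>r - t0\<bar>"
      by (rule lint_norm_le_const[OF lb])
    moreover have "y r = x + lint t0 r (\<lambda>s. f s (y s))"
      using flow_solution[of t0 x] unfolding caratheodory_solution_iff y_def by blast
    ultimately show ?thesis by (metis add_diff_cancel_left')
  qed
  have "\<bar>s - t0\<bar> \<le> \<bar>t - t0\<bar>" using s(1) by (auto simp: J_def)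
  then have s': "\<bar>s - t0\<bar> \<le> 1 / (2 * K)"
    using order_trans[OF mult_left_mono[of "\<bar>s - t0\<bar>" _ "2 * K"] assms] K_pos by (simp add: field_simps)
  have "norm (y s) \<le> norm x + norm (y s - x)" by (metis norm_triangle_sub)
  also have "\<dots> \<le> norm x + (K * norm (y s) + C) * (1 / (2 * K))"
    using order_trans[OF est[OF s(1)] mult_left_mono[OF s']] K_pos C_nonneg by simp
  finally have "K * norm (y s) \<le> 2 * K * norm x + C"
    using K_pos by (simp add: field_simps)
  then have "(K * norm (y s) + C) * \<bar>t - t0\<bar> \<le> (2 * K * norm x + 2 * C) * \<bar>t - t0\<bar>"
    by (intro mult_right_mono) auto
  with est[of t] show ?thesis by (auto simp: J_def y_def)
qed

text \<open>A doubling argument in place of an exponential estimate: by \<open>flow_near\<close>,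
  each time step of length at most 1/(2K) at most doubles \<open>norm x + C / K\<close>.\<close>

lemma flow_growth:
  assumes "2 * K * \<bar>t - t0\<bar> \<le> real n"
  shows "norm (flow f t t0 x) + C / K \<le> 2 ^ n * (norm x + C / K)"
  using assms
proof (induction n arbitrary: t)
  case 0
  then have "t = t0" using K_pos by (simp add: zero_le_mult_iff mult_le_0_iff)
  then show ?case by simp
next
  case (Suc n)
  define h where "h = 1 / (2 * K)"
  have h: "h > 0" "2 * K * h = 1" using K_pos by (auto simp: h_def)
  have t: "\<bar>t - t0\<bar> \<le> real (Suc n) * h" using Suc.prems K_pos by (simp add: h_def field_simps)
  define s where "s = (if \<bar>t - t0\<bar> \<le> h then t0 else if t \<ge> t0 then t - h else t + h)"
  have s: "\<bar>s - t0\<bar> \<le> real n * h" "\<bar>t - s\<bar> \<le> h"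
    using t h(1) by (auto simp: s_def distrib_right abs_if split: if_splits)
  have s1: "2 * K * \<bar>s - t0\<bar> \<le> real n" "2 * K * \<bar>t - s\<bar> \<le> 1"
    using s K_pos by (auto simp: h_def field_simps)
  define y where "y = flow f s t0 x"
  have "norm (flow f t s y - y) \<le> (2 * K * norm y + 2 * C) * h"
    using order_trans[OF flow_near[OF s1(2)] mult_left_mono[OF s(2)]] K_pos C_nonneg by auto
  also have "\<dots> = norm y + C / K" using K_pos by (simp add: h_def field_simps)
  finally have "norm (flow f t s y) + C / K \<le> 2 * (norm y + C / K)"
    using norm_triangle_sub[of "flow f t s y" y] by argo
  also have "\<dots> \<le> 2 * (2 ^ n * (norm x + C / K))"
    using Suc.IH[OF s1(1)] by (simp add: y_def)
  finally show ?case by (simp add: y_def flow_flow)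
qed

end

section \<open>Linear control systems with periodic coefficients\<close>

lemma bounded_bilinear_matrix_vector_mult:
  "bounded_bilinear ((*v) :: real^'n^'m \<Rightarrow> real^'n \<Rightarrow> real^'m)"
  by (auto simp: bilinear_def linear_iff matrix_vector_right_distrib matrix_vector_mult_scaleR
      matrix_vector_mult_add_rdistrib scaleR_matrix_vector_assoc
      simp flip: bilinear_conv_bounded_bilinear)

lemma bounded_bilinear_matrix_matrix_mult:
  "bounded_bilinear ((**) :: real^'n^'m \<Rightarrow> real^'k^'n \<Rightarrow> real^'k^'m)"
  by (auto simp: bilinear_def linear_iff matrix_matrix_mult_def vec_eq_iff
      algebra_simps sum.distrib sum_distrib_left simp flip: bilinear_conv_bounded_bilinear)

lemma Linf_on_UNIV_iff:
  "Linf_on UNIV g \<longleftrightarrow> g \<in> borel_measurable lebesgue \<and> (\<exists>M. AE t in lebesgue. norm (g t) \<le> M)"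
  by (simp add: Linf_on_def set_borel_measurable_def)

lemma measurable_bounded_bilinear:
  fixes prod :: "'b::euclidean_space \<Rightarrow> 'a::euclidean_space \<Rightarrow> 'c::euclidean_space"
  assumes "bounded_bilinear prod" "A \<in> borel_measurable lebesgue" "u \<in> borel_measurable lebesgue"
  shows "(\<lambda>s. prod (A s) (u s)) \<in> borel_measurable lebesgue"
  by (rule borel_measurable_continuous_Pair[OF assms(2,3)
        bounded_bilinear.continuous_on[OF assms(1) continuous_on_fst[OF continuous_on_id]
          continuous_on_snd[OF continuous_on_id]]])

text \<open>The product stays abstract to serve both the vector equation, with the control term as
  \<open>b\<close>, and the matrix equation of the fundamental solution.\<close>

lemma lip_rhs_affine:
  fixes prod :: "'b::euclidean_space \<Rightarrow> 'a::euclidean_space \<Rightarrow> 'a"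
  assumes prod: "bounded_bilinear prod" and A: "A \<in> borel_measurable lebesgue"
    and AK: "AE s in lebesgue. \<forall>x. norm (prod (A s) x) \<le> K * norm x" and K: "K > 0"
    and b: "b \<in> borel_measurable lebesgue" "AE s in lebesgue. norm (b s) \<le> C" and C: "C \<ge> 0"
  shows "lip_rhs (\<lambda>s x. prod (A s) x + b s) K C"
proof
  interpret bounded_bilinear prod by fact
  show "(\<lambda>s. prod (A s) (x s) + b s) \<in> borel_measurable lebesgue" if x: "continuous_on UNIV x" for x
  proof -
    have "x \<in> borel_measurable lebesgue"
      using x by (intro measurable_completion) (simp add: borel_measurable_continuous_onI)
    then have "(\<lambda>s. prod (A s) (x s)) \<in> borel_measurable lebesgue"
      by (rule measurable_bounded_bilinear[OF prod A])
    then show ?thesis using b by simp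
  qed
  show "AE s in lebesgue. \<forall>x y. norm (prod (A s) x + b s - (prod (A s) y + b s)) \<le> K * norm (x - y)"
    using AK by eventually_elim (simp flip: diff_right)
  show "AE s in lebesgue. norm (prod (A s) 0 + b s) \<le> C"
    using b(2) by (simp add: zero_right)
qed (use K C in auto)

lemma Linf_on_prod_bound:
  fixes prod :: "'b::euclidean_space \<Rightarrow> 'a::euclidean_space \<Rightarrow> 'c::euclidean_space"
  assumes prod: "bounded_bilinear prod" and A: "Linf_on UNIV A"
  obtains K where "K > 0" "AE s in lebesgue. \<forall>x. norm (prod (A s) x) \<le> K * norm x"
proof -
  interpret bounded_bilinear prod by fact
  obtain \<kappa> where \<kappa>: "\<kappa> > 0" "\<And>a b. norm (prod a b) \<le> norm a * norm b * \<kappa>"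
    using pos_bounded by blast
  obtain M where M: "AE s in lebesgue. norm (A s) \<le> M"
    using A by (auto simp: Linf_on_UNIV_iff)
  show ?thesis
  proof (rule that)
    show "(\<bar>M\<bar> + 1) * \<kappa> > 0" using \<kappa> by simp
    show "AE s in lebesgue. \<forall>x. norm (prod (A s) x) \<le> (\<bar>M\<bar> + 1) * \<kappa> * norm x"
      using M
    proof eventually_elim
      case (elim s)
      have "norm (prod (A s) x) \<le> (\<bar>M\<bar> + 1) * \<kappa> * norm x" for x
      proof -
        have "norm (A s) * norm x * \<kappa> \<le> (\<bar>M\<bar> + 1) * norm x * \<kappa>"
          using elim \<kappa> by (intro mult_right_mono) auto
        with \<kappa>(2)[of "A s" x] show ?thesis by (simp add: algebra_simps)
      qed
      then show ?case by blast
    qed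
  qed
qed

lemma lip_rhs_shift:
  assumes "lip_rhs f K C"
  shows "lip_rhs (\<lambda>s. f (s + c)) K C"
proof
  interpret lip_rhs f K C by fact
  show "(\<lambda>s. f (s + c) (x s)) \<in> borel_measurable lebesgue" if "continuous_on UNIV x" for x
  proof -
    have "continuous_on UNIV (\<lambda>s. x (s - c))"
      using that by (intro continuous_on_compose2[OF that] continuous_intros) auto
    from borel_measurable_lebesgue_shift[OF meas[OF this], of c] show ?thesis by simp
  qed
  show "AE s in lebesgue. \<forall>x y. norm (f (s + c) x - f (s + c) y) \<le> K * norm (x - y)"
    using AE_lebesgue_shift[OF lip] .
  show "AE s in lebesgue. norm (f (s + c) 0) \<le> C"
    using AE_lebesgue_shift[OF bdd] .
qed (use assms lip_rhs.K_pos lip_rhs.C_nonneg in blast)+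

lemma flow_shift:
  assumes "lip_rhs f K C"
  shows "flow f (t + c) (t0 + c) x = flow (\<lambda>s. f (s + c)) t t0 x"
proof -
  interpret f: lip_rhs f K C by fact
  interpret g: lip_rhs "\<lambda>s. f (s + c)" K C by (rule lip_rhs_shift[OF assms])
  define y where "y t = flow f t (t0 + c) x" for t
  have y: "continuous_on UNIV y" "\<And>t. y t = x + lint (t0 + c) t (\<lambda>s. f s (y s))"
    using f.flow_solution[of "t0 + c" x] unfolding f.caratheodory_solution_iff y_def by blast+
  have "caratheodory_solution (\<lambda>s. f (s + c)) t0 x (\<lambda>t. y (t + c))"
    unfolding g.caratheodory_solution_iff
  proof (intro conjI allI)
    show "continuous_on UNIV (\<lambda>t. y (t + c))"
      by (intro continuous_on_compose2[OF y(1)] continuous_intros) auto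
    show "y (t + c) = x + lint t0 t (\<lambda>s. f (s + c) (y (s + c)))" for t
      using y(2)[of "t + c"] lint_shift[OF f.loc_bdd_comp[OF y(1)], of t0 c t] by simp
  qed
  from g.flow_eqI[OF this, of t] show ?thesis by (simp add: y_def)
qed

lemma flow_cong_AE:
  assumes "lip_rhs f K C" "lip_rhs g K' C'"
    and "AE s in lebesgue. s \<in> {min t t0..max t t0} \<longrightarrow> f s = g s"
  shows "flow f t t0 x = flow g t t0 x"
  using caratheodory_solution_local_unique[OF assms lip_rhs.flow_solution[OF assms(1)]
      lip_rhs.flow_solution[OF assms(2)], of t0 t x] by auto

lemma ae_periodic_multiple:
  assumes "ae_periodic T f"
  shows "AE t in lebesgue. f (t + of_int k * T) = f t"
proof -
  have nat: "AE t in lebesgue. f (t + real n * T) = f t" for n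
  proof (induction n)
    case (Suc n)
    have "AE t in lebesgue. f (t + T) = f t" using assms by (simp add: ae_periodic_def)
    from AE_lebesgue_shift[OF this, of "real n * T"] Suc
    show ?case by eventually_elim (simp add: algebra_simps)
  qed simp
  show ?thesis
  proof (cases "k \<ge> 0")
    case True
    then show ?thesis using nat[of "nat k"] by simp
  next
    case False
    from AE_lebesgue_shift[OF nat[of "nat (- k)"], of "of_int k * T"] False
    show ?thesis by (auto elim!: eventually_mono)
  qed
qed

lemma Linf_on_UNIV_add: "Linf_on UNIV f \<Longrightarrow> Linf_on UNIV g \<Longrightarrow> Linf_on UNIV (\<lambda>t. f t + g t)"
  unfolding Linf_on_UNIV_iff
proof (elim conjE exE, intro conjI)
  fix M M' assume "AE t in lebesgue. norm (f t) \<le> M" "AE t in lebesgue. norm (g t) \<le> M'"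
  then have "AE t in lebesgue. norm (f t + g t) \<le> M + M'"
    by eventually_elim (auto intro: norm_triangle_mono)
  then show "\<exists>M. AE t in lebesgue. norm (f t + g t) \<le> M" by blast
qed simp

lemma Linf_on_UNIV_scaleR: "Linf_on UNIV f \<Longrightarrow> Linf_on UNIV (\<lambda>t. c *\<^sub>R f t)"
  unfolding Linf_on_UNIV_iff
proof (elim conjE exE, intro conjI)
  fix M assume "AE t in lebesgue. norm (f t) \<le> M"
  then have "AE t in lebesgue. norm (c *\<^sub>R f t) \<le> \<bar>c\<bar> * M"
    by eventually_elim (auto intro: mult_left_mono)
  then show "\<exists>M. AE t in lebesgue. norm (c *\<^sub>R f t) \<le> M" by blast
qed simp

lemma Linf_on_UNIV_zero: "Linf_on UNIV (\<lambda>_. 0)"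
  unfolding Linf_on_UNIV_iff by auto

lemma Linf_on_UNIV_if:
  assumes "Linf_on UNIV f" "Linf_on UNIV g"
  shows "Linf_on UNIV (\<lambda>t. if t < c then f t else g t)"
proof -
  obtain M M' where "AE t in lebesgue. norm (f t) \<le> M" "AE t in lebesgue. norm (g t) \<le> M'"
    using assms by (auto simp: Linf_on_UNIV_iff)
  then have "AE t in lebesgue. norm (if t < c then f t else g t) \<le> max M M'"
    by eventually_elim auto
  moreover have "(\<lambda>t. if t < c then f t else g t) \<in> borel_measurable lebesgue"
    using assms by (intro measurable_If) (auto simp: Linf_on_UNIV_iff)
  ultimately show ?thesis unfolding Linf_on_UNIV_iff by blast
qed

lemma Linf_on_UNIV_shift:
  assumes "Linf_on UNIV f"
  shows "Linf_on UNIV (\<lambda>t. f (t + c))"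
proof -
  obtain M where "AE t in lebesgue. norm (f t) \<le> M"
    using assms by (auto simp: Linf_on_UNIV_iff)
  from AE_lebesgue_shift[OF this] show ?thesis
    using assms borel_measurable_lebesgue_shift by (auto simp: Linf_on_UNIV_iff)
qed

lemma controls_if:
  assumes "u \<in> controls U" "v \<in> controls U"
  shows "(\<lambda>t. if t < c then u t else v t) \<in> controls U"
proof -
  have "AE t in lebesgue. u t \<in> U" "AE t in lebesgue. v t \<in> U"
    using assms by (auto simp: controls_def)
  then have "AE t in lebesgue. (if t < c then u t else v t) \<in> U" by eventually_elim auto
  then show ?thesis using assms Linf_on_UNIV_if by (auto simp: controls_def)
qed

lemma controls_shift: "u \<in> controls U \<Longrightarrow> (\<lambda>t. u (t + c)) \<in> controls U"
  using Linf_on_UNIV_shift AE_lebesgue_shift[of "\<lambda>t. u t \<in> U"] by (auto simp: controls_def)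

lemma controls_convex:
  assumes "convex U" "u \<in> controls U" "v \<in> controls U" "a \<ge> 0" "b \<ge> 0" "a + b = 1"
  shows "(\<lambda>t. a *\<^sub>R u t + b *\<^sub>R v t) \<in> controls U"
proof -
  have "AE t in lebesgue. u t \<in> U" "AE t in lebesgue. v t \<in> U"
    using assms by (auto simp: controls_def)
  then have "AE t in lebesgue. a *\<^sub>R u t + b *\<^sub>R v t \<in> U"
    by eventually_elim (use assms in \<open>auto intro: convexD\<close>)
  then show ?thesis using assms by (simp add: controls_def Linf_on_UNIV_scaleR Linf_on_UNIV_add)
qed

lemma controls_zero: "0 \<in> U \<Longrightarrow> (\<lambda>_. 0) \<in> controls U"
  by (simp add: controls_def Linf_on_UNIV_zero)

text \<open>A control that is merely essentially bounded becomes admissible after scaling into a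
  ball inside \<open>U\<close>. Both signs are provided because \<open>U\<close> need not be
  symmetric.\<close>

lemma controls_scale:
  assumes "0 \<in> interior U" "Linf_on UNIV u"
  obtains \<delta> where "\<delta> > 0" "(\<lambda>t. \<delta> *\<^sub>R u t) \<in> controls U" "(\<lambda>t. - \<delta> *\<^sub>R u t) \<in> controls U"
proof -
  obtain r where r: "r > 0" "cball 0 r \<subseteq> U" using assms(1) mem_interior_cball by blast
  obtain M where M: "AE t in lebesgue. norm (u t) \<le> M" using assms(2) by (auto simp: Linf_on_UNIV_iff)
  define \<delta> where "\<delta> = r / (\<bar>M\<bar> + 1)"
  have \<delta>: "\<delta> > 0" using r by (simp add: \<delta>_def)
  have *: "AE t in lebesgue. c *\<^sub>R u t \<in> U" if "\<bar>c\<bar> = \<delta>" for c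
    using M
  proof eventually_elim
    case (elim t)
    have "\<bar>c\<bar> * norm (u t) \<le> \<delta> * (\<bar>M\<bar> + 1)" using elim that \<delta> by (intro mult_mono) auto
    also have "\<dots> = r" by (simp add: \<delta>_def)
    finally show ?case using r by auto
  qed
  show ?thesis
    using that[OF \<delta>] *[of \<delta>] *[of "- \<delta>"] \<delta> Linf_on_UNIV_scaleR[OF assms(2), of \<delta>]
      Linf_on_UNIV_scaleR[OF assms(2), of "- \<delta>"]
    by (simp add: controls_def)
qed

section \<open>Trajectories and fundamental matrix of the periodic system\<close>

text \<open>\<open>K\<close> and \<open>C\<close> are carried as parameters because the estimates
  have to be uniform over the controls; for bounded \<open>U\<close> such a \<open>C\<close>
  exists.\<close>

locale periodic_control_system =
  fixes T :: real and A :: "real \<Rightarrow> real^'n^'n" and B :: "real \<Rightarrow> real^'m^'n"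
    and U :: "(real^'m) set" and K C :: real
  assumes T_pos: "T > 0"
    and A_Linf: "Linf_on UNIV A" and A_per: "ae_periodic T A"
    and B_Linf: "Linf_on UNIV B" and B_per: "ae_periodic T B"
    and convex_U: "convex U" and zero_U: "0 \<in> interior U"
    and A_bound: "AE s in lebesgue. \<forall>x. norm (A s *v x) \<le> K * norm x" and K_pos: "K > 0"
    and B_bound: "AE s in lebesgue. \<forall>w\<in>U. norm (B s *v w) \<le> C" and C_nonneg: "C \<ge> 0"
begin

abbreviation \<phi> :: "real \<Rightarrow> real \<Rightarrow> real^'n \<Rightarrow> (real \<Rightarrow> real^'m) \<Rightarrow> real^'n" where
  "\<phi> \<equiv> traj A B"

abbreviation X :: "real \<Rightarrow> real \<Rightarrow> real^'n^'n" where
  "X \<equiv> fund_sol A"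

definition rhs :: "(real \<Rightarrow> real^'m) \<Rightarrow> real \<Rightarrow> real^'n \<Rightarrow> real^'n" where
  "rhs u = (\<lambda>s y. A s *v y + B s *v u s)"

lemma traj_eq_flow: "\<phi> t s x u = flow (rhs u) t s x"
  by (simp add: traj_def flow_def rhs_def)

lemma B_measurable: "Linf_on UNIV u \<Longrightarrow> (\<lambda>s. B s *v u s) \<in> borel_measurable lebesgue"
  using B_Linf by (intro measurable_bounded_bilinear[OF bounded_bilinear_matrix_vector_mult])
                  (auto simp: Linf_on_UNIV_iff)

lemma lip_rhs_Linf:
  assumes "Linf_on UNIV u"
  obtains C' where "lip_rhs (rhs u) K C'"
proof -
  obtain K' where K': "K' > 0" "AE s in lebesgue. \<forall>w. norm (B s *v w) \<le> K' * norm w"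
    using Linf_on_prod_bound[OF bounded_bilinear_matrix_vector_mult B_Linf] .
  obtain M where M: "AE s in lebesgue. norm (u s) \<le> M" using assms by (auto simp: Linf_on_UNIV_iff)
  have "AE s in lebesgue. norm (B s *v u s) \<le> K' * \<bar>M\<bar>"
    using K'(2) M
  proof eventually_elim
    case (elim s)
    have "K' * norm (u s) \<le> K' * \<bar>M\<bar>" using elim K'(1) by (intro mult_left_mono) auto
    with elim(1)[rule_format, of "u s"] show ?case by linarith
  qed
  then have "lip_rhs (rhs u) K (K' * \<bar>M\<bar>)"
    unfolding rhs_def using A_Linf A_bound K_pos K' B_measurable[OF assms]
    by (intro lip_rhs_affine[OF bounded_bilinear_matrix_vector_mult]) (auto simp: Linf_on_UNIV_iff)
  then show ?thesis by (rule that)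
qed

lemma lip_rhs_controls:
  assumes "u \<in> controls U"
  shows "lip_rhs (rhs u) K C"
proof -
  have "AE s in lebesgue. u s \<in> U" using assms by (simp add: controls_def)
  with B_bound have "AE s in lebesgue. norm (B s *v u s) \<le> C" by eventually_elim auto
  then show ?thesis
    unfolding rhs_def using A_Linf A_bound K_pos C_nonneg B_measurable assms
    by (intro lip_rhs_affine[OF bounded_bilinear_matrix_vector_mult])
       (auto simp: Linf_on_UNIV_iff controls_def)
qed

lemma controls_Linf: "u \<in> controls U \<Longrightarrow> Linf_on UNIV u"
  by (simp add: controls_def)

lemma zero_control [simp]: "(\<lambda>_. 0) \<in> controls U"
  using zero_U interior_subset controls_zero by blast

lemma traj_same [simp]: "Linf_on UNIV u \<Longrightarrow> \<phi> t t x u = x"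
  unfolding traj_eq_flow using lip_rhs_Linf lip_rhs.flow_same by metis

lemma traj_traj: "Linf_on UNIV u \<Longrightarrow> \<phi> t r (\<phi> r s x u) u = \<phi> t s x u"
  unfolding traj_eq_flow using lip_rhs_Linf lip_rhs.flow_flow by metis

text \<open>Superposition in state and control together. It yields convexity of the reachable sets,
  homogeneity, and the splitting into free and forced motion.\<close>

lemma traj_linear:
  assumes u: "Linf_on UNIV u" and v: "Linf_on UNIV v"
  shows "\<phi> t s (a *\<^sub>R x + b *\<^sub>R y) (\<lambda>r. a *\<^sub>R u r + b *\<^sub>R v r) = a *\<^sub>R \<phi> t s x u + b *\<^sub>R \<phi> t s y v"
proof -
  obtain C1 C2 C3 where l: "lip_rhs (rhs u) K C1" "lip_rhs (rhs v) K C2"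
    "lip_rhs (rhs (\<lambda>r. a *\<^sub>R u r + b *\<^sub>R v r)) K C3"
    using lip_rhs_Linf u v Linf_on_UNIV_add[OF Linf_on_UNIV_scaleR Linf_on_UNIV_scaleR, OF u v]
    by metis
  interpret u: lip_rhs "rhs u" K C1 by fact
  interpret v: lip_rhs "rhs v" K C2 by fact
  interpret w: lip_rhs "rhs (\<lambda>r. a *\<^sub>R u r + b *\<^sub>R v r)" K C3 by fact
  define p where "p t = \<phi> t s x u" for t
  define q where "q t = \<phi> t s y v" for t
  have p: "continuous_on UNIV p" "\<And>t. p t = x + lint s t (\<lambda>r. rhs u r (p r))"
    using u.flow_solution[of s x] unfolding u.caratheodory_solution_iff p_def traj_eq_flow by blast+
  have q: "continuous_on UNIV q" "\<And>t. q t = y + lint s t (\<lambda>r. rhs v r (q r))"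
    using v.flow_solution[of s y] unfolding v.caratheodory_solution_iff q_def traj_eq_flow by blast+
  have "caratheodory_solution (rhs (\<lambda>r. a *\<^sub>R u r + b *\<^sub>R v r)) s (a *\<^sub>R x + b *\<^sub>R y)
      (\<lambda>t. a *\<^sub>R p t + b *\<^sub>R q t)"
    unfolding w.caratheodory_solution_iff
  proof (intro conjI allI)
    show "continuous_on UNIV (\<lambda>t. a *\<^sub>R p t + b *\<^sub>R q t)" by (intro continuous_intros p q)
    fix t
    have l: "loc_bdd (\<lambda>r. a *\<^sub>R rhs u r (p r))" "loc_bdd (\<lambda>r. b *\<^sub>R rhs v r (q r))"
      by (intro loc_bdd_scaleR u.loc_bdd_comp v.loc_bdd_comp p q)+
    have "lint s t (\<lambda>r. rhs (\<lambda>r. a *\<^sub>R u r + b *\<^sub>R v r) r (a *\<^sub>R p r + b *\<^sub>R q r))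
        = lint s t (\<lambda>r. a *\<^sub>R rhs u r (p r) + b *\<^sub>R rhs v r (q r))"
      by (simp add: rhs_def matrix_vector_right_distrib matrix_vector_mult_scaleR algebra_simps)
    also have "\<dots> = a *\<^sub>R lint s t (\<lambda>r. rhs u r (p r)) + b *\<^sub>R lint s t (\<lambda>r. rhs v r (q r))"
      using lint_add[OF l] lint_bounded_linear[OF u.loc_bdd_comp[OF p(1)] bounded_linear_scaleR_right]
        lint_bounded_linear[OF v.loc_bdd_comp[OF q(1)] bounded_linear_scaleR_right] by metis
    also have "\<dots> = a *\<^sub>R (p t - x) + b *\<^sub>R (q t - y)"
      using p(2)[of t] q(2)[of t] by (metis add_diff_cancel_left')
    finally show "a *\<^sub>R p t + b *\<^sub>R q t = a *\<^sub>R x + b *\<^sub>R y +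
        lint s t (\<lambda>r. rhs (\<lambda>r. a *\<^sub>R u r + b *\<^sub>R v r) r (a *\<^sub>R p r + b *\<^sub>R q r))"
      by (simp add: algebra_simps)
  qed
  from w.flow_eqI[OF this] show ?thesis by (simp add: traj_eq_flow p_def q_def)
qed

lemma traj_scaleR: "Linf_on UNIV u \<Longrightarrow> \<phi> t s (a *\<^sub>R x) (\<lambda>r. a *\<^sub>R u r) = a *\<^sub>R \<phi> t s x u"
  using traj_linear[of u u t s a x 0 x] by simp

text \<open>Evaluation at \<open>x\<close> is bounded linear and maps the matrix solution to a
  solution of the vector equation. The rules for \<open>X\<close> are then read off from
  \<open>\<phi>\<close> with zero control.\<close>

lemma traj_fund_sol: "\<phi> t s x (\<lambda>_. 0) = X t s *v x"
proof -
  obtain K' where K': "K' > 0" "AE s in lebesgue. \<forall>Y. norm (A s ** Y) \<le> K' * norm (Y :: real^'n^'n)"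
    using Linf_on_prod_bound[OF bounded_bilinear_matrix_matrix_mult A_Linf] .
  have "lip_rhs (\<lambda>r Y. A r ** Y + (0::real^'n^'n)) K' 0"
    using K' A_Linf by (intro lip_rhs_affine[OF bounded_bilinear_matrix_matrix_mult]) (auto simp: Linf_on_UNIV_iff)
  then interpret M: lip_rhs "\<lambda>r Y. A r ** Y :: real^'n^'n" K' 0 by simp
  interpret lip_rhs "rhs (\<lambda>_. 0)" K C by (rule lip_rhs_controls[OF zero_control])
  have flow: "X = (\<lambda>t s. flow (\<lambda>r Y. A r ** Y) t s (mat 1))"
    by (simp add: fund_sol_def flow_def fun_eq_iff)
  define Z where "Z t = X t s" for t
  have Z: "continuous_on UNIV Z" "\<And>t. Z t = mat 1 + lint s t (\<lambda>r. A r ** Z r)"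
    using M.flow_solution[of s "mat 1"] unfolding M.caratheodory_solution_iff Z_def flow by blast+
  have bl: "bounded_linear (\<lambda>Y. Y *v x)"
    by (rule bounded_bilinear.bounded_linear_left[OF bounded_bilinear_matrix_vector_mult])
  have "caratheodory_solution (rhs (\<lambda>_. 0)) s x (\<lambda>t. Z t *v x)"
    unfolding caratheodory_solution_iff
  proof (intro conjI allI)
    show "continuous_on UNIV (\<lambda>t. Z t *v x)"
      by (rule bounded_linear.continuous_on[OF bl Z(1)])
    fix t
    have "Z t *v x = x + lint s t (\<lambda>r. A r ** Z r) *v x"
      using Z(2)[of t] by (metis matrix_vector_mul_lid matrix_vector_mult_add_rdistrib)
    also have "lint s t (\<lambda>r. A r ** Z r) *v x = lint s t (\<lambda>r. (A r ** Z r) *v x)"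
      by (rule lint_bounded_linear[OF M.loc_bdd_comp[OF Z(1)] bl, symmetric])
    finally show "Z t *v x = x + lint s t (\<lambda>r. rhs (\<lambda>_. 0) r (Z r *v x))"
      by (simp add: rhs_def matrix_vector_mul_assoc)
  qed
  from flow_eqI[OF this, of t] show ?thesis by (simp add: traj_eq_flow Z_def)
qed

lemma traj_decomp: "Linf_on UNIV u \<Longrightarrow> \<phi> t s x u = X t s *v x + \<phi> t s 0 u"
  using traj_linear[of "\<lambda>_. 0" u t s 1 x 1 0] by (simp add: traj_fund_sol Linf_on_UNIV_zero)

lemma fund_sol_same [simp]: "X t t = mat 1"
  using traj_fund_sol[of t t] by (simp add: matrix_eq Linf_on_UNIV_zero)

lemma fund_sol_mult: "X t r ** X r s = X t s"
  using traj_traj[OF Linf_on_UNIV_zero, of t r s]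
  by (simp add: traj_fund_sol matrix_eq matrix_vector_mul_assoc)

lemma fund_sol_vec: "X t r *v (X r s *v x) = X t s *v x"
  by (simp add: matrix_vector_mul_assoc fund_sol_mult)

lemma matrix_inv_fund_sol: "matrix_inv (X t s) = X s t"
proof -
  have "X t s ** matrix_inv (X t s) = mat 1"
    unfolding matrix_inv_def
    by (rule someI2[of _ "X s t"]) (simp_all add: fund_sol_mult)
  then have "X s t ** (X t s ** matrix_inv (X t s)) = X s t" by simp
  then show ?thesis by (simp add: matrix_mul_assoc fund_sol_mult)
qed

lemma traj_cong_AE:
  assumes "Linf_on UNIV u" "Linf_on UNIV v"
    and "AE r in lebesgue. r \<in> {min t s..max t s} \<longrightarrow> u r = v r"
  shows "\<phi> t s x u = \<phi> t s x v"
proof -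
  obtain C1 C2 where "lip_rhs (rhs u) K C1" "lip_rhs (rhs v) K C2"
    using assms lip_rhs_Linf by metis
  moreover have "AE r in lebesgue. r \<in> {min t s..max t s} \<longrightarrow> rhs u r = rhs v r"
    using assms(3) by eventually_elim (auto simp: rhs_def)
  ultimately show ?thesis
    unfolding traj_eq_flow by (rule flow_cong_AE)
qed

lemma traj_shift:
  assumes "Linf_on UNIV u"
  shows "\<phi> (t + of_int k * T) (s + of_int k * T) x u = \<phi> t s x (\<lambda>r. u (r + of_int k * T))"
proof -
  obtain C1 C2 where l: "lip_rhs (rhs u) K C1" "lip_rhs (rhs (\<lambda>r. u (r + of_int k * T))) K C2"
    using assms lip_rhs_Linf Linf_on_UNIV_shift by metis
  have "AE r in lebesgue. rhs u (r + of_int k * T) = rhs (\<lambda>r. u (r + of_int k * T)) r"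
    using ae_periodic_multiple[OF A_per, of k] ae_periodic_multiple[OF B_per, of k]
    by eventually_elim (simp add: rhs_def)
  then have "flow (\<lambda>r. rhs u (r + of_int k * T)) t s x = flow (rhs (\<lambda>r. u (r + of_int k * T))) t s x"
    by (intro flow_cong_AE[OF lip_rhs_shift[OF l(1)] l(2)]) (auto elim: eventually_mono)
  then show ?thesis unfolding traj_eq_flow flow_shift[OF l(1)] .
qed

lemma fund_sol_shift: "X (t + of_int k * T) (s + of_int k * T) = X t s"
  using traj_shift[OF Linf_on_UNIV_zero, of t k s] by (simp add: traj_fund_sol matrix_eq)

lemma traj_switch:
  assumes u: "Linf_on UNIV u" and v: "Linf_on UNIV v" and "s \<le> c" "c \<le> t"
  shows "\<phi> t s x (\<lambda>r. if r < c then u r else v r) = \<phi> t c (\<phi> c s x u) v"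
proof -
  define w where "w r = (if r < c then u r else v r)" for r
  have w: "Linf_on UNIV w" unfolding w_def by (rule Linf_on_UNIV_if[OF u v])
  \<comment> \<open>The switched control takes the value of \<open>v\<close> at \<open>c\<close>, so
    up to time \<open>c\<close> it agrees with \<open>u\<close> only off this single point.\<close>
  have "AE r in lebesgue. r \<noteq> c"
    by (rule AE_I'[of "{c}"]) (auto simp flip: negligible_iff_null_sets)
  then have "AE r in lebesgue. r \<in> {min c s..max c s} \<longrightarrow> w r = u r"
    by eventually_elim (use assms in \<open>auto simp: w_def\<close>)
  then have "\<phi> c s x w = \<phi> c s x u" by (rule traj_cong_AE[OF w u])
  moreover have "\<phi> t c y w = \<phi> t c y v" for y
    using assms by (intro traj_cong_AE[OF w v]) (auto simp: w_def)
  ultimately have "\<phi> t s x w = \<phi> t c (\<phi> c s x u) v" using traj_traj[OF w, of t c s x] by simp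
  then show ?thesis unfolding w_def .
qed

lemma traj_near:
  assumes "u \<in> controls U" "2 * K * \<bar>t - s\<bar> \<le> 1"
  shows "norm (\<phi> t s x u - x) \<le> (2 * K * norm x + 2 * C) * \<bar>t - s\<bar>"
  unfolding traj_eq_flow by (rule lip_rhs.flow_near[OF lip_rhs_controls[OF assms(1)] assms(2)])

lemma traj_bounded:
  obtains c where "c \<ge> 0" "\<And>t s x u. u \<in> controls U \<Longrightarrow> \<bar>t - s\<bar> \<le> h \<Longrightarrow> norm (\<phi> t s x u) \<le> c * (norm x + 1)"
proof -
  obtain n where n: "2 * K * \<bar>h\<bar> \<le> real n" using real_arch_simple by blast
  show ?thesis
  proof (rule that)
    \<comment> \<open>The power of 2 comes from the \<open>n\<close> doubling steps of
      \<open>flow_growth\<close>; the maximum dominates both coefficients in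
      \<open>norm x + C / K\<close>.\<close>
    show "2 ^ n * max 1 (C / K) \<ge> 0" by simp
    fix t s x u assume u: "u \<in> controls U" and ts: "\<bar>t - s\<bar> \<le> h"
    have "2 * K * \<bar>t - s\<bar> \<le> real n"
      using order_trans[OF mult_left_mono[of "\<bar>t - s\<bar>" "\<bar>h\<bar>" "2 * K"] n] ts K_pos by auto
    then have "norm (\<phi> t s x u) + C / K \<le> 2 ^ n * (norm x + C / K)"
      unfolding traj_eq_flow by (rule lip_rhs.flow_growth[OF lip_rhs_controls[OF u]])
    moreover have "norm x + C / K \<le> max 1 (C / K) * (norm x + 1)"
      unfolding distrib_left by (intro add_mono) (auto simp: mult_le_cancel_right1)
    ultimately have "norm (\<phi> t s x u) + C / K \<le> 2 ^ n * (max 1 (C / K) * (norm x + 1))"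
      by (meson mult_left_mono order_trans zero_le_numeral zero_le_power)
    moreover have "C / K \<ge> 0" using C_nonneg K_pos by simp
    ultimately show "norm (\<phi> t s x u) \<le> 2 ^ n * max 1 (C / K) * (norm x + 1)"
      by (simp add: mult.assoc)
  qed
qed

text \<open>The control may change with the index because \<open>traj_near\<close> is uniform over
  controls. This serves the situations where each member of a sequence is carried to time
  \<open>t\<close> by its own control.\<close>

lemma traj_tendsto_initial:
  assumes u: "\<And>i. u i \<in> controls U" and s: "(s \<longlongrightarrow> t) F" and x: "((\<lambda>i. x i) \<longlongrightarrow> y) F"
  shows "((\<lambda>i. \<phi> t (s i) (x i) (u i) - x i) \<longlongrightarrow> 0) F"
proof (rule Lim_null_comparison)
  have "\<forall>\<^sub>F i in F. \<bar>t - s i\<bar> < 1 / (2 * K)"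
    using tendstoD[OF s, of "1 / (2 * K)"] K_pos by (simp add: dist_real_def abs_minus_commute)
  then show "\<forall>\<^sub>F i in F. norm (\<phi> t (s i) (x i) (u i) - x i) \<le> (2 * K * norm (x i) + 2 * C) * \<bar>t - s i\<bar>"
  proof eventually_elim
    case (elim i)
    then show ?case using K_pos by (intro traj_near u) (simp add: field_simps)
  qed
  have "((\<lambda>i. (2 * K * norm (x i) + 2 * C) * \<bar>t - s i\<bar>) \<longlongrightarrow> (2 * K * norm y + 2 * C) * \<bar>t - t\<bar>) F"
    by (intro tendsto_intros s x)
  then show "((\<lambda>i. (2 * K * norm (x i) + 2 * C) * \<bar>t - s i\<bar>) \<longlongrightarrow> 0) F" by simp
qed

lemma traj_tendsto:
  assumes u: "u \<in> controls U" and s: "(s \<longlongrightarrow> t) F" and x: "(x \<longlongrightarrow> y) F"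
  shows "((\<lambda>i. \<phi> r (s i) (x i) u) \<longlongrightarrow> \<phi> r t y u) F"
proof -
  have "((\<lambda>i. (\<phi> t (s i) (x i) u - x i) + x i) \<longlongrightarrow> 0 + y) F"
    by (intro tendsto_add traj_tendsto_initial[OF u s x] x)
  then have "((\<lambda>i. X r t *v \<phi> t (s i) (x i) u + \<phi> r t 0 u) \<longlongrightarrow> X r t *v y + \<phi> r t 0 u) F"
    by (intro tendsto_intros bounded_linear.tendsto[OF matrix_vector_mul_bounded_linear]) simp
  moreover have "X r t *v z + \<phi> r t 0 u = \<phi> r t z u" for z
    by (rule traj_decomp[OF controls_Linf[OF u], symmetric])
  ultimately show ?thesis by (simp add: traj_traj controls_Linf[OF u])
qed

end

section \<open>Fibers of the reachable and controllable sets\<close>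

text \<open>The union of the earlier sets is convex by monotonicity, so passing to its closure adds
  no interior points and \<open>x\<close> is interior to the union itself. A small cube around
  \<open>x\<close> has finitely many vertices; they lie in one common \<open>Z s\<close>, and
  convexity puts the whole cube there.\<close>

lemma interior_Union_mono_convex:
  fixes Z :: "real \<Rightarrow> 'a::euclidean_space set"
  assumes mono: "\<And>s t. s \<le> t \<Longrightarrow> Z s \<subseteq> Z t" and convex: "\<And>s. convex (Z s)"
    and left: "Z t \<subseteq> closure (\<Union>s\<in>{..<t}. Z s)" and x: "x \<in> interior (Z t)"
  obtains s where "s < t" "x \<in> interior (Z s)"
proof -
  let ?Q = "\<Union>s\<in>{..<t}. Z s"
  have "convex ?Q"
  proof (rule convexI)
    fix y z and a b :: real
    assume "y \<in> ?Q" "z \<in> ?Q" and ab: "0 \<le> a" "0 \<le> b" "a + b = 1"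
    then obtain r s where rs: "r < t" "s < t" "y \<in> Z r" "z \<in> Z s" by auto
    then have "y \<in> Z (max r s)" "z \<in> Z (max r s)" using mono[of r "max r s"] mono[of s "max r s"] by auto
    then have "a *\<^sub>R y + b *\<^sub>R z \<in> Z (max r s)" by (intro convexD[OF convex] ab)
    then show "a *\<^sub>R y + b *\<^sub>R z \<in> ?Q" using rs by (intro UN_I[of "max r s"]) auto
  qed
  moreover have "x \<in> interior (closure ?Q)"
    using x interior_mono[OF left] by blast
  ultimately have "x \<in> interior ?Q" by (simp add: convex_interior_closure)
  then obtain e where e: "e > 0" "cball x e \<subseteq> ?Q" using mem_interior_cball by blast
  \<comment> \<open>By the l1 bound for the norm, a cube with this half-width fits into the ball of
    radius \<open>e\<close>.\<close>
  define d where "d = e / real DIM('a)"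
  have d: "d > 0" using e by (simp add: d_def)
  let ?l = "x - (\<Sum>i\<in>Basis. d *\<^sub>R i)" and ?u = "x + (\<Sum>i\<in>Basis. d *\<^sub>R i)"
  obtain F :: "'a set" where F: "finite F" "cbox ?l ?u = convex hull F"
    using cube_convex_hull[OF d] by blast
  have "cbox ?l ?u \<subseteq> cball x e"
  proof
    fix y assume y: "y \<in> cbox ?l ?u"
    have "norm (y - x) \<le> (\<Sum>i\<in>Basis. \<bar>(y - x) \<bullet> i\<bar>)" by (rule norm_le_l1)
    also have "\<dots> \<le> (\<Sum>i\<in>(Basis::'a set). d)"
      using y by (intro sum_mono) (auto simp: mem_box inner_diff_left inner_add_left abs_le_iff algebra_simps)
    also have "\<dots> = e" by (simp add: d_def)
    finally show "y \<in> cball x e" by (simp add: dist_norm norm_minus_commute)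
  qed
  then have "F \<subseteq> ?Q" using F(2) hull_subset[of F convex] e(2) by blast
  then obtain g where g: "\<And>v. v \<in> F \<Longrightarrow> g v < t \<and> v \<in> Z (g v)" by (metis UN_E lessThan_iff subsetD)
  \<comment> \<open>The additional member \<open>t - 1\<close> makes the maximum well defined
    without knowing that \<open>F\<close> is nonempty.\<close>
  define s where "s = Max (insert (t - 1) (g ` F))"
  have "s < t" using F(1) g by (auto simp: s_def)
  moreover have "F \<subseteq> Z s"
  proof
    fix v assume v: "v \<in> F"
    then have "g v \<le> s" using F(1) by (simp add: s_def)
    with mono g v show "v \<in> Z s" by blast
  qed
  then have "cbox ?l ?u \<subseteq> Z s" unfolding F(2) using convex by (simp add: hull_minimal)
  then have "box ?l ?u \<subseteq> interior (Z s)"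
    by (meson box_subset_cbox interior_maximal open_box order_trans)
  then have "x \<in> interior (Z s)"
    using d by (auto simp: mem_box inner_diff_left inner_add_left)
  ultimately show ?thesis by (rule that)
qed

context periodic_control_system
begin

section \<open>Fibers at arbitrary real times\<close>

definition RF :: "real \<Rightarrow> (real^'n) set" where
  "RF t = {\<phi> t s 0 u | s u. s \<le> t \<and> u \<in> controls U}"

definition CF :: "real \<Rightarrow> (real^'n) set" where
  "CF t = {y. \<exists>r\<ge>t. \<exists>u\<in>controls U. \<phi> r t y u = 0}"

lemma traj_zero [simp]: "\<phi> t s 0 (\<lambda>_. 0) = 0"
  by (simp add: traj_fund_sol)

lemma traj_switch_controls:
  assumes "u \<in> controls U" "v \<in> controls U" "s \<le> c" "c \<le> t"
  obtains w where "w \<in> controls U" "\<And>x. \<phi> t s x w = \<phi> t c (\<phi> c s x u) v"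
  using that[OF controls_if[OF assms(1,2), of c]] traj_switch[of u v s c t] assms by (simp add: controls_Linf)

lemma traj_shift_controls:
  assumes "u \<in> controls U"
  obtains v where "v \<in> controls U" "\<And>t s x. \<phi> (t + of_int k * T) (s + of_int k * T) x v = \<phi> t s x u"
proof (rule that)
  show "(\<lambda>r. u (r + - (of_int k * T))) \<in> controls U" using controls_shift[OF assms] .
  then show "\<phi> (t + of_int k * T) (s + of_int k * T) x (\<lambda>r. u (r + - (of_int k * T))) = \<phi> t s x u" for t s x
    by (subst traj_shift) (simp_all add: controls_Linf)
qed

text \<open>The origin is at rest under zero control, so waiting there realizes every earlier start
  time. Common start times, used for convexity, and starts at multiples of T follow.\<close>

lemma RF_earlier:
  assumes "x \<in> RF t"
  obtains s1 where "s1 \<le> t" "\<And>s. s \<le> s1 \<Longrightarrow> \<exists>u\<in>controls U. x = \<phi> t s 0 u"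
proof -
  obtain s1 v where s1: "s1 \<le> t" "v \<in> controls U" "x = \<phi> t s1 0 v" using assms by (auto simp: RF_def)
  have "\<exists>u\<in>controls U. x = \<phi> t s 0 u" if "s \<le> s1" for s
    using traj_switch_controls[OF zero_control s1(2) that s1(1)] s1(3) by (metis traj_zero)
  with s1(1) show ?thesis using that by blast
qed

lemma CF_later:
  assumes "y \<in> CF t"
  obtains r1 where "r1 \<ge> t" "\<And>r. r \<ge> r1 \<Longrightarrow> \<exists>u\<in>controls U. \<phi> r t y u = 0"
proof -
  obtain r1 v where r1: "r1 \<ge> t" "v \<in> controls U" "\<phi> r1 t y v = 0" using assms by (auto simp: CF_def)
  have "\<exists>u\<in>controls U. \<phi> r t y u = 0" if "r \<ge> r1" for r
    using traj_switch_controls[OF r1(2) zero_control r1(1) that] r1(3) by (metis traj_zero)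
  with r1(1) show ?thesis using that by blast
qed

lemma RF_forward:
  assumes "x \<in> RF t" "u \<in> controls U" "t \<le> t'"
  shows "\<phi> t' t x u \<in> RF t'"
proof -
  obtain s v where s: "s \<le> t" "v \<in> controls U" "x = \<phi> t s 0 v" using assms(1) by (auto simp: RF_def)
  show ?thesis
    using traj_switch_controls[OF s(2) assms(2) s(1) assms(3)] s assms(3)
    by (auto simp: RF_def) (metis order_trans)
qed

lemma CF_backward:
  assumes "\<phi> t' t y u \<in> CF t'" "u \<in> controls U" "t \<le> t'"
  shows "y \<in> CF t"
proof -
  obtain r v where r: "r \<ge> t'" "v \<in> controls U" "\<phi> r t' (\<phi> t' t y u) v = 0"
    using assms(1) by (auto simp: CF_def)
  show ?thesis
    using traj_switch_controls[OF assms(2) r(2) assms(3) r(1)] r assms(3)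
    by (auto simp: CF_def) (metis order_trans)
qed

lemma zero_RF: "0 \<in> RF t"
  unfolding RF_def by (intro CollectI exI[of _ t] exI[of _ "\<lambda>_. 0"]) simp

lemma zero_CF: "0 \<in> CF t"
  unfolding CF_def by (intro CollectI exI[of _ t] bexI[of _ "\<lambda>_. 0"] conjI) simp_all

text \<open>Forward in time this is \<open>RF_forward\<close>. Backward, the point is taken back
  along the trajectory that produced it; if that trajectory started after \<open>t\<close>, a rest
  at 0 is prepended and the origin is met at time \<open>t\<close>.\<close>

lemma RF_reverse:
  assumes "x \<in> RF t'"
  obtains u where "u \<in> controls U" "\<phi> t t' x u \<in> RF t"
proof (cases "t' \<le> t")
  case True
  then show ?thesis using that RF_forward[OF assms zero_control] zero_control by blast
next
  case False
  obtain s v where s: "s \<le> t'" "v \<in> controls U" "x = \<phi> t' s 0 v" using assms by (auto simp: RF_def)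
  show ?thesis
  proof (cases "s \<le> t")
    case True
    then have "\<phi> t t' x v \<in> RF t"
      using s by (auto simp: RF_def traj_traj controls_Linf)
    with s(2) show ?thesis using that by blast
  next
    case False
    obtain w where w: "w \<in> controls U" "\<And>x. \<phi> t' t x w = \<phi> t' s (\<phi> s t x (\<lambda>_. 0)) v"
      by (rule traj_switch_controls[OF zero_control s(2) _ s(1), of t]) (use False that in auto)
    then have "x = \<phi> t' t 0 w" using s by simp
    then have "\<phi> t t' x w = 0" using w(1) by (simp add: traj_traj controls_Linf)
    then show ?thesis using that[OF w(1)] zero_RF by simp
  qed
qed

lemma RF_shift: "RF (t + of_int k * T) = RF t"
proof -
  have sub: "RF t \<subseteq> RF (t + of_int k * T)" for t k
  proof
    fix x assume "x \<in> RF t"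
    then obtain s u where s: "s \<le> t" "u \<in> controls U" "x = \<phi> t s 0 u" by (auto simp: RF_def)
    obtain v where "v \<in> controls U" "\<And>t s x. \<phi> (t + of_int k * T) (s + of_int k * T) x v = \<phi> t s x u"
      by (rule traj_shift_controls[OF s(2)]) (rule that)
    then show "x \<in> RF (t + of_int k * T)" using s unfolding RF_def
      by (intro CollectI exI[of _ "s + of_int k * T"] exI[of _ v]) auto
  qed
  from sub[of t k] sub[of "t + of_int k * T" "- k"] show ?thesis by auto
qed

lemma CF_shift: "CF (t + of_int k * T) = CF t"
proof -
  have sub: "CF t \<subseteq> CF (t + of_int k * T)" for t k
  proof
    fix y assume "y \<in> CF t"
    then obtain r u where r: "r \<ge> t" "u \<in> controls U" "\<phi> r t y u = 0" by (auto simp: CF_def)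
    obtain v where "v \<in> controls U" "\<And>t s x. \<phi> (t + of_int k * T) (s + of_int k * T) x v = \<phi> t s x u"
      by (rule traj_shift_controls[OF r(2)]) (rule that)
    then show "y \<in> CF (t + of_int k * T)" using r unfolding CF_def
      by (intro CollectI exI[of _ "r + of_int k * T"] conjI bexI[of _ v]) auto
  qed
  from sub[of t k] sub[of "t + of_int k * T" "- k"] show ?thesis by auto
qed

lemma convex_RF: "convex (RF t)"
proof (rule convexI)
  fix x y and a b :: real
  assume x: "x \<in> RF t" and y: "y \<in> RF t" and ab: "0 \<le> a" "0 \<le> b" "a + b = 1"
  obtain s1 where s1: "s1 \<le> t" "\<And>s. s \<le> s1 \<Longrightarrow> \<exists>u\<in>controls U. x = \<phi> t s 0 u" by (rule RF_earlier[OF x]) (rule that)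
  obtain s2 where s2: "s2 \<le> t" "\<And>s. s \<le> s2 \<Longrightarrow> \<exists>u\<in>controls U. y = \<phi> t s 0 u" by (rule RF_earlier[OF y]) (rule that)
  obtain u v where uv: "u \<in> controls U" "v \<in> controls U" "x = \<phi> t (min s1 s2) 0 u" "y = \<phi> t (min s1 s2) 0 v"
    using s1(2)[of "min s1 s2"] s2(2)[of "min s1 s2"] by auto
  have "a *\<^sub>R x + b *\<^sub>R y = \<phi> t (min s1 s2) 0 (\<lambda>r. a *\<^sub>R u r + b *\<^sub>R v r)"
    using traj_linear[of u v t "min s1 s2" a 0 b 0] uv by (simp add: controls_Linf)
  then show "a *\<^sub>R x + b *\<^sub>R y \<in> RF t"
    unfolding RF_def using s1(1) controls_convex[OF convex_U uv(1,2) ab]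
    by (intro CollectI exI[of _ "min s1 s2"]) auto
qed

lemma convex_CF: "convex (CF t)"
proof (rule convexI)
  fix x y and a b :: real
  assume x: "x \<in> CF t" and y: "y \<in> CF t" and ab: "0 \<le> a" "0 \<le> b" "a + b = 1"
  obtain s1 where s1: "s1 \<ge> t" "\<And>s. s \<ge> s1 \<Longrightarrow> \<exists>u\<in>controls U. \<phi> s t x u = 0" by (rule CF_later[OF x]) (rule that)
  obtain s2 where s2: "s2 \<ge> t" "\<And>s. s \<ge> s2 \<Longrightarrow> \<exists>u\<in>controls U. \<phi> s t y u = 0" by (rule CF_later[OF y]) (rule that)
  obtain u v where uv: "u \<in> controls U" "v \<in> controls U" "\<phi> (max s1 s2) t x u = 0" "\<phi> (max s1 s2) t y v = 0"
    using s1(2)[of "max s1 s2"] s2(2)[of "max s1 s2"] by auto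
  have "\<phi> (max s1 s2) t (a *\<^sub>R x + b *\<^sub>R y) (\<lambda>r. a *\<^sub>R u r + b *\<^sub>R v r) = 0"
    using traj_linear[of u v "max s1 s2" t a x b y] uv by (simp add: controls_Linf)
  then show "a *\<^sub>R x + b *\<^sub>R y \<in> CF t"
    unfolding CF_def using s1(1) controls_convex[OF convex_U uv(1,2) ab]
    by (intro CollectI exI[of _ "max s1 s2"]) auto
qed

text \<open>Resting at 0 moves the start to some \<open>- real k * T\<close>, and a shift by
  \<open>k\<close> periods turns the arrival time into \<open>real k * T + \<tau>\<close>.\<close>

lemma reach_per_eq_RF:
  assumes "\<tau> \<ge> 0"
  shows "reach_per T A B U \<tau> = RF \<tau>"
proof
  show "reach_per T A B U \<tau> \<subseteq> RF \<tau>"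
  proof
    fix x assume "x \<in> reach_per T A B U \<tau>"
    then obtain k :: nat and u where u: "u \<in> controls U" "x = \<phi> (real k * T + \<tau>) 0 0 u"
      by (auto simp: reach_per_def reach_def)
    have "real k * T + \<tau> \<ge> 0" using assms T_pos by simp
    then have "x \<in> RF (real k * T + \<tau>)" using u by (auto simp: RF_def)
    then show "x \<in> RF \<tau>" using RF_shift[of \<tau> "int k"] by (simp add: add.commute)
  qed
  show "RF \<tau> \<subseteq> reach_per T A B U \<tau>"
  proof
    fix x assume "x \<in> RF \<tau>"
    then obtain s1 where s1: "\<And>s. s \<le> s1 \<Longrightarrow> \<exists>u\<in>controls U. x = \<phi> \<tau> s 0 u" using RF_earlier by blast
    obtain k :: nat where "- s1 / T \<le> real k" using real_arch_simple by blast
    then have "- real k * T \<le> s1" using T_pos by (simp add: field_simps)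
    then obtain u where u: "u \<in> controls U" "x = \<phi> \<tau> (- real k * T) 0 u" using s1 by blast
    obtain v where v: "v \<in> controls U" "\<And>t s x. \<phi> (t + of_int (int k) * T) (s + of_int (int k) * T) x v = \<phi> t s x u"
      by (rule traj_shift_controls[OF u(1)]) (rule that)
    have "x = \<phi> (real k * T + \<tau>) 0 0 v" using v(2)[of \<tau> "- real k * T" 0] u(2) by (simp add: add.commute)
    then show "x \<in> reach_per T A B U \<tau>" using v(1) by (auto simp: reach_per_def reach_def)
  qed
qed

lemma contr_per_eq_CF: "contr_per T A B U \<tau> = CF \<tau>"
proof
  show "contr_per T A B U \<tau> \<subseteq> CF \<tau>"
  proof
    fix y assume "y \<in> contr_per T A B U \<tau>"
    then obtain k :: nat and u where u: "u \<in> controls U" "- real k * T + \<tau> \<le> 0" "\<phi> 0 (- real k * T + \<tau>) y u = 0"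
      by (auto simp: contr_per_def contr_def)
    then have "y \<in> CF (- real k * T + \<tau>)" unfolding CF_def by blast
    then show "y \<in> CF \<tau>" using CF_shift[of \<tau> "- int k"] by (simp add: add.commute)
  qed
  show "CF \<tau> \<subseteq> contr_per T A B U \<tau>"
  proof
    fix y assume "y \<in> CF \<tau>"
    then obtain r1 where r1: "r1 \<ge> \<tau>" "\<And>r. r \<ge> r1 \<Longrightarrow> \<exists>u\<in>controls U. \<phi> r \<tau> y u = 0" using CF_later by blast
    obtain k :: nat where "r1 / T \<le> real k" using real_arch_simple by blast
    then have k: "real k * T \<ge> r1" using T_pos by (simp add: field_simps)
    then obtain u where u: "u \<in> controls U" "\<phi> (real k * T) \<tau> y u = 0" using r1 by blast
    obtain v where v: "v \<in> controls U" "\<And>t s x. \<phi> (t + of_int (- int k) * T) (s + of_int (- int k) * T) x v = \<phi> t s x u"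
      by (rule traj_shift_controls[OF u(1)]) (rule that)
    have "\<phi> 0 (- real k * T + \<tau>) y v = 0" using v(2)[of "real k * T" \<tau> y] u(2) by simp
    moreover have "- real k * T + \<tau> \<le> 0" using k r1(1) by simp
    ultimately show "y \<in> contr_per T A B U \<tau>" using v(1) unfolding contr_per_def contr_def by blast
  qed
qed

section \<open>Interior and closure of the union of the fibers\<close>

lemma continuous_fund_sol_vec: "continuous_on UNIV (\<lambda>(t, x). X 0 t *v x)"
proof -
  have "isCont (\<lambda>p. X 0 (fst p) *v snd p) q" for q :: "real \<times> (real^'n)"
  proof -
    have "((\<lambda>p. \<phi> 0 (fst p) (snd p) (\<lambda>_. 0)) \<longlongrightarrow> \<phi> 0 (fst q) (snd q) (\<lambda>_. 0)) (at q)"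
      by (intro traj_tendsto zero_control tendsto_intros)
    then show ?thesis by (simp add: isCont_def traj_fund_sol)
  qed
  then show ?thesis by (simp add: continuous_at_imp_continuous_on case_prod_unfold)
qed

lemma fund_sol_zero_inverse [simp]: "X t 0 *v (X 0 t *v x) = x" "X 0 t *v (X t 0 *v x) = x"
  by (simp_all add: fund_sol_vec)

text \<open>In the coordinates \<open>z = X(0,t) x\<close> the free motion is constant, so the fibers are increasing.\<close>

lemma interior_RF_graph:
  assumes x: "x \<in> interior (RF t)"
  shows "(t, x) \<in> interior {(t, x). x \<in> RF t}"
proof -
  define Z where "Z t = {z. X t 0 *v z \<in> RF t}" for t
  have mono: "Z s \<subseteq> Z t" if "s \<le> t" for s t
  proof
    fix z assume "z \<in> Z s"
    then have "X t s *v (X s 0 *v z) \<in> RF t"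
      using RF_forward[OF _ zero_control that] by (simp add: Z_def traj_fund_sol)
    then show "z \<in> Z t" by (simp add: Z_def fund_sol_vec)
  qed
  have conv: "convex (Z s)" for s
    using convex_linear_vimage[OF matrix_vector_mul_linear convex_RF, of "X s 0" s]
    by (simp add: Z_def vimage_def)
  \<comment> \<open>A point of \<open>Z t\<close> is the limit of the earlier positions of its
    trajectory, each carried to time 0 by the free motion. A trajectory of zero length gives only
    \<open>z = 0\<close>, which lies in every \<open>Z s\<close>.\<close>
  have left: "Z t \<subseteq> closure (\<Union>s\<in>{..<t}. Z s)"
  proof
    fix z assume "z \<in> Z t"
    then obtain s u where s: "s \<le> t" "u \<in> controls U" "X t 0 *v z = \<phi> t s 0 u" by (auto simp: Z_def RF_def)
    show "z \<in> closure (\<Union>s\<in>{..<t}. Z s)"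
    proof (cases "s = t")
      case True
      then have "X 0 t *v (X t 0 *v z) = 0" using s by (simp add: controls_Linf)
      then have "z = 0" by simp
      then have "z \<in> Z (t - 1)" by (simp add: Z_def zero_RF)
      then show ?thesis by (intro subsetD[OF closure_subset]) auto
    next
      case False
      interpret lip_rhs "rhs u" K C by (rule lip_rhs_controls[OF s(2)])
      have "isCont (\<lambda>r. \<phi> r s 0 u) t"
        using flow_continuous[of s 0] by (simp add: traj_eq_flow continuous_on_eq_continuous_at)
      then have "((\<lambda>r. \<phi> r s 0 u) \<longlongrightarrow> \<phi> t s 0 u) (at_left t)"
        by (simp add: continuous_within filterlim_at_split isCont_def)
      then have "((\<lambda>r. \<phi> 0 r (\<phi> r s 0 u) (\<lambda>_. 0)) \<longlongrightarrow> \<phi> 0 t (\<phi> t s 0 u) (\<lambda>_. 0)) (at_left t)"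
        by (intro traj_tendsto zero_control tendsto_intros)
      moreover have "\<phi> 0 t (\<phi> t s 0 u) (\<lambda>_. 0) = z"
        using s(3) by (simp add: traj_fund_sol flip: s(3))
      moreover have "\<forall>\<^sub>F r in at_left t. \<phi> 0 r (\<phi> r s 0 u) (\<lambda>_. 0) \<in> (\<Union>s\<in>{..<t}. Z s)"
      proof (rule eventually_mono)
        show "\<forall>\<^sub>F r in at_left t. r \<in> {s<..<t}" using False s(1) by (intro eventually_at_left_real) simp
        fix r assume r: "r \<in> {s<..<t}"
        then have "\<phi> 0 r (\<phi> r s 0 u) (\<lambda>_. 0) \<in> Z r"
          using s(2) by (auto simp: Z_def traj_fund_sol RF_def intro: less_imp_le)
        then show "\<phi> 0 r (\<phi> r s 0 u) (\<lambda>_. 0) \<in> (\<Union>s\<in>{..<t}. Z s)" using r by auto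
      qed
      ultimately show ?thesis
        by (intro Lim_in_closed_set[of "closure (\<Union>s\<in>{..<t}. Z s)" "\<lambda>r. \<phi> 0 r (\<phi> r s 0 u) (\<lambda>_. 0)" "at_left t"])
           (auto elim!: eventually_mono intro: subsetD[OF closure_subset])
    qed
  qed
  have "open ((\<lambda>z. X t 0 *v z) -` interior (RF t))"
    by (intro open_vimage continuous_intros open_interior)
  moreover have "(\<lambda>z. X t 0 *v z) -` interior (RF t) \<subseteq> Z t"
    using interior_subset by (auto simp: Z_def)
  moreover have "X 0 t *v x \<in> (\<lambda>z. X t 0 *v z) -` interior (RF t)" using x by simp
  ultimately have "X 0 t *v x \<in> interior (Z t)" using interiorI by blast
  then obtain s where s: "s < t" "X 0 t *v x \<in> interior (Z s)"
    using interior_Union_mono_convex[of Z t] mono conv left by blast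
  \<comment> \<open>The coordinates depend continuously on time and state together, so the preimage
    of one fixed interior is open in both; monotonicity places it in the fibers at all times after
    \<open>s\<close>.\<close>
  define W where "W = (\<lambda>(t, x). X 0 t *v x) -` interior (Z s) \<inter> {s<..} \<times> UNIV"
  have "open W" unfolding W_def
    by (intro open_Int open_vimage continuous_fund_sol_vec open_Times) auto
  moreover have "W \<subseteq> {(t, x). x \<in> RF t}"
  proof clarify
    fix t' x' assume "(t', x') \<in> W"
    then have "X 0 t' *v x' \<in> Z s" "s \<le> t'" using interior_subset by (auto simp: W_def)
    then have "X 0 t' *v x' \<in> Z t'" using mono by blast
    then show "x' \<in> RF t'" by (simp add: Z_def)
  qed
  moreover have "(t, x) \<in> W" using s by (simp add: W_def)
  ultimately show ?thesis using interiorI by blast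
qed

text \<open>The time reversal of \<open>interior_RF_graph\<close>: in the same coordinates the
  controllable fibers shrink as time increases, hence the minus signs in \<open>Z\<close>.\<close>

lemma interior_CF_graph:
  assumes x: "x \<in> interior (CF t)"
  shows "(t, x) \<in> interior {(t, x). x \<in> CF t}"
proof -
  define Z where "Z t = {z. X (-t) 0 *v z \<in> CF (-t)}" for t
  have mono: "Z s \<subseteq> Z t" if "s \<le> t" for s t
  proof
    fix z assume "z \<in> Z s"
    then have "X (-s) (-t) *v (X (-t) 0 *v z) \<in> CF (-s)"
      by (simp add: Z_def fund_sol_vec)
    then show "z \<in> Z t"
      using CF_backward[OF _ zero_control, of "-s" "-t" "X (-t) 0 *v z"] that
      by (simp add: Z_def traj_fund_sol)
  qed
  have conv: "convex (Z s)" for s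
    using convex_linear_vimage[OF matrix_vector_mul_linear convex_CF, of "X (-s) 0" "-s"]
    by (simp add: Z_def vimage_def)
  have left: "Z t \<subseteq> closure (\<Union>s\<in>{..<t}. Z s)" for t
  proof (rule subsetI)
    fix z assume z: "z \<in> Z t"
    define y where "y = X (-t) 0 *v z"
    have zy: "z = X 0 (-t) *v y" by (simp add: y_def)
    obtain r u where r: "r \<ge> -t" "u \<in> controls U" "\<phi> r (-t) y u = 0" using z by (auto simp: Z_def CF_def y_def)
    show "z \<in> closure (\<Union>s\<in>{..<t}. Z s)"
    proof (cases "r = -t")
      case True
      then have "z = 0" using r zy by (simp add: controls_Linf)
      then have "z \<in> Z (t - 1)" by (simp add: Z_def zero_CF)
      then show ?thesis by (intro subsetD[OF closure_subset]) auto
    next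
      case False
      interpret lip_rhs "rhs u" K C by (rule lip_rhs_controls[OF r(2)])
      have "continuous_on UNIV (\<lambda>q. \<phi> (-q) (-t) y u)"
        unfolding traj_eq_flow
        by (intro continuous_on_compose2[OF flow_continuous[of "-t" y]] continuous_intros) auto
      then have "isCont (\<lambda>q. \<phi> (-q) (-t) y u) t"
        by (simp add: continuous_on_eq_continuous_at)
      then have "((\<lambda>q. \<phi> (-q) (-t) y u) \<longlongrightarrow> \<phi> (-t) (-t) y u) (at_left t)"
        by (simp only: continuous_within filterlim_at_split isCont_def)
      then have "((\<lambda>q. \<phi> 0 (-q) (\<phi> (-q) (-t) y u) (\<lambda>_. 0)) \<longlongrightarrow> \<phi> 0 (-t) (\<phi> (-t) (-t) y u) (\<lambda>_. 0)) (at_left t)"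
        by (intro traj_tendsto zero_control tendsto_intros)
      moreover have "\<phi> 0 (-t) (\<phi> (-t) (-t) y u) (\<lambda>_. 0) = z"
        using r(2) by (simp add: controls_Linf traj_fund_sol flip: zy)
      moreover have "\<forall>\<^sub>F q in at_left t. \<phi> 0 (-q) (\<phi> (-q) (-t) y u) (\<lambda>_. 0) \<in> (\<Union>s\<in>{..<t}. Z s)"
      proof (rule eventually_mono)
        show "\<forall>\<^sub>F q in at_left t. q \<in> {-r<..<t}" using False r(1) by (intro eventually_at_left_real) simp
        fix q assume q: "q \<in> {-r<..<t}"
        have "\<phi> r (-q) (\<phi> (-q) (-t) y u) u = 0" using r by (simp add: traj_traj controls_Linf)
        then have "\<phi> (-q) (-t) y u \<in> CF (-q)" using r(2) q by (auto simp: CF_def intro!: exI[of _ r])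
        then have "\<phi> 0 (-q) (\<phi> (-q) (-t) y u) (\<lambda>_. 0) \<in> Z q" by (simp add: Z_def traj_fund_sol)
        then show "\<phi> 0 (-q) (\<phi> (-q) (-t) y u) (\<lambda>_. 0) \<in> (\<Union>s\<in>{..<t}. Z s)" using q by auto
      qed
      ultimately show ?thesis
        by (intro Lim_in_closed_set[of "closure (\<Union>s\<in>{..<t}. Z s)" "\<lambda>q. \<phi> 0 (-q) (\<phi> (-q) (-t) y u) (\<lambda>_. 0)" "at_left t"])
           (auto elim!: eventually_mono intro: subsetD[OF closure_subset])
    qed
  qed
  have "open ((\<lambda>z. X t 0 *v z) -` interior (CF t))"
    by (intro open_vimage continuous_intros open_interior)
  moreover have "(\<lambda>z. X t 0 *v z) -` interior (CF t) \<subseteq> Z (-t)"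
    using interior_subset by (auto simp: Z_def)
  moreover have "X 0 t *v x \<in> (\<lambda>z. X t 0 *v z) -` interior (CF t)" using x by simp
  ultimately have "X 0 t *v x \<in> interior (Z (-t))" using interiorI by blast
  then obtain s where s: "s < -t" "X 0 t *v x \<in> interior (Z s)"
    using interior_Union_mono_convex[of Z "-t"] mono conv left by blast
  define W where "W = (\<lambda>(t, x). X 0 t *v x) -` interior (Z s) \<inter> {..<-s} \<times> UNIV"
  have "open W" unfolding W_def
    by (intro open_Int open_vimage continuous_fund_sol_vec open_Times) auto
  moreover have "W \<subseteq> {(t, x). x \<in> CF t}"
  proof clarify
    fix t' x' assume "(t', x') \<in> W"
    then have "X 0 t' *v x' \<in> Z s" "s \<le> -t'" using interior_subset by (auto simp: W_def)
    then have "X 0 t' *v x' \<in> Z (-t')" using mono by blast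
    then show "x' \<in> CF t'" by (simp add: Z_def)
  qed
  moreover have "(t, x) \<in> W" using s by (simp add: W_def)
  ultimately show ?thesis using interiorI by blast
qed

text \<open>Points of nearby fibers are carried into the fiber at \<open>t\<close> by
  \<open>RF_reverse\<close>. The travel times tend to 0, so the displacements do too, whichever
  controls are used.\<close>

lemma closure_RF_graph: "(t, x) \<in> closure {(t, x). x \<in> RF t} \<longleftrightarrow> x \<in> closure (RF t)"
proof
  assume "(t, x) \<in> closure {(t, x). x \<in> RF t}"
  then obtain p where p: "\<And>i. p i \<in> {(t, x). x \<in> RF t}" "p \<longlonglongrightarrow> (t, x)"
    by (auto simp: closure_sequential)
  have lim: "(\<lambda>i. fst (p i)) \<longlonglongrightarrow> t" "(\<lambda>i. snd (p i)) \<longlonglongrightarrow> x"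
    using tendsto_fst[OF p(2)] tendsto_snd[OF p(2)] by auto
  have "\<exists>u. u \<in> controls U \<and> \<phi> t (fst (p i)) (snd (p i)) u \<in> RF t" for i
    using RF_reverse[of "snd (p i)" "fst (p i)" t] p(1)[of i] by (metis case_prod_beta mem_Collect_eq)
  then obtain u where u: "\<And>i. u i \<in> controls U" "\<And>i. \<phi> t (fst (p i)) (snd (p i)) (u i) \<in> RF t" by metis
  have "(\<lambda>i. (\<phi> t (fst (p i)) (snd (p i)) (u i) - snd (p i)) + snd (p i)) \<longlonglongrightarrow> 0 + x"
    by (intro tendsto_add traj_tendsto_initial[OF u(1) lim] lim)
  then show "x \<in> closure (RF t)"
    unfolding closure_sequential using u(2) by (intro exI[of _ "\<lambda>i. \<phi> t (fst (p i)) (snd (p i)) (u i)"]) simp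
next
  assume "x \<in> closure (RF t)"
  then have "(t, x) \<in> closure ({t} \<times> RF t)" by (simp add: closure_Times)
  moreover have "{t} \<times> RF t \<subseteq> {(t, x). x \<in> RF t}" by auto
  ultimately show "(t, x) \<in> closure {(t, x). x \<in> RF t}" using closure_mono by blast
qed

lemma closure_RF_forward:
  assumes "x \<in> closure (RF t)" "u \<in> controls U" "t \<le> t'"
  shows "\<phi> t' t x u \<in> closure (RF t')"
proof -
  obtain y where y: "\<And>i. y i \<in> RF t" "y \<longlonglongrightarrow> x" using assms(1) by (auto simp: closure_sequential)
  have "(\<lambda>i. \<phi> t' t (y i) u) \<longlonglongrightarrow> \<phi> t' t x u"
    by (intro traj_tendsto assms y tendsto_const)
  then show ?thesis
    unfolding closure_sequential using RF_forward[OF y(1) assms(2,3)]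
    by (intro exI[of _ "\<lambda>i. \<phi> t' t (y i) u"]) simp
qed

end

section \<open>Reachable sets of discrete-time linear systems\<close>

text \<open>Every segment from a point of \<open>S\<close> to 0 can be prolonged beyond 0 within
  \<open>S\<close>, so 0 is a relative interior point. Since \<open>S\<close> contains 0, its affine
  hull is its span, here the whole space.\<close>

lemma interior_zero_of_span:
  fixes S :: "'a::euclidean_space set"
  assumes "convex S" "0 \<in> S" "span S = UNIV" and sym: "\<And>x. x \<in> S \<Longrightarrow> \<exists>\<delta>>0. - \<delta> *\<^sub>R x \<in> S"
  shows "0 \<in> interior S"
proof -
  have "affine hull S = UNIV"
    using affine_hull_span_0[of S] hull_inc[of 0 S affine] assms by simp
  moreover have "\<exists>e>1. (1 - e) *\<^sub>R x + e *\<^sub>R 0 \<in> S" if x: "x \<in> S" for x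
  proof -
    obtain \<delta> where "\<delta> > 0" "- \<delta> *\<^sub>R x \<in> S" using sym[OF x] by blast
    then show ?thesis by (intro exI[of _ "1 + \<delta>"]) simp
  qed
  then have "0 \<in> rel_interior S" using convex_rel_interior_iff[of S 0] assms by auto
  ultimately show ?thesis using rel_interior_interior by blast
qed

lemma linear_funpow: "linear (f :: 'a::real_vector \<Rightarrow> 'a) \<Longrightarrow> linear (f ^^ k)"
  by (induction k) (simp_all add: linear_compose linear_id)

text \<open>\<open>I k\<close> stands for the states reached from 0 in \<open>k\<close> steps, and
  \<open>I_add\<close> for concatenation: the result of the first \<open>k\<close> steps is
  propagated by \<open>M\<close>, and the last \<open>l\<close> steps add their own contribution.
  The abstraction allows the backward system to be another instance.\<close>

locale discrete_system =
  fixes M N :: "'a::euclidean_space \<Rightarrow> 'a" and I :: "nat \<Rightarrow> 'a set"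
  assumes lin_M: "linear M" and lin_N: "linear N"
    and MN [simp]: "M (N x) = x" and NM [simp]: "N (M x) = x"
    and I_convex: "convex (I k)" and I_0: "I 0 = {0}" and I_zero: "0 \<in> I k"
    and I_add: "I (k + l) = {(M ^^ l) x + y | x y. x \<in> I k \<and> y \<in> I l}"
begin

lemma lin_pow: "linear (M ^^ k)" "linear (N ^^ k)"
  using linear_funpow lin_M lin_N by auto

lemma MN_pow [simp]: "(M ^^ k) ((N ^^ k) x) = x" "(N ^^ k) ((M ^^ k) x) = x"
proof -
  show "(M ^^ k) ((N ^^ k) x) = x" for x
    by (induction k arbitrary: x) (simp_all add: funpow_swap1)
  show "(N ^^ k) ((M ^^ k) x) = x" for x
    by (induction k arbitrary: x) (simp_all add: funpow_swap1)
qed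

lemma NM_pow_commute: "(N ^^ l) ((M ^^ k) x) = (M ^^ k) ((N ^^ l) x)"
proof -
  have "N ((M ^^ k) x) = (M ^^ k) (N x)" for x
  proof (induction k)
    case (Suc k)
    have "(M ^^ Suc k) (N x) = (M ^^ k) x"
      by (simp add: funpow_Suc_right del: funpow.simps(2))
    then show ?case by simp
  qed simp
  then show ?thesis by (induction l) simp_all
qed

lemma I_mono: "k \<le> l \<Longrightarrow> I k \<subseteq> I l"
proof
  fix x assume "k \<le> l" "x \<in> I k"
  then have "x \<in> I (l - k + k)"
    unfolding I_add using I_zero[of "l - k"] linear_0[OF lin_pow(1)]
    by (intro CollectI exI[of _ 0] exI[of _ x]) simp
  then show "x \<in> I l" using \<open>k \<le> l\<close> by simp
qed

lemma I_pow:
  assumes "x \<in> I k"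
  shows "(M ^^ l) x \<in> I (k + l)"
proof -
  have "(M ^^ l) x + 0 \<in> I (k + l)" unfolding I_add using assms I_zero[of l] by blast
  then show ?thesis by simp
qed

text \<open>The backward system: its reachable sets are the sets controllable to \<open>0\<close>.\<close>

lemma backward: "discrete_system N M (\<lambda>k. {- (N ^^ k) x | x. x \<in> I k})"
proof
  show "convex {- (N ^^ k) x |x. x \<in> I k}" for k
  proof -
    have "{- (N ^^ k) x |x. x \<in> I k} = uminus ` ((N ^^ k) ` I k)" by auto
    then show ?thesis
      using I_convex convex_linear_image[OF lin_pow(2)] convex_negations by metis
  qed
  show "0 \<in> {- (N ^^ k) x |x. x \<in> I k}" for k
    using I_zero[of k] linear_0[OF lin_pow(2)] by force
  show "{- (N ^^ (k + l)) x |x. x \<in> I (k + l)} =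
      {(N ^^ l) x + y |x y. x \<in> {- (N ^^ k) x |x. x \<in> I k} \<and> y \<in> {- (N ^^ l) x |x. x \<in> I l}}" for k l
  proof -
    \<comment> \<open>Reversing time interchanges the two blocks of steps, hence the decomposition
      of \<open>I (l + k)\<close>.\<close>
    have eq: "- (N ^^ (l + k)) ((M ^^ k) x + y) = (N ^^ l) (- (N ^^ k) y) + - (N ^^ l) x" for x y
      by (simp add: funpow_add linear_add[OF lin_pow(2)] linear_neg[OF lin_pow(2)])
    have "{- (N ^^ (l + k)) z |z. z \<in> I (l + k)} =
      {(N ^^ l) x + y |x y. x \<in> {- (N ^^ k) x |x. x \<in> I k} \<and> y \<in> {- (N ^^ l) x |x. x \<in> I l}}"
      (is "?A = ?B")
    proof (intro equalityI subsetI)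
      fix z assume "z \<in> ?A"
      then obtain x y where "z = - (N ^^ (l + k)) ((M ^^ k) x + y)" "x \<in> I l" "y \<in> I k"
        unfolding I_add by blast
      then show "z \<in> ?B" unfolding eq by blast
    next
      fix z assume "z \<in> ?B"
      then obtain x y where z: "z = (N ^^ l) (- (N ^^ k) y) + - (N ^^ l) x" "x \<in> I l" "y \<in> I k"
        by blast
      then have "(M ^^ k) x + y \<in> I (l + k)" unfolding I_add by blast
      then show "z \<in> ?A" unfolding z(1) eq[symmetric] by blast
    qed
    then show ?thesis by (simp add: add.commute)
  qed
qed (simp_all add: linear_add linear_scale lin_M lin_N I_0)

text \<open>A Kalman-type rank argument. The spans \<open>L k\<close> increase, and once two
  consecutive ones coincide all later ones do; by dimension this happens for some \<open>k\<close>
  not exceeding the dimension. The final span is invariant under \<open>M\<close> and, by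
  invertibility, under its inverse, so it contains every state of which some positive multiple can
  be steered to 0, hence everything.\<close>

lemma interior_I_DIM:
  assumes sym: "\<And>k x. x \<in> I k \<Longrightarrow> \<exists>\<delta>>0. - \<delta> *\<^sub>R x \<in> I k"
    and ctrl: "\<And>x. \<exists>k. \<exists>\<delta>>0. \<exists>y\<in>I k. (M ^^ k) (\<delta> *\<^sub>R x) + y = 0"
  shows "0 \<in> interior (I DIM('a))"
proof -
  define L where "L k = span (I k)" for k
  have L_mono: "L k \<subseteq> L l" if "k \<le> l" for k l
    unfolding L_def by (rule span_mono[OF I_mono[OF that]])
  have M_L: "M x \<in> L (Suc k)" if "x \<in> L k" for x k
  proof -
    have "M ` I k \<subseteq> I (Suc k)" using I_pow[of _ k 1] by auto
    then have "M ` span (I k) \<subseteq> span (I (Suc k))"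
      using span_mono by (metis lin_M linear_span_image)
    then show ?thesis using that by (auto simp: L_def)
  qed
  \<comment> \<open>An element of \<open>I (k + 2)\<close> is \<open>M x + y\<close> with
    \<open>x\<close> in \<open>I (k + 1)\<close> and \<open>y\<close> in \<open>I 1\<close>; if
    \<open>x\<close> already lies in \<open>L k\<close>, then \<open>M x\<close> lies in
    \<open>L (k + 1)\<close>.\<close>
  have step: "L (Suc (Suc k)) = L (Suc k)" if "L (Suc k) = L k" for k
  proof
    have "I (Suc k + 1) \<subseteq> L (Suc k)"
    proof
      fix z assume "z \<in> I (Suc k + 1)"
      then obtain x y where z: "z = M x + y" "x \<in> I (Suc k)" "y \<in> I 1" unfolding I_add by auto
      then have "x \<in> L k" using that by (auto simp: L_def intro: span_base)
      moreover have "y \<in> L (Suc k)" using z(3) I_mono[of 1 "Suc k"] by (auto simp: L_def intro: span_base)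
      ultimately show "z \<in> L (Suc k)" using M_L z(1) by (auto simp: L_def intro: span_add)
    qed
    then show "L (Suc (Suc k)) \<subseteq> L (Suc k)" by (simp add: L_def span_minimal)
  qed (simp add: L_mono)
  obtain k where k: "k \<le> DIM('a)" "L (Suc k) = L k"
  proof (rule ccontr)
    assume "\<not> thesis"
    with that have ne: "L (Suc k) \<noteq> L k" if "k \<le> DIM('a)" for k using that by blast
    have "k \<le> dim (L k)" if "k \<le> Suc DIM('a)" for k
      using that
    proof (induction k)
      case (Suc k)
      have "\<not> dim (L (Suc k)) \<le> dim (L k)"
        using ne[of k] Suc.prems subspace_dim_equal[of "L k" "L (Suc k)"] L_mono[of k "Suc k"]
        by (auto simp: L_def)
      then show ?case using Suc by auto
    qed simp
    from this[of "Suc DIM('a)"] show False using dim_subset_UNIV[of "L (Suc DIM('a))"] by simp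
  qed
  have stable: "L (k + j) = L k" for j
  proof (induction j)
    case (Suc j)
    have "L (Suc (k + j)) = L (k + j)" by (induction j) (use k step in auto)
    then show ?case using Suc by simp
  qed simp
  have sub: "L j \<subseteq> L k" for j
    using L_mono[of j "k + j"] stable[of j] by simp
  have "M ` L k \<subseteq> L k" using M_L sub by blast
  moreover have "dim (M ` L k) = dim (L k)"
    by (rule dim_image_eq[OF lin_M]) (metis NM inj_onI)
  ultimately have M_image: "M ` L k = L k"
    using subspace_dim_equal[of "M ` L k" "L k"] by (simp add: L_def linear_subspace_image lin_M)
  have N_L: "(N ^^ j) x \<in> L k" if "x \<in> L k" for j x
    using that
  proof (induction j arbitrary: x)
    case (Suc j)
    then obtain y where "y \<in> L k" "x = M y" using M_image by blast
    then show ?case using Suc.IH[of y] by (simp add: funpow_swap1)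
  qed simp
  have "x \<in> L k" for x
  proof -
    obtain j \<delta> y where j: "\<delta> > 0" "y \<in> I j" "(M ^^ j) (\<delta> *\<^sub>R x) + y = 0" using ctrl by blast
    then have "(M ^^ j) (\<delta> *\<^sub>R x) = - y" by (simp add: eq_neg_iff_add_eq_0)
    moreover have "- y \<in> L k" using j(2) sub[of j] by (auto simp: L_def intro: span_neg span_base)
    ultimately have "\<delta> *\<^sub>R x \<in> L k" using N_L[of "- y" j] by (metis MN_pow(2))
    then show ?thesis using j(1) span_scale[of "\<delta> *\<^sub>R x" "I k" "1 / \<delta>"] by (simp add: L_def)
  qed
  then have "span (I DIM('a)) = UNIV" using L_mono[OF k(1)] by (auto simp: L_def)
  then show ?thesis by (intro interior_zero_of_span I_convex I_zero sym)
qed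

section \<open>Stable functionals and the reachable set\<close>

definition R :: "'a set" where "R = (\<Union>k. I k)"

definition stable_functional :: "'a \<Rightarrow> bool" where
  "stable_functional p \<longleftrightarrow> (\<forall>y. (\<lambda>k. p \<bullet> (M ^^ k) y) \<longlonglongrightarrow> 0)"

text \<open>The annihilator of the functionals that decay under \<open>M\<close>; in spectral terms,
  the sum of the center and unstable subspaces. In this form it enters separation arguments without
  any mention of eigenvalues.\<close>

definition V where "V = {v. \<forall>p. stable_functional p \<longrightarrow> p \<bullet> v = 0}"

lemma subspace_V: "subspace V"
  by (auto simp: V_def subspace_def inner_add_right)

text \<open>The adjoint of a map commuting with the powers of \<open>M\<close> sends stable
  functionals to stable functionals.\<close>

lemma V_linear_image:
  assumes f: "linear f" and comm: "\<And>k y. f ((M ^^ k) y) = (M ^^ k) (f y)" and v: "v \<in> V"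
  shows "f v \<in> V"
proof -
  have "p \<bullet> f v = 0" if p: "stable_functional p" for p
  proof -
    have "adjoint f p \<bullet> z = p \<bullet> f z" for z
      using adjoint_works[OF f, of z p] by (simp add: inner_commute)
    then have "stable_functional (adjoint f p)"
      using p by (simp add: stable_functional_def comm)
    then have "adjoint f p \<bullet> v = 0" using v by (auto simp: V_def)
    then show ?thesis using adjoint_works[OF f, of v p] by (simp add: inner_commute)
  qed
  then show ?thesis by (auto simp: V_def)
qed

lemma V_M: "v \<in> V \<Longrightarrow> (M ^^ l) v \<in> V"
  by (rule V_linear_image[OF lin_pow(1)]) (metis add.commute comp_apply funpow_add)

lemma V_N: "v \<in> V \<Longrightarrow> (N ^^ l) v \<in> V"
  by (rule V_linear_image[OF lin_pow(2) NM_pow_commute])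

lemma convex_R: "convex R"
proof (rule convexI)
  fix x y and a b :: real
  assume "x \<in> R" "y \<in> R" and ab: "0 \<le> a" "0 \<le> b" "a + b = 1"
  then obtain k l where "x \<in> I k" "y \<in> I l" by (auto simp: R_def)
  then have "x \<in> I (max k l)" "y \<in> I (max k l)" using I_mono[of k "max k l"] I_mono[of l "max k l"] by auto
  then have "a *\<^sub>R x + b *\<^sub>R y \<in> I (max k l)" by (intro convexD[OF I_convex] ab)
  then show "a *\<^sub>R x + b *\<^sub>R y \<in> R" by (auto simp: R_def)
qed

lemma R_pow: "x \<in> R \<Longrightarrow> (M ^^ l) x \<in> R"
  unfolding R_def using I_pow by blast

lemma closure_R_pow:
  assumes "x \<in> closure R"
  shows "(M ^^ l) x \<in> closure R"
proof -
  have "(M ^^ l) ` closure R \<subseteq> closure ((M ^^ l) ` R)"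
    by (rule closure_linear_image_subset[OF lin_pow(1)])
  also have "\<dots> \<subseteq> closure R" using R_pow by (intro closure_mono) auto
  finally show ?thesis using assms by blast
qed

text \<open>Unrolling \<open>I_add\<close> writes an element of \<open>I k\<close> as a sum of terms
  \<open>(M ^^ j) w\<close> with \<open>j < k\<close> and \<open>w\<close> in \<open>I 1\<close>;
  the values of \<open>p\<close> on these terms are dominated by a summable sequence independent of
  \<open>k\<close>.\<close>

lemma bounded_functional_on_R:
  assumes b: "bounded (I 1)" and p: "\<And>y. summable (\<lambda>k. \<bar>p \<bullet> (M ^^ k) y\<bar>)"
  obtains h where "\<And>x. x \<in> closure R \<Longrightarrow> \<bar>p \<bullet> x\<bar> \<le> h"
proof -
  obtain b where b: "b \<ge> 0" "\<And>w. w \<in> I 1 \<Longrightarrow> norm w \<le> b"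
    using b by (metis bounded_iff norm_ge_zero order_trans I_zero)
  \<comment> \<open>Expanding \<open>w\<close> in the standard basis makes the bound uniform over
    the bounded set \<open>I 1\<close>.\<close>
  define g where "g k = b * (\<Sum>i\<in>Basis. \<bar>p \<bullet> (M ^^ k) i\<bar>)" for k
  have g: "summable g" unfolding g_def by (intro summable_mult summable_sum p)
  have g0: "g k \<ge> 0" for k using b by (auto simp: g_def intro!: mult_nonneg_nonneg sum_nonneg)
  have gw: "\<bar>p \<bullet> (M ^^ k) w\<bar> \<le> g k" if w: "w \<in> I 1" for k w
  proof -
    have "p \<bullet> (M ^^ k) w = p \<bullet> (M ^^ k) (\<Sum>i\<in>Basis. (w \<bullet> i) *\<^sub>R i)" by (simp add: euclidean_representation)
    also have "\<dots> = (\<Sum>i\<in>Basis. (w \<bullet> i) * (p \<bullet> (M ^^ k) i))"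
      by (simp add: linear_sum[OF lin_pow(1)] linear_scale[OF lin_pow(1)] inner_sum_right)
    also have "\<bar>\<dots>\<bar> \<le> (\<Sum>i\<in>Basis. \<bar>(w \<bullet> i) * (p \<bullet> (M ^^ k) i)\<bar>)" by (rule sum_abs)
    also have "\<dots> \<le> (\<Sum>i\<in>Basis. b * \<bar>p \<bullet> (M ^^ k) i\<bar>)"
    proof (rule sum_mono)
      fix i :: 'a assume "i \<in> Basis"
      then have "\<bar>w \<bullet> i\<bar> \<le> b" using Basis_le_norm[of i w] b(2)[OF w] by linarith
      then show "\<bar>(w \<bullet> i) * (p \<bullet> (M ^^ k) i)\<bar> \<le> b * \<bar>p \<bullet> (M ^^ k) i\<bar>"
        by (simp add: abs_mult mult_right_mono)
    qed
    finally show ?thesis by (simp add: g_def sum_distrib_left)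
  qed
  have I_le: "\<bar>p \<bullet> x\<bar> \<le> sum g {..<k}" if "x \<in> I k" for k x
    using that
  proof (induction k arbitrary: x)
    case (Suc k)
    then have "x \<in> I (1 + k)" by simp
    then obtain w y where "x = (M ^^ k) w + y" "w \<in> I 1" "y \<in> I k" unfolding I_add by blast
    then show ?case using Suc.IH[of y] gw[of w k] by (simp add: inner_add_right)
  qed (simp add: I_0)
  have "\<bar>p \<bullet> x\<bar> \<le> suminf g" if xR: "x \<in> R" for x
  proof -
    obtain k where "x \<in> I k" using xR by (auto simp: R_def)
    then have "\<bar>p \<bullet> x\<bar> \<le> sum g {..<k}" by (rule I_le)
    also have "\<dots> \<le> suminf g" by (rule sum_le_suminf[OF g]) (auto simp: g0)
    finally show ?thesis .
  qed
  then have "R \<subseteq> {x. \<bar>p \<bullet> x\<bar> \<le> suminf g}" by auto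
  moreover have "closed {x. \<bar>p \<bullet> x\<bar> \<le> suminf g}"
    by (intro closed_Collect_le continuous_intros)
  ultimately show ?thesis using that[of "suminf g"] closure_minimal by blast
qed

end

locale discrete_reach = discrete_system M N I for M N :: "'a::euclidean_space \<Rightarrow> 'a" and I +
  fixes d :: nat
  assumes d_pos: "d > 0" and int_I: "0 \<in> interior (I d)"
begin

lemma backward_reach: "discrete_reach N M (\<lambda>k. {- (N ^^ k) x | x. x \<in> I k}) d"
proof -
  have "{- (N ^^ d) x | x. x \<in> I d} = (\<lambda>x. - (N ^^ d) x) ` I d" by auto
  moreover have "(\<lambda>x. - (N ^^ d) x) ` interior (I d) \<subseteq> interior ((\<lambda>x. - (N ^^ d) x) ` I d)"
  proof (intro interior_maximal image_mono interior_subset open_surjective_linear_image open_interior)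
    show "linear (\<lambda>x. - (N ^^ d) x)" by (rule linear_compose_neg[OF lin_pow(2)])
    show "surj (\<lambda>x. - (N ^^ d) x)"
      by (rule surjI[of _ "\<lambda>y. (M ^^ d) (- y)"]) simp
  qed
  moreover have "0 \<in> (\<lambda>x. - (N ^^ d) x) ` interior (I d)"
    using int_I linear_0[OF lin_pow(2)] by force
  ultimately show ?thesis
    using backward d_pos by (auto simp: discrete_reach_def discrete_reach_axioms_def)
qed

text \<open>In every block of \<open>d\<close> steps either \<open>y\<close> or \<open>- y\<close>
  can be added when \<open>y\<close> is small, so the signs can be chosen to make the value of
  \<open>p\<close> equal to a partial sum of
  \<open>\<bar>p \<bullet> (M ^^ (j * d)) y\<bar>\<close>. The upper bound on \<open>R\<close> then
  bounds the series, and its terms tend to 0.\<close>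

lemma bounded_imp_stable_functional:
  assumes h: "\<And>x. x \<in> R \<Longrightarrow> p \<bullet> x \<le> h"
  shows "stable_functional p"
proof -
  obtain \<epsilon> where \<epsilon>: "\<epsilon> > 0" "cball 0 \<epsilon> \<subseteq> I d" using int_I mem_interior_cball by blast
  have small: "(\<lambda>j. p \<bullet> (M ^^ (j * d)) y) \<longlonglongrightarrow> 0" if y: "norm y \<le> \<epsilon>" for y
  proof -
    have "\<exists>x\<in>I (m * d). p \<bullet> x = (\<Sum>j<m. \<bar>p \<bullet> (M ^^ (j * d)) y\<bar>)" for m
    proof (induction m)
      case (Suc m)
      then obtain x where x: "x \<in> I (m * d)" "p \<bullet> x = (\<Sum>j<m. \<bar>p \<bullet> (M ^^ (j * d)) y\<bar>)" by blast
      define b where "b = (if p \<bullet> (M ^^ (m * d)) y \<ge> 0 then y else - y)"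
      have "b \<in> I d" using y \<epsilon> by (auto simp: b_def)
      then have "(M ^^ (m * d)) b + x \<in> I (d + m * d)" unfolding I_add using x(1) by blast
      moreover have "p \<bullet> ((M ^^ (m * d)) b + x) = (\<Sum>j<Suc m. \<bar>p \<bullet> (M ^^ (j * d)) y\<bar>)"
        using x(2) by (simp add: b_def inner_add_right linear_neg[OF lin_pow(1)])
      ultimately show ?case by auto
    qed (simp add: I_0)
    moreover have "p \<bullet> x \<le> h" if "x \<in> I k" for x k
      using that h[of x] by (auto simp: R_def)
    ultimately have "(\<Sum>j<m. \<bar>p \<bullet> (M ^^ (j * d)) y\<bar>) \<le> h" for m by metis
    then have "summable (\<lambda>j. \<bar>p \<bullet> (M ^^ (j * d)) y\<bar>)" by (intro summableI_nonneg_bounded) auto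
    then show ?thesis using summable_LIMSEQ_zero tendsto_rabs_zero_iff by blast
  qed
  have all: "(\<lambda>j. p \<bullet> (M ^^ (j * d)) y) \<longlonglongrightarrow> 0" for y
  proof -
    define c where "c = \<epsilon> / (norm y + 1)"
    have c: "c > 0" using \<epsilon> by (simp add: c_def add_nonneg_pos)
    have "c * norm y \<le> \<epsilon>" using \<epsilon>(1) by (simp add: c_def divide_simps add_nonneg_pos)
    then have "(\<lambda>j. p \<bullet> (M ^^ (j * d)) (c *\<^sub>R y)) \<longlonglongrightarrow> 0" using c by (intro small) simp
    then have "(\<lambda>j. (1 / c) * (c * (p \<bullet> (M ^^ (j * d)) y))) \<longlonglongrightarrow> (1 / c) * 0"
      by (intro tendsto_mult tendsto_const) (simp add: linear_scale[OF lin_pow(1)])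
    then show ?thesis using c by simp
  qed
  show ?thesis
    unfolding stable_functional_def
  proof (intro allI LIMSEQ_I)
    \<comment> \<open>Decay along multiples of \<open>d\<close> extends to all exponents:
      \<open>k\<close> is split into a multiple of \<open>d\<close> and one of finitely many
      remainders, which is absorbed into the initial vector.\<close>
    fix y and e :: real assume e: "e > 0"
    have "\<forall>\<^sub>F j in sequentially. \<forall>r\<in>{..<d}. \<bar>p \<bullet> (M ^^ (j * d)) ((M ^^ r) y)\<bar> < e"
      using tendstoD[OF all e] by (intro eventually_ball_finite) (auto simp: dist_real_def)
    then obtain J where J: "\<And>j r. j \<ge> J \<Longrightarrow> r < d \<Longrightarrow> \<bar>p \<bullet> (M ^^ (j * d)) ((M ^^ r) y)\<bar> < e"
      by (auto simp: eventually_sequentially)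
    have "norm (p \<bullet> (M ^^ k) y - 0) < e" if k: "k \<ge> J * d" for k
    proof -
      have "k div d \<ge> J" using k d_pos by (simp add: less_eq_div_iff_mult_less_eq)
      moreover have "(M ^^ k) y = (M ^^ (k div d * d)) ((M ^^ (k mod d)) y)"
        by (metis comp_apply div_mult_mod_eq funpow_add)
      ultimately show ?thesis using J[of "k div d" "k mod d"] d_pos by simp
    qed
    then show "\<exists>n. \<forall>k\<ge>n. norm (p \<bullet> (M ^^ k) y - 0) < e" by blast
  qed
qed

lemma zero_int_R: "0 \<in> interior R"
proof -
  have "I d \<subseteq> R" by (auto simp: R_def)
  then show ?thesis using int_I interior_mono by blast
qed

lemma closure_interior_R: "closure (interior R) = closure R"
  using convex_closure_interior[OF convex_R] zero_int_R by blast

lemma V_subset_interior_R: "V \<subseteq> interior R"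
proof (rule ccontr)
  assume "\<not> V \<subseteq> interior R"
  then obtain v where v: "v \<in> V" "v \<notin> interior R" by blast
  then obtain p b where p: "p \<noteq> 0" "\<And>x. x \<in> interior R \<Longrightarrow> p \<bullet> x \<le> b" "p \<bullet> v \<ge> b"
    using separating_hyperplane_sets[of "interior R" "{v}"] convex_interior[OF convex_R] zero_int_R by auto
  have "closed {x. p \<bullet> x \<le> b}" by (intro closed_Collect_le continuous_intros)
  then have "closure (interior R) \<subseteq> {x. p \<bullet> x \<le> b}" using p(2) by (intro closure_minimal) auto
  then have "R \<subseteq> {x. p \<bullet> x \<le> b}" using closure_interior_R closure_subset by blast
  then have "stable_functional p" by (intro bounded_imp_stable_functional) auto
  \<comment> \<open>A stable functional vanishes on \<open>v\<close>, so the separating level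
    \<open>b\<close> is at most 0. On the other hand, \<open>p\<close> takes positive values at
    points of \<open>interior R\<close> close to 0.\<close>
  then have "b \<le> 0" using v(1) p(3) by (auto simp: V_def)
  obtain \<epsilon> where \<epsilon>: "\<epsilon> > 0" "ball 0 \<epsilon> \<subseteq> interior R"
    using zero_int_R open_interior open_contains_ball by blast
  have "(\<epsilon> / 2 / norm p) *\<^sub>R p \<in> ball 0 \<epsilon>" using \<epsilon>(1) p(1) by simp
  then have "(\<epsilon> / 2 / norm p) *\<^sub>R p \<in> interior R" using \<epsilon>(2) by blast
  then have "p \<bullet> ((\<epsilon> / 2 / norm p) *\<^sub>R p) \<le> 0" using p(2) \<open>b \<le> 0\<close> order_trans by blast
  moreover have "p \<bullet> p > 0" using p(1) by simp
  ultimately show False using \<epsilon>(1) p(1)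
    by (metis divide_pos_pos inner_scaleR_right mult_pos_pos not_le zero_less_norm_iff zero_less_numeral)
qed

text \<open>\<open>x + v\<close> is a convex combination of \<open>(1 + c) *\<^sub>R x\<close>,
  still interior for small \<open>c\<close>, and of a multiple of \<open>v\<close>, interior because
  the subspace \<open>V\<close> is contained in \<open>interior R\<close>.\<close>

lemma interior_R_add_V:
  assumes x: "x \<in> interior R" and v: "v \<in> V"
  shows "x + v \<in> interior R"
proof -
  obtain e where e: "e > 0" "ball x e \<subseteq> interior R"
    using x open_interior open_contains_ball by blast
  define c where "c = e / (2 * (norm x + 1))"
  have c: "c > 0" using e by (simp add: c_def add_nonneg_pos)
  have "c * norm x < e" using e(1) unfolding c_def by (simp add: divide_simps add_nonneg_pos)
  then have "(1 + c) *\<^sub>R x \<in> ball x e" using c by (simp add: dist_norm algebra_simps)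
  then have 1: "(1 + c) *\<^sub>R x \<in> interior R" using e by blast
  have "((1 + c) / c) *\<^sub>R v \<in> V" using subspace_V v by (simp add: subspace_scale)
  then have 2: "((1 + c) / c) *\<^sub>R v \<in> interior R" using V_subset_interior_R by blast
  have "(1 / (1 + c)) *\<^sub>R ((1 + c) *\<^sub>R x) + (c / (1 + c)) *\<^sub>R (((1 + c) / c) *\<^sub>R v) \<in> interior R"
    using c by (intro convexD[OF convex_interior[OF convex_R] 1 2]) (auto simp: field_simps)
  then show ?thesis using c by simp
qed

lemma closure_R_add_V:
  assumes x: "x \<in> closure R" and v: "v \<in> V"
  shows "x + v \<in> closure R"
proof -
  have "(\<lambda>x. v + x) ` interior R \<subseteq> interior R" using interior_R_add_V v by (auto simp: add.commute)
  then have "(\<lambda>x. v + x) ` closure (interior R) \<subseteq> closure (interior R)"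
    using closure_translation[of v "interior R"] closure_mono by metis
  then show ?thesis using x unfolding closure_interior_R by (auto simp: add.commute)
qed

text \<open>The last \<open>d\<close> steps may add any element of \<open>I d\<close>, so a whole
  ball around \<open>(M ^^ d) x\<close> is reached.\<close>

lemma R_pow_d: "x \<in> R \<Longrightarrow> (M ^^ d) x \<in> interior R"
proof -
  assume "x \<in> R"
  then obtain k where k: "x \<in> I k" by (auto simp: R_def)
  obtain \<epsilon> where \<epsilon>: "\<epsilon> > 0" "ball 0 \<epsilon> \<subseteq> I d" using int_I mem_interior by blast
  have "ball ((M ^^ d) x) \<epsilon> \<subseteq> I (k + d)"
  proof
    fix z assume z: "z \<in> ball ((M ^^ d) x) \<epsilon>"
    then have "z - (M ^^ d) x \<in> I d" using \<epsilon>(2) by (auto simp: dist_norm norm_minus_commute)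
    moreover have "z = (M ^^ d) x + (z - (M ^^ d) x)" by simp
    ultimately show "z \<in> I (k + d)" unfolding I_add using k by blast
  qed
  then show ?thesis using \<epsilon>(1) by (auto simp: mem_interior R_def)
qed

lemma closure_R_scale:
  assumes "x \<in> closure R" "0 \<le> s" "s < 1"
  shows "s *\<^sub>R x \<in> interior R"
  using mem_interior_closure_convex_shrink[OF convex_R zero_int_R assms(1), of "1 - s"] assms(2,3)
  by (simp add: algebra_simps)

text \<open>A functional separating \<open>x\<close> from \<open>R\<close> would be bounded on \<open>R\<close>, hence stable, so it does not
  see the initial value \<open>w\<close> after a long time.\<close>

lemma closure_R_recurrent:
  assumes rec: "\<And>n e. e > 0 \<Longrightarrow>
    \<exists>k\<ge>n. \<exists>w. norm (w - x) \<le> e \<and> (\<exists>r\<in>I k. norm (x - ((M ^^ k) w + r)) \<le> e)"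
  shows "x \<in> closure R"
proof (rule ccontr)
  assume "x \<notin> closure R"
  then obtain q b where q: "q \<bullet> x < b" "\<And>z. z \<in> closure R \<Longrightarrow> q \<bullet> z > b"
    using separating_hyperplane_closed_point[of "closure R" x] convex_closure[OF convex_R] by auto
  define p where "p = - q"
  have p: "p \<bullet> x > - b" "\<And>z. z \<in> R \<Longrightarrow> p \<bullet> z \<le> - b"
    using q closure_subset[of R] by (auto simp: p_def intro: less_imp_le)
  have st: "stable_functional p" by (rule bounded_imp_stable_functional[OF p(2)])
  define g where "g = p \<bullet> x + b"
  have g: "g > 0" using p(1) by (simp add: g_def)
  \<comment> \<open>With this \<open>e\<close>, displacements of size \<open>e\<close> change
    \<open>p\<close> by at most \<open>g / 4\<close>, and \<open>norm w\<close> is at most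
    \<open>norm x + 1\<close>, so that a single \<open>n\<close> makes
    \<open>p \<bullet> (M ^^ k) w\<close> small for all admissible \<open>w\<close>.\<close>
  define e where "e = min 1 (g / (4 * (norm p + 1)))"
  have np: "norm p + 1 > 0" by (simp add: add_nonneg_pos)
  have e: "e > 0" "e \<le> 1" using g np by (auto simp: e_def)
  have "e * (norm p + 1) \<le> g / (4 * (norm p + 1)) * (norm p + 1)"
    using np by (intro mult_right_mono) (auto simp: e_def)
  also have "\<dots> = g / 4" using np by (simp add: divide_simps)
  finally have pe: "norm p * e \<le> g / 4" using e by (simp add: algebra_simps)
  have "(\<lambda>k. (norm x + 1) * (\<Sum>i\<in>Basis. \<bar>p \<bullet> (M ^^ k) i\<bar>)) \<longlonglongrightarrow> (norm x + 1) * (\<Sum>i\<in>(Basis::'a set). 0)"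
    using st by (intro tendsto_mult tendsto_const tendsto_sum tendsto_rabs_zero) (auto simp: stable_functional_def)
  then have "\<forall>\<^sub>F k in sequentially. (norm x + 1) * (\<Sum>i\<in>Basis. \<bar>p \<bullet> (M ^^ k) i\<bar>) < g / 4"
    using g by (intro order_tendstoD(2)) auto
  then obtain n where n: "\<And>k. k \<ge> n \<Longrightarrow> (norm x + 1) * (\<Sum>i\<in>Basis. \<bar>p \<bullet> (M ^^ k) i\<bar>) < g / 4"
    by (auto simp: eventually_sequentially)
  obtain k w r where k: "k \<ge> n" "norm (w - x) \<le> e" "r \<in> I k" "norm (x - ((M ^^ k) w + r)) \<le> e"
    using rec[OF e(1), of n] by blast
  have nw: "norm w \<le> norm x + 1" using k(2) e norm_triangle_sub[of w x] by linarith
  have "p \<bullet> (M ^^ k) w = p \<bullet> (M ^^ k) (\<Sum>i\<in>Basis. (w \<bullet> i) *\<^sub>R i)" by (simp add: euclidean_representation)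
  also have "\<dots> = (\<Sum>i\<in>Basis. (w \<bullet> i) * (p \<bullet> (M ^^ k) i))"
    by (simp add: linear_sum[OF lin_pow(1)] linear_scale[OF lin_pow(1)] inner_sum_right)
  also have "\<dots> \<le> (\<Sum>i\<in>Basis. (norm x + 1) * \<bar>p \<bullet> (M ^^ k) i\<bar>)"
  proof (rule sum_mono)
    fix i :: 'a assume "i \<in> Basis"
    then have "\<bar>w \<bullet> i\<bar> \<le> norm x + 1" using Basis_le_norm[of i w] nw by linarith
    then have "\<bar>w \<bullet> i\<bar> * \<bar>p \<bullet> (M ^^ k) i\<bar> \<le> (norm x + 1) * \<bar>p \<bullet> (M ^^ k) i\<bar>" by (rule mult_right_mono) simp
    then show "(w \<bullet> i) * (p \<bullet> (M ^^ k) i) \<le> (norm x + 1) * \<bar>p \<bullet> (M ^^ k) i\<bar>"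
      by (metis abs_ge_self abs_mult order_trans)
  qed
  also have "\<dots> < g / 4" using n[OF k(1)] by (simp add: sum_distrib_left)
  finally have 1: "p \<bullet> (M ^^ k) w < g / 4" .
  have 2: "p \<bullet> r \<le> - b" using k(3) p(2) by (auto simp: R_def)
  have "p \<bullet> (x - ((M ^^ k) w + r)) \<le> norm p * norm (x - ((M ^^ k) w + r))" by (rule norm_cauchy_schwarz)
  also have "\<dots> \<le> norm p * e" using k(4) by (intro mult_left_mono) auto
  finally have 3: "p \<bullet> (x - ((M ^^ k) w + r)) \<le> g / 4" using pe by linarith
  \<comment> \<open>\<open>p \<bullet> x\<close> is the sum of the three estimated terms, so
    \<open>g\<close> would be smaller than \<open>g / 2\<close>.\<close>
  show False using 1 2 3 g by (simp add: inner_diff_right inner_add_right g_def)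
qed

end

section \<open>Generalized eigenspaces\<close>

definition shift_op :: "complex^'n^'n \<Rightarrow> complex \<Rightarrow> complex^'n \<Rightarrow> complex^'n" where
  "shift_op M \<mu> w = M *v w - \<mu> *s w"

text \<open>Spans, linear maps and dimensions on \<open>complex^'n\<close> refer to real scalars,
  while eigenvectors use \<open>*s\<close>; this identity connects the two.\<close>

lemma scaleR_eq_scalar_mult: "c *\<^sub>R x = complex_of_real c *s (x :: complex^'n)"
  unfolding vec_eq_iff vector_scaleR_component vector_smult_component by (simp add: scaleR_conv_of_real)

lemma shift_op_add: "shift_op M \<mu> (v + w) = shift_op M \<mu> v + shift_op M \<mu> w"
  by (simp add: shift_op_def matrix_vector_right_distrib vector_add_ldistrib)

lemma shift_op_scale: "shift_op M \<mu> (c *s w) = c *s shift_op M \<mu> w"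
  by (simp add: shift_op_def vector_scalar_commute vector_ssub_ldistrib vector_smult_assoc mult.commute)

lemma shift_op_pow_add: "(shift_op M \<mu> ^^ k) (v + w) = (shift_op M \<mu> ^^ k) v + (shift_op M \<mu> ^^ k) w"
  by (induction k) (simp_all add: shift_op_add)

lemma shift_op_pow_scale: "(shift_op M \<mu> ^^ k) (c *s w) = c *s (shift_op M \<mu> ^^ k) w"
  by (induction k) (simp_all add: shift_op_scale)

lemma shift_op_pow_0 [simp]: "(shift_op M \<mu> ^^ k) 0 = 0"
  using shift_op_pow_scale[of k M \<mu> 0 0] by simp

lemma shift_op_pow_matrix:
  assumes "P ** M = M ** P"
  shows "(shift_op M \<mu> ^^ k) (P *v w) = P *v (shift_op M \<mu> ^^ k) w"
proof (induction k)
  case (Suc k)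
  have "shift_op M \<mu> (P *v z) = P *v shift_op M \<mu> z" for z
    using assms by (simp add: shift_op_def matrix_vector_mul_assoc matrix_vector_mult_diff_distrib vector_scalar_commute)
  then show ?case using Suc by simp
qed simp

lemma gen_eigenspace_iff: "v \<in> gen_eigenspace M \<mu> \<longleftrightarrow> (\<exists>k. (shift_op M \<mu> ^^ k) v = 0)"
proof -
  have "shift_op M \<mu> = (\<lambda>w. M *v w - \<mu> *s w)" by (simp add: shift_op_def fun_eq_iff)
  then show ?thesis by (simp add: gen_eigenspace_def)
qed

lemma gen_eigenspace_scale: "v \<in> gen_eigenspace M \<mu> \<Longrightarrow> c *s v \<in> gen_eigenspace M \<mu>"
  unfolding gen_eigenspace_iff shift_op_pow_scale by fastforce

text \<open>On the generalized eigenspace of \<open>\<nu>\<close>, the map \<open>M - \<mu>\<close>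
  is the nonzero scalar \<open>\<nu> - \<mu>\<close> plus a locally nilpotent map. Its inverse is
  built by induction on the order: \<open>c *s u\<close> solves the equation up to an error of lower
  order, which \<open>w\<close> corrects.\<close>

lemma shift_op_surj_gen_eigenspace:
  assumes "\<nu> \<noteq> \<mu>" "u \<in> gen_eigenspace M \<nu>"
  shows "\<exists>w\<in>gen_eigenspace M \<nu>. shift_op M \<mu> w = u"
proof -
  obtain k where "(shift_op M \<nu> ^^ k) u = 0" using assms(2) by (auto simp: gen_eigenspace_iff)
  then show ?thesis
  proof (induction k arbitrary: u)
    case 0
    then show ?case by (intro bexI[of _ 0]) (auto simp: shift_op_def gen_eigenspace_iff)
  next
    case (Suc k)
    define c where "c = 1 / (\<nu> - \<mu>)"
    have c: "c * (\<nu> - \<mu>) = 1" using assms(1) by (simp add: c_def)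
    have "(shift_op M \<nu> ^^ k) (- c *s shift_op M \<nu> u) = 0"
      unfolding shift_op_pow_scale using Suc.prems by (simp add: funpow_swap1)
    then obtain w where w: "w \<in> gen_eigenspace M \<nu>" "shift_op M \<mu> w = - c *s shift_op M \<nu> u"
      using Suc.IH by blast
    have "shift_op M \<nu> u = M *v u - \<nu> *s u" by (simp add: shift_op_def)
    then have "shift_op M \<mu> (c *s u + w) = c *s (M *v u - \<mu> *s u) - c *s (M *v u - \<nu> *s u)"
      unfolding shift_op_add w(2) shift_op_scale by (simp add: shift_op_def)
    also have "\<dots> = (c * (\<nu> - \<mu>)) *s u"
      by (simp add: vec_eq_iff algebra_simps)
    finally have "shift_op M \<mu> (c *s u + w) = u" using c by simp
    moreover have "c *s u + w \<in> gen_eigenspace M \<nu>"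
    proof -
      obtain j where "(shift_op M \<nu> ^^ j) w = 0" using w(1) by (auto simp: gen_eigenspace_iff)
      then have "(shift_op M \<nu> ^^ (Suc k + j)) w = 0"
        by (simp only: funpow_add comp_apply shift_op_pow_0)
      moreover have "(shift_op M \<nu> ^^ (j + Suc k)) u = 0"
        using Suc.prems by (simp only: funpow_add comp_apply shift_op_pow_0)
      ultimately have "(shift_op M \<nu> ^^ (Suc k + j)) (c *s u + w) = 0"
        by (simp add: shift_op_pow_add shift_op_pow_scale add.commute del: funpow.simps)
      then show ?thesis unfolding gen_eigenspace_iff by blast
    qed
    ultimately show ?case by blast
  qed
qed

text \<open>\<open>M - \<mu>\<close> maps the sum of the generalized eigenspaces onto itself up to
  elements of the one for \<open>\<mu>\<close>. Subtracting a suitable \<open>w\<close> from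
  \<open>v\<close> therefore leaves a vector that \<open>M - \<mu>\<close> sends into the
  generalized eigenspace of \<open>\<mu>\<close>, hence a member of that space.\<close>

lemma gen_eigenspace_sum_step:
  assumes "shift_op M \<mu> v \<in> span (\<Union>\<nu>. gen_eigenspace M \<nu>)"
  shows "v \<in> span (\<Union>\<nu>. gen_eigenspace M \<nu>)"
proof -
  let ?S = "span (\<Union>\<nu>. gen_eigenspace M \<nu>)"
  have "\<exists>w g. w \<in> ?S \<and> g \<in> gen_eigenspace M \<mu> \<and> u = shift_op M \<mu> w + g" if "u \<in> ?S" for u
    using that
  proof (induction rule: span_induct_alt)
    case base
    show ?case by (intro exI[of _ 0]) (auto simp: span_zero gen_eigenspace_iff shift_op_def)
  next
    case (step c x y)
    then obtain w g \<nu> where wg: "w \<in> ?S" "g \<in> gen_eigenspace M \<mu>" "y = shift_op M \<mu> w + g"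
      and x: "x \<in> gen_eigenspace M \<nu>" by blast
    have cx: "c *\<^sub>R x = complex_of_real c *s x" by (rule scaleR_eq_scalar_mult)
    show ?case
    proof (cases "\<nu> = \<mu>")
      case True
      obtain k where k: "(shift_op M \<mu> ^^ k) x = 0" using x True by (auto simp: gen_eigenspace_iff)
      obtain j where j: "(shift_op M \<mu> ^^ j) g = 0" using wg(2) by (auto simp: gen_eigenspace_iff)
      have "(shift_op M \<mu> ^^ (j + k)) x = 0" "(shift_op M \<mu> ^^ (k + j)) g = 0"
        using k j by (simp_all only: funpow_add comp_apply shift_op_pow_0)
      then have "(shift_op M \<mu> ^^ (k + j)) (c *\<^sub>R x + g) = 0"
        unfolding cx by (simp add: shift_op_pow_add shift_op_pow_scale add.commute)
      then have "c *\<^sub>R x + g \<in> gen_eigenspace M \<mu>" by (auto simp: gen_eigenspace_iff)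
      moreover have "c *\<^sub>R x + y = shift_op M \<mu> w + (c *\<^sub>R x + g)" using wg(3) by simp
      ultimately show ?thesis using wg(1) by blast
    next
      case False
      then obtain z where z: "z \<in> gen_eigenspace M \<nu>" "shift_op M \<mu> z = c *\<^sub>R x"
        using shift_op_surj_gen_eigenspace[OF False] gen_eigenspace_scale[OF x] unfolding cx by blast
      have "z \<in> ?S" using z(1) by (intro span_base) blast
      then have "z + w \<in> ?S" using wg(1) by (rule span_add)
      moreover have "c *\<^sub>R x + y = shift_op M \<mu> (z + w) + g" using wg(3) z(2) by (simp add: shift_op_add)
      ultimately show ?thesis using wg(2) by blast
    qed
  qed
  then obtain w g where wg: "w \<in> ?S" "g \<in> gen_eigenspace M \<mu>" "shift_op M \<mu> v = shift_op M \<mu> w + g"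
    using assms by blast
  have "shift_op M \<mu> (v + (-1) *s w) = g"
    unfolding shift_op_add shift_op_scale wg(3) by (simp add: vec_eq_iff)
  moreover obtain k where "(shift_op M \<mu> ^^ k) g = 0" using wg(2) by (auto simp: gen_eigenspace_iff)
  ultimately have "(shift_op M \<mu> ^^ Suc k) (v + (-1) *s w) = 0" by (simp only: funpow_Suc_right comp_apply)
  then have "v + (-1) *s w \<in> gen_eigenspace M \<mu>" unfolding gen_eigenspace_iff by blast
  then have "v + (-1) *s w \<in> ?S" by (auto intro: span_base)
  then have "(v + (-1) *s w) + w \<in> ?S" using wg(1) by (rule span_add)
  then show ?thesis by (simp add: vec_eq_iff)
qed

section \<open>Annihilating polynomials and the primary decomposition\<close>

text \<open>The vector p(M) v, evaluated by the scheme of Horner.\<close>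

definition poly_act :: "complex poly \<Rightarrow> complex^'n^'n \<Rightarrow> complex^'n \<Rightarrow> complex^'n" where
  "poly_act p M v = fold_coeffs (\<lambda>a w. a *s v + M *v w) p 0"

lemma poly_act_0 [simp]: "poly_act 0 M v = 0"
  by (simp add: poly_act_def)

lemma poly_act_pCons: "poly_act (pCons a p) M v = a *s v + M *v poly_act p M v"
  by (cases "p = 0 \<and> a = 0") (auto simp: poly_act_def)

lemma poly_act_add: "poly_act (p + q) M v = poly_act p M v + poly_act q M v"
proof (induction p arbitrary: q)
  case (pCons a p)
  show ?case
    by (cases q) (simp add: poly_act_pCons pCons.IH matrix_vector_right_distrib vector_sadd_rdistrib)
qed simp

lemma poly_act_smult: "poly_act (smult c p) M v = c *s poly_act p M v"
  by (induction p) (simp_all add: poly_act_pCons vector_add_ldistrib vector_smult_assoc vector_scalar_commute)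

lemma poly_act_matrix: "poly_act p M (M *v v) = M *v poly_act p M v"
  by (induction p) (simp_all add: poly_act_pCons matrix_vector_right_distrib vector_scalar_commute)

lemma poly_act_vec_add: "poly_act p M (v + w) = poly_act p M v + poly_act p M w"
  by (induction p) (simp_all add: poly_act_pCons matrix_vector_right_distrib vector_add_ldistrib)

lemma poly_act_vec_scale: "poly_act p M (c *s v) = c *s poly_act p M v"
  by (induction p) (simp_all add: poly_act_pCons vector_scalar_commute vector_smult_assoc vector_add_ldistrib mult.commute)

lemma poly_act_root: "poly_act ([:- z, 1:] * q) M v = poly_act q M (shift_op M z v)"
proof -
  have "[:- z, 1:] * q = smult (- z) q + pCons 0 q" by simp
  moreover have "shift_op M z v = M *v v + (- z) *s v" by (simp add: shift_op_def vec_eq_iff)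
  ultimately show ?thesis
    by (simp only: poly_act_add poly_act_smult poly_act_pCons poly_act_vec_add poly_act_vec_scale poly_act_matrix)
       (simp add: vec_eq_iff)
qed

lemma poly_act_monom: "poly_act (monom c k) M v = c *s (((*v) M) ^^ k) v"
  by (induction k) (simp_all add: monom_0 monom_Suc poly_act_pCons vector_scalar_commute)

lemma poly_act_sum: "finite S \<Longrightarrow> poly_act (sum f S) M v = (\<Sum>i\<in>S. poly_act (f i) M v)"
  by (induction rule: finite_induct) (simp_all add: poly_act_add)

text \<open>The iterates of \<open>v\<close> under \<open>M\<close> either repeat, which gives a
  difference of two monomials, or are eventually more numerous than the real dimension and then
  linearly dependent over the reals.\<close>

lemma annihilating_poly: "\<exists>p. p \<noteq> 0 \<and> poly_act p M (v :: complex^'n) = 0"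
proof -
  define f where "f i = (((*v) M) ^^ i) v" for i
  define n where "n = DIM(complex^'n)"
  show ?thesis
  proof (cases "inj_on f {..n}")
    case True
    then have "card (f ` {..n}) > DIM(complex^'n)" by (simp add: card_image n_def)
    then have "dependent (f ` {..n})" by (intro dependent_biggerset)
    then obtain u w where u: "w \<in> f ` {..n}" "u w \<noteq> 0" "(\<Sum>x\<in>f ` {..n}. u x *\<^sub>R x) = 0"
      by (auto simp: dependent_finite)
    then obtain j where j: "j \<le> n" "u (f j) \<noteq> 0" by auto
    define p where "p = (\<Sum>i\<le>n. monom (complex_of_real (u (f i))) i)"
    have "poly_act p M v = (\<Sum>i\<le>n. u (f i) *\<^sub>R f i)"
      unfolding p_def by (simp add: poly_act_sum poly_act_monom f_def scaleR_eq_scalar_mult)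
    also have "\<dots> = 0" using u(3) sum.reindex[OF True, of "\<lambda>x. u x *\<^sub>R x"] by simp
    finally have "poly_act p M v = 0" .
    moreover have "coeff p j = u (f j)"
      using j(1) by (simp add: p_def coeff_sum)
    then have "p \<noteq> 0" using j(2) by auto
    ultimately show ?thesis by blast
  next
    case False
    then obtain i j where ij: "i < j" "f i = f j" by (metis inj_onI linorder_neqE_nat)
    define p where "p = monom 1 j + monom (-1 :: complex) i"
    have "poly_act p M v = 0"
      using ij(2) by (simp add: p_def poly_act_add poly_act_monom f_def vec_eq_iff)
    moreover have "coeff p j = 1" using ij(1) by (simp add: p_def)
    then have "p \<noteq> 0" by auto
    ultimately show ?thesis by blast
  qed
qed

text \<open>Induction on the degree of an annihilating polynomial: a root \<open>z\<close> is split
  off, the quotient annihilates \<open>shift_op M z v\<close>, and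
  \<open>gen_eigenspace_sum_step\<close> returns from there to \<open>v\<close>.\<close>

lemma span_gen_eigenspaces: "span (\<Union>\<nu>. gen_eigenspace M \<nu>) = (UNIV :: (complex^'n) set)"
proof -
  have "v \<in> span (\<Union>\<nu>. gen_eigenspace M \<nu>)" if "p \<noteq> 0" "poly_act p M v = 0" for p and v :: "complex^'n"
    using that
  proof (induction "degree p" arbitrary: p v)
    case 0
    then obtain a where "p = [:a:]" "a \<noteq> 0" by (metis degree_eq_zeroE pCons_0_0)
    then have "v = 0" using 0 by (simp add: poly_act_pCons vec_eq_iff)
    then show ?case by (simp add: span_zero)
  next
    case (Suc k)
    then have "\<not> constant (poly p)" by (simp add: constant_degree)
    then obtain z where "poly p z = 0" using fundamental_theorem_of_algebra by blast
    then obtain q where q: "p = [:- z, 1:] * q" by (auto simp: poly_eq_0_iff_dvd)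
    then have q0: "q \<noteq> 0" using Suc.prems by auto
    have "degree p = Suc (degree q)" unfolding q using q0 by (subst degree_mult_eq) auto
    then have "shift_op M z v \<in> span (\<Union>\<nu>. gen_eigenspace M \<nu>)"
      using Suc.hyps Suc.prems q0 unfolding q poly_act_root by auto
    then show ?case by (rule gen_eigenspace_sum_step)
  qed
  then show ?thesis using annihilating_poly[of M] by blast
qed

section \<open>Spectral subspaces of a real matrix\<close>

definition re_vec :: "complex^'n \<Rightarrow> real^'n" where "re_vec v = (\<chi> i. Re (v $ i))"

lemma linear_re_vec: "linear re_vec"
  by (auto simp: linear_iff re_vec_def vec_eq_iff)

lemma re_vec_complexify: "re_vec (complexify M *v v) = M *v re_vec v"
  by (simp add: re_vec_def complexify_def matrix_vector_mult_def vec_eq_iff)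

lemma re_vec_complexify_pow: "re_vec ((((*v) (complexify M)) ^^ k) v) = (((*v) M) ^^ k) (re_vec v)"
  by (induction k) (simp_all add: re_vec_complexify)

lemma real_gen_eigenspace_eq: "real_gen_eigenspace M \<mu> = re_vec ` gen_eigenspace (complexify M) \<mu>"
  by (auto simp: real_gen_eigenspace_def re_vec_def)

lemma gen_eigenspace_trivial:
  assumes "\<not> complex_eigenvalue M \<mu>"
  shows "gen_eigenspace (complexify M) \<mu> = {0}"
proof -
  have "v = 0" if "(shift_op (complexify M) \<mu> ^^ k) v = 0" for v k
    using that
  proof (induction k)
    case (Suc k)
    then show ?case using assms by (auto simp: complex_eigenvalue_def shift_op_def)
  qed simp
  then show ?thesis by (auto simp: gen_eigenspace_iff)
qed

lemma spectral_decomposition: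
  obtains a b c where "a \<in> spectral_subspace (\<lambda>r. r < 1) M" "b \<in> spectral_subspace (\<lambda>r. r = 1) M"
    "c \<in> spectral_subspace (\<lambda>r. r > 1) M" "x = a + b + c"
proof -
  define G where "G P = (\<Union>\<mu>\<in>{\<mu>. complex_eigenvalue M \<mu> \<and> P (cmod \<mu>)}. real_gen_eigenspace M \<mu>)" for P
  \<comment> \<open>The union runs over all complex numbers; those that are not eigenvalues
    contribute only the zero vector, hence the \<open>insert 0\<close>.\<close>
  have "re_vec ` (\<Union>\<mu>. gen_eigenspace (complexify M) \<mu>) \<subseteq>
      insert 0 (G (\<lambda>r. r < 1) \<union> G (\<lambda>r. r = 1) \<union> G (\<lambda>r. r > 1))"
  proof
    fix y assume "y \<in> re_vec ` (\<Union>\<mu>. gen_eigenspace (complexify M) \<mu>)"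
    then obtain v \<mu> where v: "v \<in> gen_eigenspace (complexify M) \<mu>" and y: "y = re_vec v" by blast
    have "re_vec v = 0" if nG: "re_vec v \<notin> G (\<lambda>r. r < 1)" "re_vec v \<notin> G (\<lambda>r. r = 1)" "re_vec v \<notin> G (\<lambda>r. r > 1)"
    proof -
    have "re_vec v \<in> real_gen_eigenspace M \<mu>" using v by (simp add: real_gen_eigenspace_eq)
    then have "\<not> complex_eigenvalue M \<mu>"
      using nG v unfolding G_def by (cases "cmod \<mu>" "1::real" rule: linorder_cases) blast+
    then have "v = 0" using v(1) gen_eigenspace_trivial by blast
    then show "re_vec v = 0" by (simp add: re_vec_def vec_eq_iff)
    qed
    then show "y \<in> insert 0 (G (\<lambda>r. r < 1) \<union> G (\<lambda>r. r = 1) \<union> G (\<lambda>r. r > 1))"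
      unfolding y by blast
  qed
  then have "span (re_vec ` (\<Union>\<mu>. gen_eigenspace (complexify M) \<mu>)) \<subseteq>
      span (G (\<lambda>r. r < 1) \<union> G (\<lambda>r. r = 1) \<union> G (\<lambda>r. r > 1))"
    using span_mono by (metis span_insert_0)
  moreover have "x = re_vec (\<chi> i. complex_of_real (x $ i))" by (simp add: re_vec_def vec_eq_iff)
  then have "x \<in> span (re_vec ` (\<Union>\<mu>. gen_eigenspace (complexify M) \<mu>))"
    using span_gen_eigenspaces[of "complexify M"] linear_span_image[OF linear_re_vec] by blast
  ultimately have "x \<in> span (G (\<lambda>r. r < 1) \<union> G (\<lambda>r. r = 1) \<union> G (\<lambda>r. r > 1))" by blast
  then obtain y c where "x = y + c" "c \<in> span (G (\<lambda>r. r > 1))" "y \<in> span (G (\<lambda>r. r < 1) \<union> G (\<lambda>r. r = 1))"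
    unfolding span_Un[of _ "G (\<lambda>r. r > 1)"] by blast
  moreover from this obtain a b where "y = a + b" "a \<in> span (G (\<lambda>r. r < 1))" "b \<in> span (G (\<lambda>r. r = 1))"
    unfolding span_Un[of _ "G (\<lambda>r. r = 1)"] by blast
  ultimately show ?thesis
    using that[of a b c] by (simp add: spectral_subspace_def G_def)
qed

lemma spectral_subspace_induct:
  assumes "x \<in> spectral_subspace P M" "subspace S"
    and "\<And>\<mu> v. complex_eigenvalue M \<mu> \<Longrightarrow> P (cmod \<mu>) \<Longrightarrow> v \<in> gen_eigenspace (complexify M) \<mu> \<Longrightarrow> re_vec v \<in> S"
  shows "x \<in> S"
proof -
  have "spectral_subspace P M \<subseteq> S"
    unfolding spectral_subspace_def using assms(2,3)
    by (intro span_minimal) (auto simp: real_gen_eigenspace_eq)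
  then show ?thesis using assms(1) by blast
qed

lemma subspace_spectral_subspace: "subspace (spectral_subspace P M)"
  by (simp add: spectral_subspace_def)

lemma re_vec_in_spectral_subspace:
  assumes "complex_eigenvalue M \<mu>" "P (cmod \<mu>)" "v \<in> gen_eigenspace (complexify M) \<mu>"
  shows "re_vec v \<in> spectral_subspace P M"
  unfolding spectral_subspace_def using assms
  by (intro span_base) (auto simp: real_gen_eigenspace_eq)

lemma spectral_subspace_mono:
  "(\<And>r. P r \<Longrightarrow> Q r) \<Longrightarrow> spectral_subspace P M \<subseteq> spectral_subspace Q M"
  unfolding spectral_subspace_def by (intro span_mono) blast

lemma complexify_mult: "complexify (P ** M) = complexify P ** complexify M"
  by (simp add: complexify_def matrix_matrix_mult_def vec_eq_iff)

lemma spectral_subspace_commute: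
  assumes "Q ** M = M ** Q" "x \<in> spectral_subspace P M"
  shows "Q *v x \<in> spectral_subspace P M"
proof -
  have "x \<in> {x. Q *v x \<in> spectral_subspace P M}"
    using assms(2)
  proof (rule spectral_subspace_induct)
    show "subspace {x. Q *v x \<in> spectral_subspace P M}"
      using linear_subspace_vimage[OF matrix_vector_mul_linear subspace_spectral_subspace, of Q P M]
      by (simp add: vimage_def)
    fix \<mu> v assume v: "complex_eigenvalue M \<mu>" "P (cmod \<mu>)" "v \<in> gen_eigenspace (complexify M) \<mu>"
    have "complexify Q ** complexify M = complexify M ** complexify Q"
      using assms(1) by (simp flip: complexify_mult)
    then have "complexify Q *v v \<in> gen_eigenspace (complexify M) \<mu>"
      using v(3) unfolding gen_eigenspace_iff by (metis shift_op_pow_matrix matrix_vector_mult_0_right)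
    then show "re_vec v \<in> {x. Q *v x \<in> spectral_subspace P M}"
      using re_vec_in_spectral_subspace[of M \<mu> P, OF v(1,2)] by (simp flip: re_vec_complexify)
  qed
  then show ?thesis by simp
qed

text \<open>On a generalized eigenvector \<open>v\<close> of order \<open>k + 1\<close> a functional that vanishes on those of order
  \<open>k\<close> satisfies \<open>p (M\<^sup>j v) = \<mu>\<^sup>j p v\<close>.\<close>

lemma spectral_subspace_stable_functional:
  fixes M :: "real^'n^'n"
  assumes x: "x \<in> spectral_subspace P M" and P: "\<And>r. P r \<Longrightarrow> r \<ge> 1"
    and p: "\<And>y. (\<lambda>k. p \<bullet> (((*v) M) ^^ k) y) \<longlonglongrightarrow> 0"
  shows "p \<bullet> x = 0"
proof -
  \<comment> \<open>The complex-linear extension of \<open>p\<close>. Its real and imaginary parts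
    are values of \<open>p\<close> on real parts of complex vectors, so the decay of
    \<open>p\<close> along real orbits passes to \<open>c\<close>.\<close>
  define c where "c v = (\<Sum>i\<in>UNIV. complex_of_real (p $ i) * v $ i)" for v :: "complex^'n"
  let ?M = "complexify M"
  have Re_c: "Re (c v) = p \<bullet> re_vec v" for v by (simp add: c_def re_vec_def inner_vec_def)
  have Im_c: "Im (c v) = p \<bullet> re_vec ((- \<i>) *s v)" for v by (simp add: c_def re_vec_def inner_vec_def)
  have c_add: "c (v + w) = c v + c w" for v w by (simp add: c_def algebra_simps sum.distrib)
  have c_scale: "c (a *s v) = a * c v" for a v by (simp add: c_def sum_distrib_left algebra_simps)
  have pow_scale: "(((*v) ?M) ^^ k) (a *s v) = a *s (((*v) ?M) ^^ k) v" for k a v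
    by (induction k) (simp_all add: vector_scalar_commute)
  have lim: "(\<lambda>k. c ((((*v) ?M) ^^ k) v)) \<longlonglongrightarrow> 0" for v
  proof -
    have "(\<lambda>k. Re (c ((((*v) ?M) ^^ k) v))) \<longlonglongrightarrow> 0"
      using p[of "re_vec v"] by (simp add: Re_c re_vec_complexify_pow)
    moreover have "(\<lambda>k. Im (c ((((*v) ?M) ^^ k) v))) \<longlonglongrightarrow> 0"
      using p[of "re_vec ((- \<i>) *s v)"]
      by (simp only: Im_c re_vec_complexify_pow flip: pow_scale)
    ultimately show ?thesis by (simp add: tendsto_complex_iff)
  qed
  have key: "c v = 0" if "(shift_op ?M \<mu> ^^ k) v = 0" "cmod \<mu> \<ge> 1" for k \<mu> v
    using that(1)
  proof (induction k arbitrary: v)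
    case 0
    then show ?case by (simp add: c_def)
  next
    case (Suc k)
    note IH = Suc.IH
    have "c ((((*v) ?M) ^^ j) v) = \<mu> ^ j * c v" for j
    proof (induction j)
      case (Suc j)
      define w where "w = (((*v) ?M) ^^ j) v"
      have "(shift_op ?M \<mu> ^^ n) (?M *v z) = ?M *v (shift_op ?M \<mu> ^^ n) z" for n z
        by (rule shift_op_pow_matrix) simp
      then have "(shift_op ?M \<mu> ^^ n) ((((*v) ?M) ^^ i) v) = (((*v) ?M) ^^ i) ((shift_op ?M \<mu> ^^ n) v)" for n i
        by (induction i) simp_all
      moreover have "(((*v) ?M) ^^ i) 0 = 0" for i by (induction i) simp_all
      ultimately have "(shift_op ?M \<mu> ^^ Suc k) w = 0"
        unfolding w_def using \<open>(shift_op ?M \<mu> ^^ Suc k) v = 0\<close> by metis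
      then have "(shift_op ?M \<mu> ^^ k) (shift_op ?M \<mu> w) = 0"
        by (simp add: funpow_swap1)
      then have "c (shift_op ?M \<mu> w) = 0" by (rule IH)
      moreover have "?M *v w = shift_op ?M \<mu> w + \<mu> *s w" by (simp add: shift_op_def)
      ultimately have "c (?M *v w) = \<mu> * c w" by (simp add: c_add c_scale)
      then show ?case using \<open>c ((((*v) ?M) ^^ j) v) = \<mu> ^ j * c v\<close> by (simp add: w_def)
    qed simp
    then have "(\<lambda>j. \<mu> ^ j * c v) \<longlonglongrightarrow> 0" using lim[of v] by simp
    then have "(\<lambda>j. cmod (\<mu> ^ j * c v)) \<longlonglongrightarrow> 0" using tendsto_norm_zero by blast
    moreover have "cmod (\<mu> ^ j * c v) \<ge> cmod (c v)" for j
      using that(2) by (simp add: norm_mult norm_power mult_le_cancel_right1)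
    ultimately have "cmod (c v) \<le> 0" by (intro LIMSEQ_le_const) auto
    then show ?case by simp
  qed
  have "x \<in> {x. p \<bullet> x = 0}"
    using x
  proof (rule spectral_subspace_induct)
    show "subspace {x. p \<bullet> x = 0}" by (rule subspace_hyperplane)
    fix \<mu> v assume v: "P (cmod \<mu>)" "v \<in> gen_eigenspace ?M \<mu>"
    then obtain k where "(shift_op ?M \<mu> ^^ k) v = 0" by (auto simp: gen_eigenspace_iff)
    then have "c v = 0" using key P v(1) by blast
    then show "re_vec v \<in> {x. p \<bullet> x = 0}" by (simp flip: Re_c)
  qed
  then show ?thesis by simp
qed

lemma norm_vector_scalar_mult: "norm (c *s v) = cmod c * norm (v :: complex^'n)"
  by (simp add: norm_vec_def norm_mult L2_set_right_distrib)

text \<open>No explicit powers of Jordan blocks are computed. With \<open>a j\<close> the norm of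
  the j-th iterate of \<open>v\<close> and \<open>b j\<close> the same for
  \<open>shift_op M \<mu> v\<close>, one has \<open>a (Suc j) \<le> cmod \<mu> * a j + b j\<close>.
  Since \<open>cmod \<mu> < 1\<close> and \<open>b\<close> is summable by induction on the order,
  summing this bounds all partial sums of \<open>a\<close>.\<close>

lemma spectral_subspace_summable:
  assumes x: "x \<in> spectral_subspace (\<lambda>r. r < 1) M"
  shows "summable (\<lambda>k. norm ((((*v) M) ^^ k) x))"
proof -
  let ?M = "complexify M"
  have key: "summable (\<lambda>j. norm ((((*v) ?M) ^^ j) v))" if "(shift_op ?M \<mu> ^^ k) v = 0" "cmod \<mu> < 1" for k \<mu> v
    using that(1)
  proof (induction k arbitrary: v)
    case 0
    have "(((*v) ?M) ^^ j) 0 = 0" for j by (induction j) simp_all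
    with 0 show ?case by simp
  next
    case (Suc k)
    define a where "a j = norm ((((*v) ?M) ^^ j) v)" for j
    define b where "b j = norm ((((*v) ?M) ^^ j) (shift_op ?M \<mu> v))" for j
    have b: "summable b" unfolding b_def using Suc.prems by (intro Suc.IH) (simp add: funpow_swap1)
    have ab: "a (Suc j) \<le> cmod \<mu> * a j + b j" for j
    proof -
      have "(((*v) ?M) ^^ j) (shift_op ?M \<mu> v) = (((*v) ?M) ^^ Suc j) v - \<mu> *s (((*v) ?M) ^^ j) v"
        by (induction j) (simp_all add: shift_op_def matrix_vector_mult_diff_distrib vector_scalar_commute)
      then have "(((*v) ?M) ^^ Suc j) v = \<mu> *s (((*v) ?M) ^^ j) v + (((*v) ?M) ^^ j) (shift_op ?M \<mu> v)" by simp
      then have "a (Suc j) \<le> norm (\<mu> *s (((*v) ?M) ^^ j) v) + b j"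
        unfolding a_def b_def by (metis norm_triangle_ineq)
      then show ?thesis by (simp add: norm_vector_scalar_mult a_def)
    qed
    have le: "(\<Sum>j<n. a j) \<le> (a 0 + suminf b) / (1 - cmod \<mu>)" for n
    proof -
      have "(\<Sum>j<n. a j) \<le> (\<Sum>j<Suc n. a j)" by (simp add: a_def)
      also have "\<dots> = a 0 + (\<Sum>j<n. a (Suc j))" by (rule sum.lessThan_Suc_shift)
      also have "\<dots> \<le> a 0 + (\<Sum>j<n. cmod \<mu> * a j + b j)" by (intro add_left_mono sum_mono ab)
      also have "\<dots> = a 0 + cmod \<mu> * (\<Sum>j<n. a j) + (\<Sum>j<n. b j)" by (simp add: sum.distrib sum_distrib_left)
      also have "(\<Sum>j<n. b j) \<le> suminf b" by (rule sum_le_suminf[OF b]) (auto simp: b_def)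
      finally have "(\<Sum>j<n. a j) * (1 - cmod \<mu>) \<le> a 0 + suminf b" by (simp add: algebra_simps)
      then show ?thesis using that(2) by (simp add: pos_le_divide_eq)
    qed
    then show ?case unfolding a_def[symmetric] by (intro summableI_nonneg_bounded[OF _ le]) (simp add: a_def)
  qed
  have lin: "linear (((*v) M) ^^ k)" for k by (intro linear_funpow matrix_vector_mul_linear)
  have "x \<in> {x. summable (\<lambda>k. norm ((((*v) M) ^^ k) x))}"
    using x
  proof (rule spectral_subspace_induct)
    show "subspace {x. summable (\<lambda>k. norm ((((*v) M) ^^ k) x))}"
      unfolding subspace_def
    proof (safe)
      fix x y assume "summable (\<lambda>k. norm ((((*v) M) ^^ k) x))" "summable (\<lambda>k. norm ((((*v) M) ^^ k) y))"
      from summable_add[OF this] show "summable (\<lambda>k. norm ((((*v) M) ^^ k) (x + y)))"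
        by (rule summable_comparison_test'[where N = 0]) (simp add: linear_add[OF lin] norm_triangle_ineq)
    qed (simp_all add: linear_0[OF lin] linear_scale[OF lin] summable_mult)
    fix \<mu> v assume v: "cmod \<mu> < 1" "v \<in> gen_eigenspace ?M \<mu>"
    then obtain k where "(shift_op ?M \<mu> ^^ k) v = 0" by (auto simp: gen_eigenspace_iff)
    from key[OF this v(1)] have "summable (\<lambda>k. norm ((((*v) M) ^^ k) (re_vec v)))"
    proof (rule summable_comparison_test'[where N = 0])
      have "norm (re_vec w) \<le> norm w" for w :: "complex^'n"
        unfolding norm_vec_def by (rule L2_set_mono) (auto simp: re_vec_def abs_Re_le_cmod)
      then show "norm (norm ((((*v) M) ^^ k) (re_vec v))) \<le> norm ((((*v) ?M) ^^ k) v)" for k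
        by (simp flip: re_vec_complexify_pow)
    qed
    then show "re_vec v \<in> {x. summable (\<lambda>k. norm ((((*v) M) ^^ k) x))}" by simp
  qed
  then show ?thesis by simp
qed

lemma complexify_one: "complexify (mat 1) = mat 1"
  by (simp add: complexify_def mat_def vec_eq_iff)

text \<open>By \<open>N - 1/\<mu> = - (1/\<mu>) N (M - \<mu>)\<close>, the generalized eigenspace of
  \<open>M\<close> for \<open>\<mu>\<close> lies in that of \<open>N\<close> for
  \<open>1/\<mu>\<close>. The condition \<open>r > 0\<close> guards against the convention
  \<open>inverse 0 = 0\<close>, by which \<open>r = 0\<close> could satisfy
  \<open>P (inverse r)\<close>.\<close>

lemma spectral_subspace_inverse:
  assumes inv: "M ** N = mat 1" "N ** M = mat 1" and x: "x \<in> spectral_subspace P M"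
  shows "x \<in> spectral_subspace (\<lambda>r. r > 0 \<and> P (inverse r)) N"
  using x
proof (rule spectral_subspace_induct)
  show "subspace (spectral_subspace (\<lambda>r. r > 0 \<and> P (inverse r)) N)" by (rule subspace_spectral_subspace)
  fix \<mu> v assume \<mu>: "complex_eigenvalue M \<mu>" "P (cmod \<mu>)" and v: "v \<in> gen_eigenspace (complexify M) \<mu>"
  let ?M = "complexify M" and ?N = "complexify N"
  have cinv: "?M ** ?N = mat 1" "?N ** ?M = mat 1"
    using inv by (simp_all add: complexify_one flip: complexify_mult)
  have NM: "?N *v (?M *v w) = w" for w by (simp add: matrix_vector_mul_assoc cinv)
  obtain w where w: "w \<noteq> 0" "?M *v w = \<mu> *s w" using \<mu>(1) by (auto simp: complex_eigenvalue_def)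
  have w': "w = \<mu> *s (?N *v w)" using NM[of w] w(2) by (simp add: vector_scalar_commute)
  have \<mu>0: "\<mu> \<noteq> 0" using w(1) w' by auto
  have "?N *v w = inverse \<mu> *s w"
    using arg_cong[OF w', of "\<lambda>z. inverse \<mu> *s z"] \<mu>0 by (simp add: vector_smult_assoc)
  then have ev: "complex_eigenvalue N (inverse \<mu>)" using w(1) by (auto simp: complex_eigenvalue_def)
  have shift: "shift_op ?N (inverse \<mu>) z = (- inverse \<mu>) *s (?N *v shift_op ?M \<mu> z)" for z
  proof -
    have "?N *v shift_op ?M \<mu> z = z - \<mu> *s (?N *v z)"
      by (simp add: shift_op_def matrix_vector_mult_diff_distrib NM vector_scalar_commute)
    then show ?thesis
      unfolding \<open>?N *v shift_op ?M \<mu> z = z - \<mu> *s (?N *v z)\<close> unfolding shift_op_def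
      using \<mu>0 by (simp add: vec_eq_iff field_simps)
  qed
  obtain k where k: "(shift_op ?M \<mu> ^^ k) v = 0" using v by (auto simp: gen_eigenspace_iff)
  have comm: "?N ** ?M = ?M ** ?N" using cinv by simp
  have "(shift_op ?N (inverse \<mu>) ^^ k) v = 0"
    using k
  proof (induction k arbitrary: v)
    case (Suc k)
    have "(shift_op ?M \<mu> ^^ k) (shift_op ?N (inverse \<mu>) v) = (- inverse \<mu>) *s (?N *v (shift_op ?M \<mu> ^^ k) (shift_op ?M \<mu> v))"
      unfolding shift shift_op_pow_scale shift_op_pow_matrix[OF comm] ..
    also have "\<dots> = 0" using Suc.prems by (simp add: funpow_swap1)
    finally show ?case using Suc.IH by (simp add: funpow_swap1)
  qed simp
  then have "v \<in> gen_eigenspace ?N (inverse \<mu>)" by (auto simp: gen_eigenspace_iff)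
  then show "re_vec v \<in> spectral_subspace (\<lambda>r. r > 0 \<and> P (inverse r)) N"
    using \<mu>(2) \<mu>0 by (intro re_vec_in_spectral_subspace[OF ev]) (simp_all add: norm_inverse)
qed

lemma complex_eigenvalue_iff: "complex_eigenvalue M \<mu> \<longleftrightarrow> det (complexify M - mat \<mu>) = 0"
proof -
  have "(complexify M - mat \<mu>) *v v = complexify M *v v - \<mu> *s v" for v
  proof -
    have "mat \<mu> *v v = \<mu> *s v"
      by (simp add: vec_eq_iff matrix_vector_mult_def mat_def if_distrib[where f = "\<lambda>a. a * _"] cong: if_cong)
    then show ?thesis by (simp add: matrix_vector_mult_diff_rdistrib)
  qed
  then have "complex_eigenvalue M \<mu> \<longleftrightarrow> (\<exists>v. (complexify M - mat \<mu>) *v v = 0 \<and> v \<noteq> 0)"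
    by (auto simp: complex_eigenvalue_def)
  also have "\<dots> \<longleftrightarrow> \<not> invertible (complexify M - mat \<mu>)"
    using matrix_left_invertible_ker[of "complexify M - mat \<mu>"] invertible_left_inverse by blast
  finally show ?thesis by (simp add: invertible_det_nz)
qed

lemma complex_eigenvalue_transpose: "complex_eigenvalue (transpose M) \<mu> \<longleftrightarrow> complex_eigenvalue M \<mu>"
proof -
  have "complexify (transpose M) - mat \<mu> = transpose (complexify M - mat \<mu>)"
    by (simp add: complexify_def transpose_def mat_def vec_eq_iff)
  then show ?thesis by (simp add: complex_eigenvalue_iff det_transpose)
qed

text \<open>A trivial spectral subspace means that no eigenvalue has a modulus satisfying
  \<open>P\<close>, and the transpose has the same eigenvalues.\<close>

lemma spectral_subspace_transpose_trivial:
  assumes "spectral_subspace P M = {0}"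
  shows "spectral_subspace P (transpose M) = {0}"
proof -
  have "\<not> (complex_eigenvalue M \<mu> \<and> P (cmod \<mu>))" for \<mu>
  proof
    assume \<mu>: "complex_eigenvalue M \<mu> \<and> P (cmod \<mu>)"
    then obtain v where v: "v \<noteq> 0" "complexify M *v v = \<mu> *s v" by (auto simp: complex_eigenvalue_def)
    then have "(shift_op (complexify M) \<mu> ^^ 1) v = 0" by (simp add: shift_op_def)
    then have "v \<in> gen_eigenspace (complexify M) \<mu>" unfolding gen_eigenspace_iff by blast
    then have "re_vec (a *s v) = 0" for a
      using re_vec_in_spectral_subspace[of M \<mu> P] \<mu> gen_eigenspace_scale assms by blast
    \<comment> \<open>The two multiples give the real and the imaginary part of
      \<open>v\<close>.\<close>
    from this[of 1] this[of "- \<i>"] have "v = 0" by (simp add: re_vec_def vec_eq_iff complex_eq_iff)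
    then show False using v(1) by simp
  qed
  then have none: "{\<mu>. complex_eigenvalue M \<mu> \<and> P (cmod \<mu>)} = {}" by blast
  show ?thesis
    unfolding spectral_subspace_def complex_eigenvalue_transpose none by simp
qed

section \<open>The phase space of the autonomized system\<close>

text \<open>The preimage under the covering of the phase space by the real line times
  \<open>real^'n\<close>; interiors and closures over the circle are computed up there.\<close>

definition lift_set :: "real \<Rightarrow> (real \<times> (real^'n)) set \<Rightarrow> (real \<times> (real^'n)) set" where
  "lift_set T S = {(t, x). (t rmod T, x) \<in> S}"

lemma rmod_shift [simp]: "(t + of_int k * T) rmod T = t rmod T"
proof -
  have "[t = t + of_int k * T] (rmod T)" unfolding rcong_altdef by blast
  then show ?thesis by (simp add: rcong_def)
qed

lemma rmod_eqE:
  assumes "s rmod T = t rmod T"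
  obtains k :: int where "s = t + of_int k * T"
  using assms rcong_altdef[of t s T] by (auto simp: rcong_def)

lemma rmodE:
  obtains k :: int where "t = t rmod T + of_int k * T"
  using rmod_eqE[of t T "t rmod T"] by auto

lemma topspace_phase_space: "T > 0 \<Longrightarrow> topspace (phase_space T) = {0..<T} \<times> UNIV"
  by (simp add: phase_space_def topspace_circle)

text \<open>The product of the quotient map with the identity is again a quotient map, because the
  saturation of an open set of times is a union of translates and hence open.\<close>

lemma openin_phase_space:
  assumes T: "T > 0"
  shows "openin (phase_space T) S \<longleftrightarrow> S \<subseteq> {0..<T} \<times> UNIV \<and> open (lift_set T S)"
proof
  assume S: "openin (phase_space T) S"
  have "open (lift_set T S)"
    unfolding open_prod_def
  proof clarify
    fix t x assume "(t, x) \<in> lift_set T S"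
    then have tx: "(t rmod T, x) \<in> S" by (simp add: lift_set_def)
    have alt: "\<forall>x y. (x, y) \<in> S \<longrightarrow>
        (\<exists>V. openin (circle T) V \<and> (\<exists>W. open W \<and> x \<in> V \<and> y \<in> W \<and> V \<times> W \<subseteq> S))"
      using S by (simp add: phase_space_def openin_prod_topology_alt)
    obtain V W where VW: "openin (circle T) V" "open W" "t rmod T \<in> V" "x \<in> W" "V \<times> W \<subseteq> S"
      using alt[rule_format, OF tx] by (elim exE conjE)
    then show "\<exists>A B. open A \<and> open B \<and> (t, x) \<in> A \<times> B \<and> A \<times> B \<subseteq> lift_set T S"
      by (intro exI[of _ "{t. t rmod T \<in> V}"] exI[of _ W]) (auto simp: openin_circle lift_set_def)
  qed
  moreover have "S \<subseteq> {0..<T} \<times> UNIV" using openin_subset[OF S] T by (simp add: topspace_phase_space)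
  ultimately show "S \<subseteq> {0..<T} \<times> UNIV \<and> open (lift_set T S)" by blast
next
  assume S: "S \<subseteq> {0..<T} \<times> UNIV \<and> open (lift_set T S)"
  show "openin (phase_space T) S"
    unfolding phase_space_def openin_prod_topology_alt
  proof (intro allI impI)
    fix \<tau> x assume \<tau>x: "(\<tau>, x) \<in> S"
    then have "(\<tau>, x) \<in> lift_set T S" using S by (auto simp: lift_set_def)
    then obtain V W where VW: "open V" "open W" "\<tau> \<in> V" "x \<in> W" "V \<times> W \<subseteq> lift_set T S"
      using S by (auto elim!: open_prod_elim)
    let ?V = "(\<lambda>t. t rmod T) ` V"
    have "{t. t rmod T \<in> ?V} = (\<Union>k::int. (\<lambda>t. of_int k * T + t) ` V)"
    proof (intro equalityI subsetI)
      fix t assume "t \<in> {t. t rmod T \<in> ?V}"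
      then obtain v where v: "v \<in> V" "t rmod T = v rmod T" by auto
      obtain k :: int where "t = of_int k * T + v"
        using rmod_eqE[OF v(2)] by (metis add.commute)
      with v(1) show "t \<in> (\<Union>k::int. (\<lambda>t. of_int k * T + t) ` V)" by blast
    qed (auto simp: add.commute)
    moreover have "open \<dots>" using VW(1) by (intro open_UN ballI open_translation)
    ultimately have "openin (circle T) ?V"
      using T by (auto simp: openin_circle rmod_less rmod_nonneg)
    moreover have "\<tau> \<in> ?V" using VW(3) \<tau>x S by (auto intro!: image_eqI[of _ _ \<tau>])
    moreover have "?V \<times> W \<subseteq> S" using VW(5) by (auto simp: lift_set_def)
    ultimately show "\<exists>V W. openin (circle T) V \<and> openin euclidean W \<and> \<tau> \<in> V \<and> x \<in> W \<and> V \<times> W \<subseteq> S"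
      using VW by (intro exI[of _ ?V] exI[of _ W]) auto
  qed
qed

definition proj_set :: "real \<Rightarrow> (real \<times> (real^'n)) set \<Rightarrow> (real \<times> (real^'n)) set" where
  "proj_set T S = (\<lambda>(t, x). (t rmod T, x)) ` S"

lemma mem_proj_set: "p \<in> S \<Longrightarrow> (fst p rmod T, snd p) \<in> proj_set T S"
  unfolding proj_set_def by (rule image_eqI) (simp_all add: case_prod_beta)

lemma openin_proj_set:
  assumes T: "T > 0" and S: "open S"
  shows "openin (phase_space T) (proj_set T S)"
proof -
  have "lift_set T (proj_set T S) = (\<Union>k::int. (\<lambda>p. (of_int k * T, 0) + p) ` S)"
  proof (intro equalityI subsetI)
    fix p assume "p \<in> lift_set T (proj_set T S)"
    then obtain s where s: "(s, snd p) \<in> S" "fst p rmod T = s rmod T"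
      by (auto simp: lift_set_def proj_set_def)
    obtain k :: int where "fst p = s + of_int k * T" using s(2) by (rule rmod_eqE)
    then have "p = (of_int k * T, 0) + (s, snd p)" by (simp add: prod_eq_iff)
    then show "p \<in> (\<Union>k::int. (\<lambda>p. (of_int k * T, 0) + p) ` S)" using s(1) by blast
  next
    fix p assume "p \<in> (\<Union>k::int. (\<lambda>p. (of_int k * T, 0) + p) ` S)"
    then obtain k :: int and q where q: "q \<in> S" "p = (of_int k * T, 0) + q" by blast
    then have "(fst p rmod T, snd p) = (\<lambda>(t, x). (t rmod T, x)) q"
      by (simp add: case_prod_beta add.commute)
    then have "(fst p rmod T, snd p) \<in> proj_set T S" unfolding proj_set_def using q(1) by (rule image_eqI)
    then show "p \<in> lift_set T (proj_set T S)" by (simp add: lift_set_def case_prod_beta)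
  qed
  moreover have "open \<dots>" using S by (intro open_UN ballI open_translation)
  ultimately show ?thesis
    using T by (auto simp: openin_phase_space proj_set_def rmod_less rmod_nonneg)
qed

lemma closure_of_phase_space:
  assumes T: "T > 0"
  shows "p \<in> phase_space T closure_of S \<longleftrightarrow> p \<in> {0..<T} \<times> UNIV \<and> p \<in> closure (lift_set T S)"
proof (cases "p \<in> {0..<T} \<times> UNIV")
  case True
  then have pp: "(fst p rmod T, snd p) = p" by auto
  have "(\<forall>V. p \<in> V \<and> openin (phase_space T) V \<longrightarrow> (\<exists>y\<in>S. y \<in> V)) \<longleftrightarrow> p \<in> closure (lift_set T S)"
  proof
    assume L: "\<forall>V. p \<in> V \<and> openin (phase_space T) V \<longrightarrow> (\<exists>y\<in>S. y \<in> V)"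
    have "\<exists>y\<in>lift_set T S. y \<in> V" if V: "open V" "p \<in> V" for V
    proof -
      have "p \<in> proj_set T V" using mem_proj_set[OF V(2), of T] pp by simp
      then obtain y where "y \<in> S" "y \<in> proj_set T V" using L openin_proj_set[OF T V(1)] by blast
      then show ?thesis by (auto simp: proj_set_def lift_set_def)
    qed
    then show "p \<in> closure (lift_set T S)" unfolding closure_iff_nhds_not_empty by blast
  next
    assume R: "p \<in> closure (lift_set T S)"
    show "\<forall>V. p \<in> V \<and> openin (phase_space T) V \<longrightarrow> (\<exists>y\<in>S. y \<in> V)"
    proof (intro allI impI)
      fix V assume V: "p \<in> V \<and> openin (phase_space T) V"
      then have "open (lift_set T V)" "p \<in> lift_set T V"
        using T pp by (auto simp: openin_phase_space lift_set_def split: prod.splits)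
      then obtain y where "y \<in> lift_set T S" "y \<in> lift_set T V"
        using R unfolding closure_iff_nhds_not_empty by blast
      then show "\<exists>y\<in>S. y \<in> V" by (auto simp: lift_set_def)
    qed
  qed
  then show ?thesis
    unfolding in_closure_of topspace_phase_space[OF T] using True by (simp only: Bex_def simp_thms)
qed (simp add: in_closure_of topspace_phase_space[OF T])

lemma interior_of_phase_space:
  assumes T: "T > 0" and S: "S \<subseteq> {0..<T} \<times> UNIV"
  shows "p \<in> phase_space T interior_of S \<longleftrightarrow> p \<in> {0..<T} \<times> UNIV \<and> p \<in> interior (lift_set T S)"
proof
  assume "p \<in> phase_space T interior_of S"
  then obtain V where V: "openin (phase_space T) V" "p \<in> V" "V \<subseteq> S" by (auto simp: interior_of_def)
  then have p: "p \<in> {0..<T} \<times> UNIV" using S by blast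
  then have "(fst p rmod T, snd p) = p" by auto
  then have "open (lift_set T V)" "p \<in> lift_set T V" "lift_set T V \<subseteq> lift_set T S"
    using T V by (auto simp: openin_phase_space lift_set_def split: prod.splits)
  then show "p \<in> {0..<T} \<times> UNIV \<and> p \<in> interior (lift_set T S)" using p interiorI by blast
next
  assume p: "p \<in> {0..<T} \<times> UNIV \<and> p \<in> interior (lift_set T S)"
  then have pp: "(fst p rmod T, snd p) = p" by auto
  have "openin (phase_space T) (proj_set T (interior (lift_set T S)))"
    by (rule openin_proj_set[OF T open_interior])
  moreover have "proj_set T (interior (lift_set T S)) \<subseteq> S"
    using interior_subset by (fastforce simp: proj_set_def lift_set_def)
  moreover have "p \<in> proj_set T (interior (lift_set T S))" using mem_proj_set[of p "interior (lift_set T S)" T] p pp by simp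
  ultimately show "p \<in> phase_space T interior_of S" unfolding interior_of_def by blast
qed

section \<open>Periodic sampling\<close>

locale controllable_system = periodic_control_system T A B U K C
  for T :: real and A :: "real \<Rightarrow> real^'n^'n" and B :: "real \<Rightarrow> real^'m^'n"
    and U :: "(real^'m) set" and K C :: real +
  assumes controllable: "controllable A B"
begin

definition fwd_step :: "real \<Rightarrow> real^'n \<Rightarrow> real^'n" where "fwd_step \<tau> x = X (\<tau> + T) \<tau> *v x"

definition bwd_step :: "real \<Rightarrow> real^'n \<Rightarrow> real^'n" where "bwd_step \<tau> x = X \<tau> (\<tau> + T) *v x"

definition J :: "real \<Rightarrow> nat \<Rightarrow> (real^'n) set" where
  "J \<tau> k = {\<phi> (\<tau> + real k * T) \<tau> 0 u | u. u \<in> controls U}"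

lemma fwd_step_pow: "(fwd_step \<tau> ^^ k) x = X (\<tau> + real k * T) \<tau> *v x"
proof (induction k)
  case (Suc k)
  have "X (\<tau> + T) \<tau> = X (\<tau> + real (Suc k) * T) (\<tau> + real k * T)"
    using fund_sol_shift[of "\<tau> + T" "int k" \<tau>] by (simp add: algebra_simps)
  then show ?case using Suc by (simp add: fwd_step_def fund_sol_vec)
qed simp

lemma bwd_step_pow: "(bwd_step \<tau> ^^ k) x = X \<tau> (\<tau> + real k * T) *v x"
proof (induction k arbitrary: x)
  case (Suc k)
  have "X \<tau> (\<tau> + T) = X (\<tau> + real k * T) (\<tau> + real (Suc k) * T)"
    using fund_sol_shift[of \<tau> "int k" "\<tau> + T"] by (simp add: algebra_simps)
  then show ?case using Suc[of "bwd_step \<tau> x"] by (simp add: bwd_step_def fund_sol_vec funpow_swap1)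
qed simp

lemma fwd_step_matrix: "fwd_step \<tau> = (*v) (X (T + \<tau>) \<tau>)"
  by (simp add: fwd_step_def fun_eq_iff add.commute)

lemma bwd_step_matrix: "bwd_step \<tau> = (*v) (X \<tau> (T + \<tau>))"
  by (simp add: bwd_step_def fun_eq_iff add.commute)

lemma discrete_system: "discrete_system (fwd_step \<tau>) (bwd_step \<tau>) (J \<tau>)"
proof
  show "fwd_step \<tau> (x + y) = fwd_step \<tau> x + fwd_step \<tau> y" "bwd_step \<tau> (x + y) = bwd_step \<tau> x + bwd_step \<tau> y"
    "fwd_step \<tau> (c *\<^sub>R x) = c *\<^sub>R fwd_step \<tau> x" "bwd_step \<tau> (c *\<^sub>R x) = c *\<^sub>R bwd_step \<tau> x"
    "fwd_step \<tau> (bwd_step \<tau> x) = x" "bwd_step \<tau> (fwd_step \<tau> x) = x" for x y c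
    by (simp_all add: fwd_step_def bwd_step_def matrix_vector_right_distrib matrix_vector_mult_scaleR fund_sol_vec)
  show "convex (J \<tau> k)" for k
  proof (rule convexI)
    fix x y and a b :: real
    assume "x \<in> J \<tau> k" "y \<in> J \<tau> k" and ab: "0 \<le> a" "0 \<le> b" "a + b = 1"
    then obtain u v where uv: "u \<in> controls U" "v \<in> controls U"
      "x = \<phi> (\<tau> + real k * T) \<tau> 0 u" "y = \<phi> (\<tau> + real k * T) \<tau> 0 v" by (auto simp: J_def)
    have "a *\<^sub>R x + b *\<^sub>R y = \<phi> (\<tau> + real k * T) \<tau> 0 (\<lambda>r. a *\<^sub>R u r + b *\<^sub>R v r)"
      using traj_linear[of u v "\<tau> + real k * T" \<tau> a 0 b 0] uv by (simp add: controls_Linf)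
    then show "a *\<^sub>R x + b *\<^sub>R y \<in> J \<tau> k"
      unfolding J_def using controls_convex[OF convex_U uv(1,2) ab] by blast
  qed
  show "J \<tau> 0 = {0}"
  proof
    show "J \<tau> 0 \<subseteq> {0}" by (auto simp: J_def controls_Linf)
    show "{0} \<subseteq> J \<tau> 0" unfolding J_def by (auto intro!: exI[of _ "\<lambda>_. 0"])
  qed
  show "0 \<in> J \<tau> k" for k unfolding J_def by (intro CollectI exI[of _ "\<lambda>_. 0"]) simp
  show "J \<tau> (k + l) = {(fwd_step \<tau> ^^ l) x + y |x y. x \<in> J \<tau> k \<and> y \<in> J \<tau> l}" for k l
  proof -
    let ?k = "\<tau> + real k * T" and ?kl = "\<tau> + real (k + l) * T"
    have le: "\<tau> \<le> ?k" "?k \<le> ?kl" using T_pos by (simp_all add: algebra_simps)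
    have X: "X ?kl ?k = X (\<tau> + real l * T) \<tau>"
      using fund_sol_shift[of "\<tau> + real l * T" "int k" \<tau>] by (simp add: algebra_simps)
    have split: "\<phi> ?kl ?k x v = (fwd_step \<tau> ^^ l) x + \<phi> ?kl ?k 0 v" if "v \<in> controls U" for x v
      using traj_decomp[of v ?kl ?k x] that X by (simp add: controls_Linf fwd_step_pow)
    show ?thesis
    proof (intro equalityI subsetI)
      fix z assume "z \<in> J \<tau> (k + l)"
      then obtain u where u: "u \<in> controls U" "z = \<phi> ?kl \<tau> 0 u" by (auto simp: J_def)
      define x where "x = \<phi> ?k \<tau> 0 u"
      have "z = \<phi> ?kl ?k x u" using u by (simp add: x_def traj_traj controls_Linf)
      moreover have "\<phi> ?kl ?k 0 u \<in> J \<tau> l"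
      proof -
        obtain v where v: "v \<in> controls U"
            "\<And>t s x. \<phi> (t + of_int (- int k) * T) (s + of_int (- int k) * T) x v = \<phi> t s x u"
          by (rule traj_shift_controls[OF u(1)]) (rule that)
        have "\<phi> ?kl ?k 0 u = \<phi> (\<tau> + real l * T) \<tau> 0 v" using v(2)[of ?kl ?k 0] by (simp add: algebra_simps)
        then show ?thesis using v(1) by (auto simp: J_def)
      qed
      moreover have "x \<in> J \<tau> k" using u by (auto simp: J_def x_def)
      ultimately show "z \<in> {(fwd_step \<tau> ^^ l) x + y |x y. x \<in> J \<tau> k \<and> y \<in> J \<tau> l}"
        using split[OF u(1), of x] by blast
    next
      fix z assume "z \<in> {(fwd_step \<tau> ^^ l) x + y |x y. x \<in> J \<tau> k \<and> y \<in> J \<tau> l}"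
      then obtain u v where u: "u \<in> controls U" "v \<in> controls U"
        "z = (fwd_step \<tau> ^^ l) (\<phi> ?k \<tau> 0 u) + \<phi> (\<tau> + real l * T) \<tau> 0 v" by (auto simp: J_def)
      obtain v' where v': "v' \<in> controls U"
          "\<And>t s x. \<phi> (t + of_int (int k) * T) (s + of_int (int k) * T) x v' = \<phi> t s x v"
        by (rule traj_shift_controls[OF u(2)]) (rule that)
      have "\<phi> (\<tau> + real l * T) \<tau> 0 v = \<phi> ?kl ?k 0 v'"
        using v'(2)[of "\<tau> + real l * T" \<tau> 0] by (simp add: algebra_simps)
      then have z: "z = \<phi> ?kl ?k (\<phi> ?k \<tau> 0 u) v'" using u(3) split[OF v'(1), of "\<phi> ?k \<tau> 0 u"] by simp
      obtain w where "w \<in> controls U" "\<And>x. \<phi> ?kl \<tau> x w = \<phi> ?kl ?k (\<phi> ?k \<tau> x u) v'"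
        by (rule traj_switch_controls[OF u(1) v'(1) le]) (rule that)
      then show "z \<in> J \<tau> (k + l)" unfolding J_def z by (intro CollectI exI[of _ w]) simp
    qed
  qed
qed

text \<open>Controllability supplies a control steering \<open>x\<close> to 0. It is merely bounded;
  scaling it together with the state makes it admissible, and zero control fills the time up to a
  whole number of periods. \<open>CARD('n)\<close> enters as the dimension of the state
  space.\<close>

lemma discrete_reach: "discrete_reach (fwd_step \<tau>) (bwd_step \<tau>) (J \<tau>) CARD('n)"
proof -
  interpret discrete_system "fwd_step \<tau>" "bwd_step \<tau>" "J \<tau>" by (rule discrete_system)
  have "\<exists>\<delta>>0. - \<delta> *\<^sub>R x \<in> J \<tau> k" if x: "x \<in> J \<tau> k" for k x
  proof -
    obtain u where u: "u \<in> controls U" "x = \<phi> (\<tau> + real k * T) \<tau> 0 u" using x by (auto simp: J_def)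
    obtain \<delta> where "\<delta> > 0" and \<delta>: "(\<lambda>t. - \<delta> *\<^sub>R u t) \<in> controls U"
      using controls_scale[OF zero_U controls_Linf[OF u(1)]] by blast
    moreover have "- \<delta> *\<^sub>R x = \<phi> (\<tau> + real k * T) \<tau> 0 (\<lambda>t. - \<delta> *\<^sub>R u t)"
      using traj_scaleR[OF controls_Linf[OF u(1)], of _ _ "- \<delta>" 0] u(2) by simp
    ultimately show ?thesis unfolding J_def by blast
  qed
  moreover have "\<exists>k. \<exists>\<delta>>0. \<exists>y\<in>J \<tau> k. (fwd_step \<tau> ^^ k) (\<delta> *\<^sub>R x) + y = 0" for x
  proof -
    obtain t1 u where u: "t1 > \<tau>" "Linf_on {\<tau>..t1} u"
      "\<phi> t1 \<tau> x (\<lambda>t. indicator {\<tau>..t1} t *\<^sub>R u t) = 0"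
      using controllable unfolding controllable_def by blast
    define w where "w t = indicator {\<tau>..t1} t *\<^sub>R u t" for t
    obtain M where M: "AE t in lebesgue. t \<in> {\<tau>..t1} \<longrightarrow> norm (u t) \<le> M"
      using u(2) by (auto simp: Linf_on_def)
    have "AE t in lebesgue. norm (w t) \<le> max M 0"
      using M by eventually_elim (auto simp: w_def indicator_def)
    then have w: "Linf_on UNIV w"
      using u(2) by (auto simp: Linf_on_UNIV_iff w_def[abs_def] Linf_on_def set_borel_measurable_def)
    obtain \<delta> where \<delta>: "\<delta> > 0" "(\<lambda>t. \<delta> *\<^sub>R w t) \<in> controls U"
      using controls_scale[OF zero_U w] by blast
    obtain k :: nat where "(t1 - \<tau>) / T \<le> real k" using real_arch_simple by blast
    then have k: "t1 \<le> \<tau> + real k * T" using T_pos by (simp add: field_simps)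
    obtain v where v: "v \<in> controls U"
        "\<And>x. \<phi> (\<tau> + real k * T) \<tau> x v = \<phi> (\<tau> + real k * T) t1 (\<phi> t1 \<tau> x (\<lambda>t. \<delta> *\<^sub>R w t)) (\<lambda>_. 0)"
      by (rule traj_switch_controls[OF \<delta>(2) zero_control less_imp_le[OF u(1)] k]) (rule that)
    have "\<phi> t1 \<tau> (\<delta> *\<^sub>R x) (\<lambda>t. \<delta> *\<^sub>R w t) = 0"
      using traj_scaleR[OF w, of t1 \<tau> \<delta> x] u(3) by (simp add: w_def[abs_def])
    then have "\<phi> (\<tau> + real k * T) \<tau> (\<delta> *\<^sub>R x) v = 0" using v(2) by simp
    then have "(fwd_step \<tau> ^^ k) (\<delta> *\<^sub>R x) + \<phi> (\<tau> + real k * T) \<tau> 0 v = 0"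
      using traj_decomp[OF controls_Linf[OF v(1)], of "\<tau> + real k * T" \<tau> "\<delta> *\<^sub>R x"] by (simp add: fwd_step_pow)
    then show ?thesis using \<delta>(1) v(1) unfolding J_def by blast
  qed
  ultimately have "0 \<in> interior (J \<tau> DIM(real^'n))" by (rule interior_I_DIM)
  then show ?thesis
    by unfold_locales simp_all
qed

lemma RF_eq_Union_J: "RF \<tau> = (\<Union>k. J \<tau> k)"
proof (intro equalityI subsetI)
  fix x assume "x \<in> RF \<tau>"
  then obtain s1 where s1: "\<And>s. s \<le> s1 \<Longrightarrow> \<exists>u\<in>controls U. x = \<phi> \<tau> s 0 u" using RF_earlier by blast
  obtain k :: nat where "(\<tau> - s1) / T \<le> real k" using real_arch_simple by blast
  then have "\<tau> - real k * T \<le> s1" using T_pos by (simp add: field_simps)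
  then obtain u where u: "u \<in> controls U" "x = \<phi> \<tau> (\<tau> - real k * T) 0 u" using s1 by blast
  obtain v where v: "v \<in> controls U"
      "\<And>t s x. \<phi> (t + of_int (int k) * T) (s + of_int (int k) * T) x v = \<phi> t s x u"
    by (rule traj_shift_controls[OF u(1)]) (rule that)
  have "x = \<phi> (\<tau> + real k * T) \<tau> 0 v" using v(2)[of \<tau> "\<tau> - real k * T" 0] u(2) by simp
  then show "x \<in> (\<Union>k. J \<tau> k)" using v(1) by (auto simp: J_def)
next
  fix x assume "x \<in> (\<Union>k. J \<tau> k)"
  then obtain k u where u: "u \<in> controls U" "x = \<phi> (\<tau> + real k * T) \<tau> 0 u" by (auto simp: J_def)
  have "x \<in> RF (\<tau> + real k * T)"
    unfolding RF_def using u T_pos by (intro CollectI exI[of _ \<tau>] exI[of _ u]) simp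
  then show "x \<in> RF \<tau>" using RF_shift[of \<tau> "int k"] by simp
qed

text \<open>\<open>y\<close> is steered to 0 in \<open>k\<close> periods exactly when its free
  motion cancels some \<open>x\<close> in \<open>J \<tau> k\<close>, that is, when \<open>y\<close>
  is minus the backward image of \<open>x\<close>. This identifies the abstract backward system with
  the controllable sets.\<close>

lemma CF_eq_Union_J: "CF \<tau> = (\<Union>k. {- (bwd_step \<tau> ^^ k) x | x. x \<in> J \<tau> k})"
proof (intro equalityI subsetI)
  fix y assume "y \<in> CF \<tau>"
  then obtain r1 where r1: "\<And>r. r \<ge> r1 \<Longrightarrow> \<exists>u\<in>controls U. \<phi> r \<tau> y u = 0" using CF_later by blast
  obtain k :: nat where "(r1 - \<tau>) / T \<le> real k" using real_arch_simple by blast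
  then have "r1 \<le> \<tau> + real k * T" using T_pos by (simp add: field_simps)
  then obtain u where u: "u \<in> controls U" "\<phi> (\<tau> + real k * T) \<tau> y u = 0" using r1 by blast
  define x where "x = \<phi> (\<tau> + real k * T) \<tau> 0 u"
  have "X (\<tau> + real k * T) \<tau> *v y = - x"
    using traj_decomp[OF controls_Linf[OF u(1)], of "\<tau> + real k * T" \<tau> y] u(2)
    by (simp add: x_def eq_neg_iff_add_eq_0)
  then have "X \<tau> (\<tau> + real k * T) *v (- x) = y" by (metis fund_sol_vec fund_sol_same matrix_vector_mul_lid)
  then have "y = - (bwd_step \<tau> ^^ k) x"
    by (simp add: bwd_step_pow linear_neg[OF matrix_vector_mul_linear])
  moreover have "x \<in> J \<tau> k" using u(1) by (auto simp: J_def x_def)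
  ultimately show "y \<in> (\<Union>k. {- (bwd_step \<tau> ^^ k) x | x. x \<in> J \<tau> k})" by blast
next
  fix y assume "y \<in> (\<Union>k. {- (bwd_step \<tau> ^^ k) x | x. x \<in> J \<tau> k})"
  then obtain k x where x: "y = - (bwd_step \<tau> ^^ k) x" "x \<in> J \<tau> k" by blast
  obtain u where u: "u \<in> controls U" "x = \<phi> (\<tau> + real k * T) \<tau> 0 u" using x(2) by (auto simp: J_def)
  have "X (\<tau> + real k * T) \<tau> *v y = - x"
    by (simp add: x(1) bwd_step_pow linear_neg[OF matrix_vector_mul_linear] fund_sol_vec)
  then have "\<phi> (\<tau> + real k * T) \<tau> y u = 0"
    using traj_decomp[OF controls_Linf[OF u(1)], of "\<tau> + real k * T" \<tau> y] u(2) by simp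
  then show "y \<in> CF \<tau>"
    unfolding CF_def using u(1) T_pos by (intro CollectI exI[of _ "\<tau> + real k * T"]) auto
qed

sublocale fwd: discrete_reach "fwd_step \<tau>" "bwd_step \<tau>" "J \<tau>" "CARD('n)" for \<tau>
  by (rule discrete_reach)

sublocale bwd: discrete_reach "bwd_step \<tau>" "fwd_step \<tau>" "\<lambda>k. {- (bwd_step \<tau> ^^ k) x | x. x \<in> J \<tau> k}" "CARD('n)" for \<tau>
  by (rule fwd.backward_reach)

lemma fwd_R: "fwd.R \<tau> = RF \<tau>"
  by (simp add: fwd.R_def RF_eq_Union_J)

lemma bwd_R: "bwd.R \<tau> = CF \<tau>"
  unfolding bwd.R_def CF_eq_Union_J ..

lemma spectral_subset_fwd_V:
  assumes "\<And>r. P r \<Longrightarrow> r \<ge> 1"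
  shows "spectral_subspace P (X (T + \<tau>) \<tau>) \<subseteq> fwd.V \<tau>"
  unfolding fwd.V_def fwd.stable_functional_def unfolding fwd_step_matrix
  using spectral_subspace_stable_functional[OF _ assms] by blast

lemma spectral_subset_bwd_V:
  assumes "\<And>r. P r \<Longrightarrow> r \<le> 1"
  shows "spectral_subspace P (X (T + \<tau>) \<tau>) \<subseteq> bwd.V \<tau>"
proof
  fix x assume "x \<in> spectral_subspace P (X (T + \<tau>) \<tau>)"
  then have x: "x \<in> spectral_subspace (\<lambda>r. r > 0 \<and> P (inverse r)) (X \<tau> (T + \<tau>))"
    by (intro spectral_subspace_inverse[of "X (T + \<tau>) \<tau>"]) (simp_all add: fund_sol_mult)
  have "r \<ge> 1" if "r > 0 \<and> P (inverse r)" for r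
    using that assms[of "inverse r"] by (simp add: inverse_le_1_iff)
  from spectral_subspace_stable_functional[OF x this]
  show "x \<in> bwd.V \<tau>" 
    unfolding bwd.V_def bwd.stable_functional_def unfolding bwd_step_matrix by blast
qed

end

section \<open>The control set\<close>

context periodic_control_system
begin

section \<open>Reachable and controllable sets over the circle\<close>

abbreviation Ra :: "real \<times> (real^'n) \<Rightarrow> (real \<times> (real^'n)) set" where
  "Ra \<equiv> reach_aut T A B U"

abbreviation Ca :: "real \<times> (real^'n) \<Rightarrow> (real \<times> (real^'n)) set" where
  "Ca \<equiv> contr_aut T A B U"

lemma reach_aut_forward:
  assumes "(s rmod T, y) \<in> Ra p" "s \<le> s'" "u \<in> controls U"
  shows "(s' rmod T, \<phi> s' s y u) \<in> Ra p"
proof -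
  obtain t v where v: "t \<ge> 0" "v \<in> controls U" "s rmod T = (fst p + t) rmod T"
    "y = \<phi> (fst p + t) (fst p) (snd p) v"
    using assms(1) by (auto simp: reach_aut_def traj_aut_def)
  obtain k :: int where k: "s = fst p + t + of_int k * T" using v(3) by (rule rmod_eqE)
  obtain w where w: "w \<in> controls U"
      "\<And>t s x. \<phi> (t + of_int (- k) * T) (s + of_int (- k) * T) x w = \<phi> t s x u"
    by (rule traj_shift_controls[OF assms(3)]) (rule that)
  define h where "h = s' - s"
  have h: "h \<ge> 0" using assms(2) by (simp add: h_def)
  have s: "s + of_int (- k) * T = fst p + t" "s' + of_int (- k) * T = fst p + (t + h)"
    using k by (simp_all add: h_def)
  have "\<phi> (fst p + (t + h)) (fst p + t) y w = \<phi> s' s y u"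
    using w(2)[of s' s y] unfolding s .
  moreover obtain z where z: "z \<in> controls U"
      "\<And>x. \<phi> (fst p + (t + h)) (fst p) x z = \<phi> (fst p + (t + h)) (fst p + t) (\<phi> (fst p + t) (fst p) x v) w"
    by (rule traj_switch_controls[OF v(2) w(1), of "fst p" "fst p + t" "fst p + (t + h)"])
       (use v(1) h that in auto)
  ultimately have "\<phi> s' s y u = \<phi> (fst p + (t + h)) (fst p) (snd p) z" using v(4) by simp
  moreover have "s' rmod T = (fst p + (t + h)) rmod T" using rmod_shift[of s' "- k" T] unfolding s by simp
  ultimately show ?thesis
    unfolding reach_aut_def traj_aut_def using z(1) v(1) h
    by (intro CollectI exI[of _ "t + h"] exI[of _ z]) simp
qed

lemma reach_aut_trans: "q \<in> Ra p \<Longrightarrow> z \<in> Ra q \<Longrightarrow> z \<in> Ra p"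
proof -
  assume q: "q \<in> Ra p" and "z \<in> Ra q"
  then obtain t u where u: "t \<ge> 0" "u \<in> controls U" "z = ((fst q + t) rmod T, \<phi> (fst q + t) (fst q) (snd q) u)"
    by (auto simp: reach_aut_def traj_aut_def)
  have "fst q rmod T = fst q" using q by (auto simp: reach_aut_def traj_aut_def)
  then have "(fst q rmod T, snd q) \<in> Ra p" using q by simp
  from reach_aut_forward[OF this _ u(2), of "fst q + t"] show "z \<in> Ra p" using u(1,3) by simp
qed

lemma contr_aut_iff: "q \<in> Ca p \<longleftrightarrow> q \<in> {0..<T} \<times> UNIV \<and> p \<in> Ra q"
  by (auto simp: contr_aut_def reach_aut_def)

lemma reach_aut_zero_iff: "(t rmod T, x) \<in> Ra (0, 0) \<longleftrightarrow> x \<in> RF t"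
proof -
  have RF: "RF (t rmod T) = RF t" for t
  proof -
    obtain k :: int where k: "t = t rmod T + of_int k * T" by (rule rmodE)
    show ?thesis using RF_shift[of "t rmod T" k] unfolding k[symmetric] ..
  qed
  show ?thesis
  proof
    assume "(t rmod T, x) \<in> Ra (0, 0)"
    then obtain s u where s: "s \<ge> 0" "u \<in> controls U" "t rmod T = s rmod T" "x = \<phi> s 0 0 u"
      by (auto simp: reach_aut_def traj_aut_def)
    then have "x \<in> RF s" by (auto simp: RF_def)
    then show "x \<in> RF t" using RF s(3) by metis
  next
    assume "x \<in> RF t"
    then have "x \<in> reach_per T A B U (t rmod T)"
      using RF T_pos by (simp add: reach_per_eq_RF rmod_nonneg)
    then obtain k :: nat and u where u: "u \<in> controls U" "x = \<phi> (real k * T + t rmod T) 0 0 u"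
      by (auto simp: reach_per_def reach_def)
    moreover have "(real k * T + t rmod T) rmod T = t rmod T"
      using rmod_shift[of "t rmod T" "int k" T] by (simp add: add.commute)
    moreover have "real k * T + t rmod T \<ge> 0" using T_pos by (simp add: rmod_nonneg)
    ultimately show "(t rmod T, x) \<in> Ra (0, 0)"
      unfolding reach_aut_def traj_aut_def
      by (intro CollectI exI[of _ "real k * T + t rmod T"] exI[of _ u]) simp
  qed
qed

lemma contr_aut_zero_iff: "(t rmod T, y) \<in> Ca (0, 0) \<longleftrightarrow> y \<in> CF t"
proof -
  have CF: "CF (t rmod T) = CF t"
  proof -
    obtain k :: int where k: "t = t rmod T + of_int k * T" by (rule rmodE)
    show ?thesis using CF_shift[of "t rmod T" k] unfolding k[symmetric] ..
  qed
  have "(t rmod T, y) \<in> Ca (0, 0) \<longleftrightarrow> y \<in> CF (t rmod T)"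
  proof
    assume "(t rmod T, y) \<in> Ca (0, 0)"
    then obtain h u where h: "h \<ge> 0" "u \<in> controls U" "\<phi> (t rmod T + h) (t rmod T) y u = 0"
      by (auto simp: contr_aut_def traj_aut_def)
    then show "y \<in> CF (t rmod T)" unfolding CF_def by (intro CollectI exI[of _ "t rmod T + h"]) auto
  next
    assume "y \<in> CF (t rmod T)"
    then obtain k :: nat and u where u: "u \<in> controls U" "- real k * T + t rmod T \<le> 0"
      "\<phi> 0 (- real k * T + t rmod T) y u = 0"
      by (auto simp: contr_per_def contr_def simp flip: contr_per_eq_CF)
    obtain v where v: "v \<in> controls U"
        "\<And>t s x. \<phi> (t + of_int (int k) * T) (s + of_int (int k) * T) x v = \<phi> t s x u"
      by (rule traj_shift_controls[OF u(1)]) (rule that)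
    have "\<phi> (real k * T) (t rmod T) y v = 0"
      using v(2)[of 0 "- real k * T + t rmod T" y] u(3) by simp
    moreover have "real k * T rmod T = 0" by simp
    ultimately show "(t rmod T, y) \<in> Ca (0, 0)"
      unfolding contr_aut_def traj_aut_def using v(1) u(2) T_pos
      by (intro CollectI conjI exI[of _ "real k * T - t rmod T"] bexI[of _ v])
         (auto simp: rmod_less rmod_nonneg)
  qed
  then show ?thesis by (simp add: CF)
qed

lemma lift_reach_aut: "lift_set T (Ra (0, 0)) = {(t, x). x \<in> RF t}"
  by (simp add: lift_set_def reach_aut_zero_iff)

lemma lift_contr_aut: "lift_set T (Ca (0, 0)) = {(t, x). x \<in> CF t}"
  by (simp add: lift_set_def contr_aut_zero_iff)

definition D0 :: "(real \<times> (real^'n)) set" where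
  "D0 = (phase_space T closure_of Ra (0, 0)) \<inter> Ca (0, 0)"

lemma rmod_T_in: "t rmod T \<in> {0..<T}"
  using T_pos by (simp add: rmod_less rmod_nonneg)

lemma RF_rmod: "RF (t rmod T) = RF t"
  by (simp add: set_eq_iff flip: reach_aut_zero_iff)

lemma mem_D0: "(t rmod T, x) \<in> D0 \<longleftrightarrow> x \<in> closure (RF t) \<and> x \<in> CF t"
  using rmod_T_in[of t]
  by (simp add: D0_def closure_of_phase_space[OF T_pos] lift_reach_aut closure_RF_graph
      contr_aut_zero_iff RF_rmod del: atLeastLessThan_iff)

lemma D0_subset: "D0 \<subseteq> {0..<T} \<times> UNIV"
  by (auto simp: D0_def contr_aut_iff)

lemma mem_D0': "(\<tau>, x) \<in> D0 \<longleftrightarrow> \<tau> \<in> {0..<T} \<and> x \<in> closure (RF \<tau>) \<and> x \<in> CF \<tau>"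
proof (cases "\<tau> \<in> {0..<T}")
  case True
  then have "\<tau> rmod T = \<tau>" by simp
  with mem_D0[of \<tau> x] True show ?thesis by simp
qed (use D0_subset in auto)

lemma lift_D0: "lift_set T D0 = {(t, x). x \<in> closure (RF t) \<and> x \<in> CF t}"
  by (simp add: lift_set_def mem_D0)

lemma interior_D0:
  assumes "\<tau> \<in> {0..<T}" "x \<in> interior (RF \<tau>)" "x \<in> interior (CF \<tau>)"
  shows "(\<tau>, x) \<in> phase_space T interior_of D0"
proof -
  have "(\<tau>, x) \<in> interior ({(t, x). x \<in> RF t} \<inter> {(t, x). x \<in> CF t})"
    using interior_RF_graph[OF assms(2)] interior_CF_graph[OF assms(3)] by (simp add: interior_Int)
  moreover have "{(t, x). x \<in> RF t} \<inter> {(t, x). x \<in> CF t} \<subseteq> lift_set T D0"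
    using closure_subset by (auto simp: lift_D0)
  then have "interior ({(t, x). x \<in> RF t} \<inter> {(t, x). x \<in> CF t}) \<subseteq> interior (lift_set T D0)"
    by (rule interior_mono)
  ultimately show ?thesis
    using assms(1) by (auto simp: interior_of_phase_space[OF T_pos D0_subset] simp del: interior_Int)
qed

text \<open>A control steering \<open>x\<close> to 0 is continued by rest at 0. Along it the state
  remains controllable to 0, and the closures of the reachable fibers are forward invariant.\<close>

lemma D0_steer:
  assumes "(\<tau>, x) \<in> D0"
  obtains u where "u \<in> controls U" "\<And>t. t \<ge> 0 \<Longrightarrow> traj_aut T A B t (\<tau>, x) u \<in> D0"
proof -
  have x: "x \<in> closure (RF \<tau>)" "x \<in> CF \<tau>" using assms by (auto simp: mem_D0')
  obtain r u where r: "r \<ge> \<tau>" "u \<in> controls U" "\<phi> r \<tau> x u = 0" using x(2) by (auto simp: CF_def)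
  define w where "w = (\<lambda>q. if q < r then u q else 0)"
  have w: "w \<in> controls U" unfolding w_def by (rule controls_if[OF r(2) zero_control])
  have w0: "\<phi> t \<tau> x w = 0" if "t \<ge> r" for t
    using traj_switch[OF controls_Linf[OF r(2)] Linf_on_UNIV_zero r(1) that, of x] r(3) by (simp add: w_def)
  have "traj_aut T A B t (\<tau>, x) w \<in> D0" if t: "t \<ge> 0" for t
  proof -
    have "\<phi> (\<tau> + t) \<tau> x w \<in> closure (RF (\<tau> + t))"
      using t by (intro closure_RF_forward[OF x(1) w]) simp
    moreover have "\<phi> (\<tau> + t) \<tau> x w \<in> CF (\<tau> + t)"
    proof (cases "\<tau> + t \<ge> r")
      case True
      then show ?thesis using w0 zero_CF by simp
    next
      case False
      have "\<phi> r (\<tau> + t) (\<phi> (\<tau> + t) \<tau> x w) w = 0" using w w0[of r] by (simp add: traj_traj controls_Linf)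
      then show ?thesis using False w unfolding CF_def by (intro CollectI exI[of _ r]) auto
    qed
    ultimately show ?thesis by (simp add: traj_aut_def mem_D0)
  qed
  with w show ?thesis using that by blast
qed

lemma closure_of_lift:
  "(t rmod T, x) \<in> phase_space T closure_of S \<longleftrightarrow> (t, x) \<in> closure (lift_set T S)"
proof -
  have sub: "(t + of_int k * T, x) \<in> closure (lift_set T S)" if "(t, x) \<in> closure (lift_set T S)" for t k
  proof -
    have "(+) (of_int k * T, 0) ` lift_set T S \<subseteq> lift_set T S"
      by (auto simp: lift_set_def add.commute)
    then have "(+) (of_int k * T, 0) ` closure (lift_set T S) \<subseteq> closure (lift_set T S)"
      using closure_translation[of "(of_int k * T, 0)" "lift_set T S"] closure_mono by metis
    moreover have "(t + of_int k * T, x) = (of_int k * T, 0) + (t, x)" by simp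
    ultimately show ?thesis using that by (metis imageI subsetD)
  qed
  obtain k :: int where k: "t = t rmod T + of_int k * T" by (rule rmodE)
  then have "t rmod T = t + of_int (- k) * T" by simp
  then have "(t rmod T, x) \<in> closure (lift_set T S) \<longleftrightarrow> (t, x) \<in> closure (lift_set T S)"
    using sub[of "t rmod T" k] sub[of t "- k"] k by metis
  then show ?thesis using rmod_T_in[of t] by (simp add: closure_of_phase_space[OF T_pos] del: atLeastLessThan_iff)
qed

text \<open>A trajectory from the limit point \<open>z\<close> is approximated by trajectories with
  the same control from points \<open>q i\<close> near \<open>z\<close>, all ending at the same
  absolute time.\<close>

lemma closure_reach_trans:
  assumes z: "z \<in> phase_space T closure_of Ra p"
  shows "phase_space T closure_of Ra z \<subseteq> phase_space T closure_of Ra p"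
proof (rule closure_of_minimal[OF _ closedin_closure_of])
  define L where "L = lift_set T (Ra p)"
  obtain \<tau> x where zt: "z = (\<tau>, x)" by (cases z)
  have \<tau>: "\<tau> \<in> {0..<T}" and zL: "(\<tau>, x) \<in> closure L"
    using z by (auto simp: closure_of_phase_space[OF T_pos] zt L_def)
  then obtain q where q: "\<And>i. q i \<in> L" "q \<longlonglongrightarrow> (\<tau>, x)" by (auto simp: closure_sequential)
  have lim: "(\<lambda>i. fst (q i)) \<longlonglongrightarrow> \<tau>" "(\<lambda>i. snd (q i)) \<longlonglongrightarrow> x"
    using tendsto_fst[OF q(2)] tendsto_snd[OF q(2)] by auto
  show "Ra z \<subseteq> phase_space T closure_of Ra p"
  proof
    fix w assume "w \<in> Ra z"
    then obtain t u where u: "t \<ge> 0" "u \<in> controls U" "w = ((\<tau> + t) rmod T, \<phi> (\<tau> + t) \<tau> x u)"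
      by (auto simp: reach_aut_def traj_aut_def zt)
    have "(\<tau> + t, \<phi> (\<tau> + t) \<tau> x u) \<in> closure L"
    \<comment> \<open>The approximating points may lie at times after \<open>\<tau>\<close>. For
      positive \<open>t\<close> they are eventually before \<open>\<tau> + t\<close>; for
      \<open>t = 0\<close> there is nothing to travel.\<close>
    proof (cases "t = 0")
      case True
      then show ?thesis using zL u(2) by (simp add: controls_Linf)
    next
      case False
      have "(\<lambda>i. (\<tau> + t, \<phi> (\<tau> + t) (fst (q i)) (snd (q i)) u)) \<longlonglongrightarrow> (\<tau> + t, \<phi> (\<tau> + t) \<tau> x u)"
        by (intro tendsto_intros traj_tendsto u lim)
      moreover have "\<forall>\<^sub>F i in sequentially. (\<tau> + t, \<phi> (\<tau> + t) (fst (q i)) (snd (q i)) u) \<in> closure L"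
      proof -
        have "\<forall>\<^sub>F i in sequentially. fst (q i) < \<tau> + t"
          using lim(1) u(1) False by (intro order_tendstoD(2)) auto
        then show ?thesis
        proof eventually_elim
          case (elim i)
          have "(fst (q i) rmod T, snd (q i)) \<in> Ra p"
            using q(1)[of i] by (simp add: L_def lift_set_def case_prod_beta)
          from reach_aut_forward[OF this less_imp_le[OF elim] u(2)]
          show ?case by (intro subsetD[OF closure_subset]) (simp add: L_def lift_set_def)
        qed
      qed
      ultimately show ?thesis by (intro Lim_in_closed_set[OF closed_closure]) auto
    qed
    then show "w \<in> phase_space T closure_of Ra p" by (simp add: u(3) closure_of_lift L_def)
  qed
qed

end

section \<open>Existence, recurrence and uniqueness\<close>

context controllable_system
begin

lemma zero_interior: "0 \<in> interior (RF \<tau>)" "0 \<in> interior (CF \<tau>)"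
  using fwd.zero_int_R bwd.zero_int_R by (simp_all add: fwd_R bwd_R)

lemma zero_in_interior_D0: "\<tau> \<in> {0..<T} \<Longrightarrow> (\<tau>, 0) \<in> phase_space T interior_of D0"
  by (rule interior_D0[OF _ zero_interior])

lemma zero_in_D0: "(0, 0) \<in> D0"
  using zero_in_interior_D0[of 0] interior_of_subset[of "phase_space T" D0] T_pos by auto

lemma pre_control_set_D0: "pre_control_set T A B U D0"
  unfolding pre_control_set_def
proof (intro conjI ballI)
  show "D0 \<subseteq> {0..<T} \<times> UNIV" by (rule D0_subset)
  show "\<exists>u\<in>controls U. \<forall>t\<ge>0. traj_aut T A B t p u \<in> D0" if "p \<in> D0" for p
    using D0_steer[of "fst p" "snd p"] that by (metis prod.collapse)
  show "D0 \<subseteq> phase_space T closure_of Ra p" if "p \<in> D0" for p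
  proof -
    have "(0, 0) \<in> Ra p" using that by (auto simp: D0_def contr_aut_iff)
    then have "Ra (0, 0) \<subseteq> Ra p" using reach_aut_trans by blast
    then show ?thesis using closure_of_mono unfolding D0_def by blast
  qed
qed

text \<open>For maximality, a point \<open>q\<close> of a larger candidate is only known to approach
  the origin. Since the set controllable to the origin is a neighborhood of it, \<open>q\<close>
  enters that set and from there reaches the origin exactly.\<close>

lemma control_set_D0: "control_set T A B U D0"
  unfolding control_set_def
proof (intro conjI allI impI)
  show "D0 \<noteq> {}" using zero_in_D0 by blast
  show "pre_control_set T A B U D0" by (rule pre_control_set_D0)
  fix D' assume D': "D0 \<subseteq> D' \<and> pre_control_set T A B U D'"
  have "D' \<subseteq> D0"
  proof
    fix q assume q: "q \<in> D'"
    have "q \<in> phase_space T closure_of Ra (0, 0)"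
      using D' zero_in_D0 q unfolding pre_control_set_def by blast
    moreover have "q \<in> Ca (0, 0)"
    proof -
      have sub: "Ca (0, 0) \<subseteq> {0..<T} \<times> UNIV" by (auto simp: contr_aut_iff)
      have "(0, 0) \<in> interior (lift_set T (Ca (0, 0)))"
        unfolding lift_contr_aut by (rule interior_CF_graph[OF zero_interior(2)])
      then have "(0, 0) \<in> phase_space T interior_of Ca (0, 0)"
        using T_pos by (simp add: interior_of_phase_space[OF T_pos sub])
      then obtain V where V: "openin (phase_space T) V" "(0, 0) \<in> V" "V \<subseteq> Ca (0, 0)"
        by (auto simp: interior_of_def)
      have "(0, 0) \<in> phase_space T closure_of Ra q"
        using D' zero_in_D0 q unfolding pre_control_set_def by blast
      then obtain y where "y \<in> Ra q" "y \<in> V" using V unfolding in_closure_of by blast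
      then have "(0, 0) \<in> Ra q" using V(3) reach_aut_trans contr_aut_iff by blast
      moreover have "q \<in> {0..<T} \<times> UNIV" using D' q unfolding pre_control_set_def by blast
      ultimately show ?thesis by (simp add: contr_aut_iff)
    qed
    ultimately show "q \<in> D0" by (simp add: D0_def)
  qed
  then show "D' = D0" using D' by blast
qed

text \<open>Property (i) moves the point \<open>n\<close> periods ahead and property (ii) brings it back approximately. The
  small deviation of the return time from a multiple of \<open>T\<close> is removed by continuing with zero control
  or by going back along the trajectory.\<close>

lemma control_set_recurrent:
  assumes D: "pre_control_set T A B U D" and x: "(\<tau>, x) \<in> D" and e: "e > 0"
  obtains k r where "k \<ge> n" "r \<in> J \<tau> k" "norm (x - ((fwd_step \<tau> ^^ k) x + r)) \<le> e"
proof -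
  have \<tau>: "\<tau> \<in> {0..<T}" using D x unfolding pre_control_set_def by blast
  then have \<tau>T: "\<tau> rmod T = \<tau>" by simp
  obtain u0 where u0: "u0 \<in> controls U" "\<And>t. t \<ge> 0 \<Longrightarrow> traj_aut T A B t (\<tau>, x) u0 \<in> D"
    using D x unfolding pre_control_set_def by meson
  define x' where "x' = \<phi> (\<tau> + real n * T) \<tau> x u0"
  have "(\<tau> + real n * T) rmod T = \<tau>" using rmod_shift[of \<tau> "int n" T] \<tau>T by simp
  then have "(\<tau>, x') \<in> D" using u0(2)[of "real n * T"] T_pos by (simp add: traj_aut_def x'_def)
  then have "(\<tau>, x) \<in> phase_space T closure_of Ra (\<tau>, x')"
    using D x unfolding pre_control_set_def by blast
  then have "(\<tau>, x) \<in> closure (lift_set T (Ra (\<tau>, x')))" by (simp add: closure_of_phase_space[OF T_pos])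
  then obtain q where q: "\<And>i. q i \<in> lift_set T (Ra (\<tau>, x'))" "q \<longlonglongrightarrow> (\<tau>, x)"
    by (auto simp: closure_sequential)
  have lim: "(\<lambda>i. fst (q i)) \<longlonglongrightarrow> \<tau>" "(\<lambda>i. snd (q i)) \<longlonglongrightarrow> x"
    using tendsto_fst[OF q(2)] tendsto_snd[OF q(2)] by auto
  have adjust: "\<exists>u j w. u \<in> controls U \<and> w \<in> controls U \<and> \<phi> \<tau> s y u = \<phi> (\<tau> + real j * T) \<tau> x' w"
    if sy: "(s, y) \<in> lift_set T (Ra (\<tau>, x'))" "\<bar>\<tau> - s\<bar> < T" for s y
  proof -
    obtain t v where t: "t \<ge> 0" "v \<in> controls U" "s rmod T = (\<tau> + t) rmod T" "y = \<phi> (\<tau> + t) \<tau> x' v"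
      using sy(1) by (auto simp: lift_set_def reach_aut_def traj_aut_def)
    obtain k :: int where k: "s = \<tau> + t + of_int k * T" using t(3) by (rule rmod_eqE)
    \<comment> \<open>The bound on \<open>\<tau> - s\<close> excludes \<open>k > 0\<close>, so that
      the number \<open>j\<close> of return periods is a natural number.\<close>
    have "of_int k * T < 1 * T" using sy(2) k t(1) unfolding abs_less_iff by linarith
    then have "real_of_int k < 1" using T_pos by (simp only: mult_less_cancel_right_pos)
    then have "k \<le> 0" by linarith
    then obtain j :: nat where j: "- k = int j" using nonneg_int_cases[of "- k"] by auto
    then have jk: "real_of_int k = - real j" by linarith
    have s: "s = \<tau> + t - real j * T" using k jk by simp
    obtain w where w: "w \<in> controls U" "\<exists>v'. v' \<in> controls U \<and> \<phi> (\<tau> + real j * T) (\<tau> + t) y w = \<phi> (\<tau> + real j * T) \<tau> x' v'"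
    proof (cases "\<tau> + t \<le> \<tau> + real j * T")
      case True
      obtain v' where "v' \<in> controls U"
          "\<And>x. \<phi> (\<tau> + real j * T) \<tau> x v' = \<phi> (\<tau> + real j * T) (\<tau> + t) (\<phi> (\<tau> + t) \<tau> x v) (\<lambda>_. 0)"
        by (rule traj_switch_controls[OF t(2) zero_control _ True, of \<tau>]) (use t(1) that in auto)
      then show ?thesis using that[of "\<lambda>_. 0"] t(4) by (metis zero_control)
    next
      case False
      then show ?thesis using that[OF t(2)] t(2,4) by (auto simp: traj_traj controls_Linf)
    qed
    obtain u where u: "u \<in> controls U"
        "\<And>t s x. \<phi> (t + of_int (- int j) * T) (s + of_int (- int j) * T) x u = \<phi> t s x w"
      by (rule traj_shift_controls[OF w(1)]) (rule that)
    have "\<phi> \<tau> s y u = \<phi> (\<tau> + real j * T) (\<tau> + t) y w"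
      using u(2)[of "\<tau> + real j * T" "\<tau> + t" y] by (simp add: s)
    then show ?thesis using u(1) w(2) by metis
  qed
  \<comment> \<open>The proximity condition stands as a premise so that a control can be chosen for
    every index; zero control serves where the condition fails.\<close>
  have "\<exists>u. u \<in> controls U \<and> (\<bar>\<tau> - fst (q i)\<bar> < T \<longrightarrow>
      (\<exists>j w. w \<in> controls U \<and> \<phi> \<tau> (fst (q i)) (snd (q i)) u = \<phi> (\<tau> + real j * T) \<tau> x' w))" for i
    using adjust[of "fst (q i)" "snd (q i)"] q(1)[of i] zero_control by (metis prod.collapse)
  then obtain u where u: "\<And>i. u i \<in> controls U" "\<And>i. \<bar>\<tau> - fst (q i)\<bar> < T \<Longrightarrow>
      (\<exists>j w. w \<in> controls U \<and> \<phi> \<tau> (fst (q i)) (snd (q i)) (u i) = \<phi> (\<tau> + real j * T) \<tau> x' w)"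
    by metis
  have "(\<lambda>i. (\<phi> \<tau> (fst (q i)) (snd (q i)) (u i) - snd (q i)) + snd (q i)) \<longlonglongrightarrow> 0 + x"
    by (intro tendsto_add traj_tendsto_initial[OF u(1) lim] lim)
  then have "(\<lambda>i. \<phi> \<tau> (fst (q i)) (snd (q i)) (u i)) \<longlonglongrightarrow> x" by simp
  from tendstoD[OF this e] have "\<forall>\<^sub>F i in sequentially. dist (\<phi> \<tau> (fst (q i)) (snd (q i)) (u i)) x < e" .
  moreover have "\<forall>\<^sub>F i in sequentially. dist (fst (q i)) \<tau> < T" using tendstoD[OF lim(1) T_pos] .
  ultimately have "\<forall>\<^sub>F i in sequentially. dist (\<phi> \<tau> (fst (q i)) (snd (q i)) (u i)) x < e \<and> dist (fst (q i)) \<tau> < T"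
    by (rule eventually_conj)
  then obtain i where i: "dist (\<phi> \<tau> (fst (q i)) (snd (q i)) (u i)) x < e" "dist (fst (q i)) \<tau> < T"
    by (auto dest: eventually_happens)
  then obtain j w where w: "w \<in> controls U" "\<phi> \<tau> (fst (q i)) (snd (q i)) (u i) = \<phi> (\<tau> + real j * T) \<tau> x' w"
    using u(2)[of i] by (auto simp: dist_real_def abs_minus_commute)
  \<comment> \<open>\<open>n\<close> periods along \<open>u0\<close> followed by \<open>j\<close>
    return periods, which makes \<open>k\<close> as large as prescribed.\<close>
  define k where "k = j + n"
  obtain w' where w': "w' \<in> controls U"
      "\<And>t s x. \<phi> (t + of_int (int n) * T) (s + of_int (int n) * T) x w' = \<phi> t s x w"
    by (rule traj_shift_controls[OF w(1)]) (rule that)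
  obtain v where v: "v \<in> controls U"
      "\<And>x. \<phi> (\<tau> + real k * T) \<tau> x v = \<phi> (\<tau> + real k * T) (\<tau> + real n * T) (\<phi> (\<tau> + real n * T) \<tau> x u0) w'"
    by (rule traj_switch_controls[OF u0(1) w'(1), of \<tau> "\<tau> + real n * T" "\<tau> + real k * T"])
       (use T_pos that in \<open>auto simp: k_def distrib_right\<close>)
  have "\<phi> (\<tau> + real k * T) \<tau> x v = \<phi> (\<tau> + real j * T) \<tau> x' w"
    using v(2)[of x] w'(2)[of "\<tau> + real j * T" \<tau> x'] by (simp add: x'_def k_def algebra_simps)
  then have "norm (x - \<phi> (\<tau> + real k * T) \<tau> x v) \<le> e"
    using i(1) w(2) by (simp add: dist_norm norm_minus_commute)
  moreover have "\<phi> (\<tau> + real k * T) \<tau> x v = (fwd_step \<tau> ^^ k) x + \<phi> (\<tau> + real k * T) \<tau> 0 v"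
    using traj_decomp[OF controls_Linf[OF v(1)], of "\<tau> + real k * T" \<tau> x] by (simp add: fwd_step_pow)
  moreover have "\<phi> (\<tau> + real k * T) \<tau> 0 v \<in> J \<tau> k" using v(1) by (auto simp: J_def)
  moreover have "k \<ge> n" by (simp add: k_def)
  ultimately show ?thesis using that by metis
qed

lemma control_set_fiber:
  assumes D: "pre_control_set T A B U D" and x: "(\<tau>, x) \<in> D"
  shows "x \<in> closure (RF \<tau>)" "x \<in> closure (CF \<tau>)"
proof -
  have "x \<in> closure (fwd.R \<tau>)"
  proof (rule fwd.closure_R_recurrent)
    fix n and e :: real assume "e > 0"
    then obtain k r where "k \<ge> n" "r \<in> J \<tau> k" "norm (x - ((fwd_step \<tau> ^^ k) x + r)) \<le> e"
      by (rule control_set_recurrent[OF D x])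
    then show "\<exists>k\<ge>n. \<exists>w. norm (w - x) \<le> e \<and> (\<exists>r\<in>J \<tau> k. norm (x - ((fwd_step \<tau> ^^ k) w + r)) \<le> e)"
      using \<open>e > 0\<close> by (intro exI[of _ k] conjI exI[of _ x]) auto
  qed
  then show "x \<in> closure (RF \<tau>)" by (simp add: fwd_R)
  have "x \<in> closure (bwd.R \<tau>)"
  proof (rule bwd.closure_R_recurrent)
    fix n and e :: real assume "e > 0"
    then obtain k r where k: "k \<ge> n" "r \<in> J \<tau> k" "norm (x - ((fwd_step \<tau> ^^ k) x + r)) \<le> e"
      by (rule control_set_recurrent[OF D x])
    \<comment> \<open>Backward in time the roles are exchanged: the approximate return
      \<open>w\<close> is the initial point and \<open>x\<close> is reached exactly. This is why
      \<open>closure_R_recurrent\<close> admits a start that is only near \<open>x\<close>.\<close>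
    define w where "w = (fwd_step \<tau> ^^ k) x + r"
    have "(bwd_step \<tau> ^^ k) w + - (bwd_step \<tau> ^^ k) r = x"
      by (simp add: w_def linear_add[OF fwd.lin_pow(2)])
    then have "norm (x - ((bwd_step \<tau> ^^ k) w + - (bwd_step \<tau> ^^ k) r)) \<le> e" using \<open>e > 0\<close> by simp
    then show "\<exists>k\<ge>n. \<exists>w. norm (w - x) \<le> e \<and>
        (\<exists>r\<in>{- (bwd_step \<tau> ^^ k) x |x. x \<in> J \<tau> k}. norm (x - ((bwd_step \<tau> ^^ k) w + r)) \<le> e)"
      using k by (intro exI[of _ k] conjI exI[of _ w]) (auto simp: w_def norm_minus_commute)
  qed
  then show "x \<in> closure (CF \<tau>)" by (simp add: bwd_R)
qed

text \<open>An interior point of \<open>D\<close> is interior to the closure of the convex fiber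
  \<open>CF \<tau>\<close>, hence lies in the fiber itself and therefore in \<open>D0\<close>. Two
  sets with properties (i) and (ii) that share a point have a union with the same properties, so
  maximality of both gives equality.\<close>

lemma control_set_unique:
  assumes D: "control_set T A B U D" and int: "phase_space T interior_of D \<noteq> {}"
  shows "D = D0"
proof -
  have pre: "pre_control_set T A B U D" using D by (simp add: control_set_def)
  then have sub: "D \<subseteq> {0..<T} \<times> UNIV" by (simp add: pre_control_set_def)
  obtain \<tau> x where \<tau>x: "(\<tau>, x) \<in> phase_space T interior_of D" using int by auto
  then have \<tau>: "\<tau> \<in> {0..<T}" and "(\<tau>, x) \<in> interior (lift_set T D)"
    by (auto simp: interior_of_phase_space[OF T_pos sub])
  moreover have "open ((\<lambda>y. (\<tau>, y)) -` interior (lift_set T D))"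
    by (intro open_vimage open_interior continuous_intros)
  moreover have "(\<lambda>y. (\<tau>, y)) -` interior (lift_set T D) \<subseteq> closure (CF \<tau>)"
  proof
    fix y assume "y \<in> (\<lambda>y. (\<tau>, y)) -` interior (lift_set T D)"
    then have "(\<tau> rmod T, y) \<in> D" using interior_subset by (auto simp: lift_set_def)
    moreover have "\<tau> rmod T = \<tau>" using \<tau> by simp
    ultimately show "y \<in> closure (CF \<tau>)" using control_set_fiber(2)[OF pre] by simp
  qed
  ultimately have "x \<in> interior (closure (CF \<tau>))" using interiorI by blast
  then have "x \<in> CF \<tau>" using convex_interior_closure[OF convex_CF] interior_subset by blast
  moreover have xD: "(\<tau>, x) \<in> D"
    using \<tau>x interior_of_subset[of "phase_space T" D] by blast
  ultimately have xD0: "(\<tau>, x) \<in> D0" using control_set_fiber(1)[OF pre] \<tau> by (simp add: mem_D0')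
  have reach: "D \<subseteq> phase_space T closure_of Ra p" if "p \<in> D" for p
    using pre that by (simp add: pre_control_set_def)
  have reach0: "D0 \<subseteq> phase_space T closure_of Ra p" if "p \<in> D0" for p
    using pre_control_set_D0 that by (simp add: pre_control_set_def)
  have "pre_control_set T A B U (D \<union> D0)"
    unfolding pre_control_set_def
  proof (intro conjI ballI)
    show "D \<union> D0 \<subseteq> {0..<T} \<times> UNIV" using sub D0_subset by blast
    fix p assume p: "p \<in> D \<union> D0"
    have stay: "\<exists>u\<in>controls U. \<forall>t\<ge>0. traj_aut T A B t p u \<in> E" if "pre_control_set T A B U E" "p \<in> E" for E
      using that by (simp add: pre_control_set_def)
    show "\<exists>u\<in>controls U. \<forall>t\<ge>0. traj_aut T A B t p u \<in> D \<union> D0"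
      using p stay[OF pre] stay[OF pre_control_set_D0] by (metis UnCI UnE)
    have "(\<tau>, x) \<in> phase_space T closure_of Ra p" using p reach reach0 xD xD0 by blast
    then show "D \<union> D0 \<subseteq> phase_space T closure_of Ra p"
      using closure_reach_trans reach[OF xD] reach0[OF xD0] by blast
  qed
  then have "D \<union> D0 = D" "D \<union> D0 = D0"
    using D control_set_D0 unfolding control_set_def by blast+
  then show ?thesis by simp
qed

end

section \<open>Spectral bounds for the control set\<close>

lemma inner_transpose_pow:
  fixes M :: "real^'n^'n"
  shows "p \<bullet> (((*v) M) ^^ k) y = (((*v) (transpose M)) ^^ k) p \<bullet> y"
proof (induction k arbitrary: y)
  case (Suc k)
  have "p \<bullet> (((*v) M) ^^ Suc k) y = (((*v) (transpose M)) ^^ k) p \<bullet> (M *v y)"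
    using Suc[of "M *v y"] by (simp add: funpow_swap1 del: transpose_matrix_vector)
  moreover have "(transpose M *v q) \<bullet> y = q \<bullet> (M *v y)" for q by (simp add: dot_lmul_matrix)
  ultimately show ?case by (simp del: transpose_matrix_vector)
qed simp

lemma summable_functional:
  fixes M :: "real^'n^'n"
  assumes "p \<in> spectral_subspace (\<lambda>r. r < 1) (transpose M)"
  shows "summable (\<lambda>k. \<bar>p \<bullet> (((*v) M) ^^ k) y\<bar>)"
proof (rule summable_comparison_test'[where N = 0])
  show "summable (\<lambda>k. norm ((((*v) (transpose M)) ^^ k) p) * norm y)"
    by (intro summable_mult2 spectral_subspace_summable assms)
  show "norm \<bar>p \<bullet> (((*v) M) ^^ k) y\<bar> \<le> norm ((((*v) (transpose M)) ^^ k) p) * norm y" for k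
    using Cauchy_Schwarz_ineq2 by (simp add: inner_transpose_pow)
qed

context controllable_system
begin

lemma Y_mat_vec: "Y_mat T A \<tau> *v x = (fwd_step \<tau> ^^ CARD('n)) x"
  by (simp add: Y_mat_def fwd_step_pow add.commute)

lemma Y_mat_inv_vec: "matrix_inv (Y_mat T A \<tau>) *v x = (bwd_step \<tau> ^^ CARD('n)) x"
  by (simp add: Y_mat_def matrix_inv_fund_sol bwd_step_pow add.commute)

lemma E_subset_V:
  "E_zero T A \<tau> \<subseteq> fwd.V \<tau>" "E_plus T A \<tau> \<subseteq> fwd.V \<tau>"
  "E_zero T A \<tau> \<subseteq> bwd.V \<tau>" "E_minus T A \<tau> \<subseteq> bwd.V \<tau>"
  unfolding E_zero_def E_plus_def E_minus_def
  by (intro spectral_subset_fwd_V spectral_subset_bwd_V; simp)+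

lemma spectral_subspace_fund_sol:
  assumes "x \<in> spectral_subspace P (X (T + \<tau>) \<tau>)"
  shows "(fwd_step \<tau> ^^ k) x \<in> spectral_subspace P (X (T + \<tau>) \<tau>)"
    and "(bwd_step \<tau> ^^ k) x \<in> spectral_subspace P (X (T + \<tau>) \<tau>)"
proof -
  have step: "X (T + \<tau>) \<tau> *v y \<in> spectral_subspace P (X (T + \<tau>) \<tau>)"
    "X \<tau> (T + \<tau>) *v y \<in> spectral_subspace P (X (T + \<tau>) \<tau>)"
    if "y \<in> spectral_subspace P (X (T + \<tau>) \<tau>)" for y
    using that by (auto intro!: spectral_subspace_commute simp: fund_sol_mult)
  show "(fwd_step \<tau> ^^ k) x \<in> spectral_subspace P (X (T + \<tau>) \<tau>)"
    unfolding fwd_step_matrix by (induction k) (use assms step in simp_all)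
  show "(bwd_step \<tau> ^^ k) x \<in> spectral_subspace P (X (T + \<tau>) \<tau>)"
    unfolding bwd_step_matrix by (induction k) (use assms step in simp_all)
qed

text \<open>The \<open>d\<close> forward steps put the stable summand into the interior of the
  reachable fiber, and the other two summands belong to the subspace that may be added there. The
  backward system gives the same with the stable and unstable summands exchanged.\<close>

lemma inner_subset:
  "fiber_image (Y_mat T A) (K_minus T A B U) \<oplus>\<^sub>f center_bundle T A
     \<oplus>\<^sub>f fiber_image (\<lambda>\<tau>. matrix_inv (Y_mat T A \<tau>)) (K_plus T A B U)
   \<subseteq> phase_space T interior_of D0"
proof
  fix p assume "p \<in> fiber_image (Y_mat T A) (K_minus T A B U) \<oplus>\<^sub>f center_bundle T A
     \<oplus>\<^sub>f fiber_image (\<lambda>\<tau>. matrix_inv (Y_mat T A \<tau>)) (K_plus T A B U)"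
  then obtain \<tau> x y z where p: "p = (\<tau>, Y_mat T A \<tau> *v x + y + matrix_inv (Y_mat T A \<tau>) *v z)"
    and \<tau>: "\<tau> \<in> {0..<T}"
    and x: "x \<in> interior (reach_per T A B U \<tau>)" "x \<in> E_minus T A \<tau>"
    and y: "y \<in> E_zero T A \<tau>"
    and z: "z \<in> interior (contr_per T A B U \<tau>)" "z \<in> E_plus T A \<tau>"
    unfolding fiber_sum_def fiber_image_def K_minus_def K_plus_def center_bundle_def by auto
  let ?x = "(fwd_step \<tau> ^^ CARD('n)) x" and ?z = "(bwd_step \<tau> ^^ CARD('n)) z"
  have xz: "x \<in> fwd.R \<tau>" "z \<in> bwd.R \<tau>"
    using x(1) z(1) \<tau> interior_subset by (auto simp: fwd_R bwd_R reach_per_eq_RF contr_per_eq_CF)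
  have "y + ?z \<in> fwd.V \<tau>" "y + ?x \<in> bwd.V \<tau>"
    by (intro subspace_add[OF fwd.subspace_V] subspace_add[OF bwd.subspace_V] fwd.V_N bwd.V_N
        subsetD[OF E_subset_V(1)] subsetD[OF E_subset_V(2)] subsetD[OF E_subset_V(3)]
        subsetD[OF E_subset_V(4)] x(2) y z(2))+
  then have "?x + (y + ?z) \<in> interior (fwd.R \<tau>)" "?z + (y + ?x) \<in> interior (bwd.R \<tau>)"
    using fwd.interior_R_add_V[OF fwd.R_pow_d[OF xz(1)]] bwd.interior_R_add_V[OF bwd.R_pow_d[OF xz(2)]]
    by blast+
  then show "p \<in> phase_space T interior_of D0"
    unfolding p Y_mat_vec Y_mat_inv_vec
    by (intro interior_D0[OF \<tau>]) (simp_all add: fwd_R bwd_R add_ac)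
qed

text \<open>Scaling by \<open>s < 1\<close> moves a point of the closure of the convex fiber into
  its interior and keeps it in the stable subspace; then \<open>s\<close> tends to 1.\<close>

lemma closure_K_minus:
  assumes \<tau>: "\<tau> \<in> {0..<T}" and a: "a \<in> closure (RF \<tau>)" "a \<in> E_minus T A \<tau>"
  shows "(\<tau>, a) \<in> phase_space T closure_of K_minus T A B U"
proof -
  let ?S = "interior (RF \<tau>) \<inter> E_minus T A \<tau>"
  have "a \<in> closure ?S"
  proof (rule Lim_in_closed_set[OF closed_closure])
    have "((\<lambda>s. s *\<^sub>R a) \<longlongrightarrow> 1 *\<^sub>R a) (at_left 1)" by (intro tendsto_intros)
    then show "((\<lambda>s. s *\<^sub>R a) \<longlongrightarrow> a) (at_left 1)" by simp
    show "at_left (1::real) \<noteq> bot" by simp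
    show "\<forall>\<^sub>F s in at_left 1. s *\<^sub>R a \<in> closure ?S"
    proof (rule eventually_mono)
      show "\<forall>\<^sub>F s in at_left 1. s \<in> {0<..<1::real}" by (intro eventually_at_left_real) simp
      fix s :: real assume "s \<in> {0<..<1}"
      then have s: "0 \<le> s" "s < 1" by auto
      have "s *\<^sub>R a \<in> interior (RF \<tau>)"
        unfolding fwd_R[symmetric] by (rule fwd.closure_R_scale[OF _ s]) (simp add: fwd_R a(1))
      moreover have "s *\<^sub>R a \<in> E_minus T A \<tau>"
        using a(2) unfolding E_minus_def by (rule subspace_scale[OF subspace_spectral_subspace])
      ultimately have "s *\<^sub>R a \<in> ?S" by blast
      then show "s *\<^sub>R a \<in> closure ?S" by (rule subsetD[OF closure_subset])
    qed
  qed
  then have "(\<tau>, a) \<in> closure ({\<tau>} \<times> ?S)" by (simp add: closure_Times)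
  moreover have "{\<tau>} \<times> ?S \<subseteq> lift_set T (K_minus T A B U)"
    using \<tau> by (auto simp: lift_set_def K_minus_def reach_per_eq_RF)
  ultimately have "(\<tau>, a) \<in> closure (lift_set T (K_minus T A B U))" using closure_mono by blast
  then show ?thesis using \<tau> by (simp add: closure_of_phase_space[OF T_pos])
qed

lemma outer_subset:
  "D0 \<subseteq> fiber_image (\<lambda>\<tau>. matrix_inv (Y_mat T A \<tau>)) (phase_space T closure_of K_minus T A B U)
     \<oplus>\<^sub>f center_bundle T A \<oplus>\<^sub>f fiber_image (Y_mat T A) (K_plus T A B U)"
proof
  fix p assume "p \<in> D0"
  then obtain \<tau> x where p: "p = (\<tau>, x)" and \<tau>: "\<tau> \<in> {0..<T}"
    and x: "x \<in> closure (RF \<tau>)" "x \<in> CF \<tau>" by (cases p) (auto simp: mem_D0')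
  obtain a b c where "a \<in> spectral_subspace (\<lambda>r. r < 1) (X (T + \<tau>) \<tau>)"
    "b \<in> spectral_subspace (\<lambda>r. r = 1) (X (T + \<tau>) \<tau>)"
    "c \<in> spectral_subspace (\<lambda>r. r > 1) (X (T + \<tau>) \<tau>)" and xabc: "x = a + b + c"
    by (rule spectral_decomposition)
  then have abc: "a \<in> E_minus T A \<tau>" "b \<in> E_zero T A \<tau>" "c \<in> E_plus T A \<tau>"
    by (simp_all add: E_minus_def E_zero_def E_plus_def)
  let ?d = "CARD('n)"
  define a' where "a' = (fwd_step \<tau> ^^ ?d) a"
  define c' where "c' = (bwd_step \<tau> ^^ ?d) c"
  \<comment> \<open>Removing the center and unstable parts does not leave the closure of the
    reachable fiber.\<close>
  have "x + - (b + c) \<in> closure (fwd.R \<tau>)"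
    using x(1) abc E_subset_V(1,2)
    by (intro fwd.closure_R_add_V subspace_neg[OF fwd.subspace_V] subspace_add[OF fwd.subspace_V])
       (auto simp: fwd_R)
  then have "a \<in> closure (fwd.R \<tau>)" by (simp add: xabc)
  then have "a' \<in> closure (RF \<tau>)" unfolding a'_def fwd_R[symmetric] by (rule fwd.closure_R_pow)
  moreover have "a' \<in> E_minus T A \<tau>"
    using abc(1) spectral_subspace_fund_sol(1) by (simp add: a'_def E_minus_def)
  ultimately have "(\<tau>, a') \<in> phase_space T closure_of K_minus T A B U"
    by (intro closure_K_minus \<tau>)
  moreover have a: "a = matrix_inv (Y_mat T A \<tau>) *v a'" by (simp add: Y_mat_inv_vec a'_def)
  ultimately have 1: "(\<tau>, a) \<in> fiber_image (\<lambda>\<tau>. matrix_inv (Y_mat T A \<tau>)) (phase_space T closure_of K_minus T A B U)"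
    unfolding fiber_image_def by blast
  \<comment> \<open>\<open>x\<close> lies in the controllable fiber itself and not merely in its
    closure, so \<open>d\<close> backward steps give an interior point; this yields
    \<open>K_plus\<close> without a closure.\<close>
  have "(bwd_step \<tau> ^^ ?d) x + (bwd_step \<tau> ^^ ?d) (- (a + b)) \<in> interior (bwd.R \<tau>)"
    using x(2) abc E_subset_V(3,4) bwd.R_pow_d
    by (intro bwd.interior_R_add_V bwd.V_M subspace_neg[OF bwd.subspace_V] subspace_add[OF bwd.subspace_V])
       (auto simp: bwd_R)
  moreover have "(bwd_step \<tau> ^^ ?d) x + (bwd_step \<tau> ^^ ?d) (- (a + b)) = c'"
    unfolding linear_add[OF fwd.lin_pow(2), symmetric] by (simp add: xabc c'_def)
  ultimately have "c' \<in> interior (CF \<tau>)" by (simp add: bwd_R)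
  moreover have "c' \<in> E_plus T A \<tau>"
    using abc(3) spectral_subspace_fund_sol(2) by (simp add: c'_def E_plus_def)
  ultimately have "(\<tau>, c') \<in> K_plus T A B U" using \<tau> by (simp add: K_plus_def contr_per_eq_CF)
  moreover have "c = Y_mat T A \<tau> *v c'" by (simp add: Y_mat_vec c'_def)
  ultimately have 2: "(\<tau>, c) \<in> fiber_image (Y_mat T A) (K_plus T A B U)"
    unfolding fiber_image_def by blast
  have 3: "(\<tau>, b) \<in> center_bundle T A" using \<tau> abc(2) by (simp add: center_bundle_def)
  show "p \<in> fiber_image (\<lambda>\<tau>. matrix_inv (Y_mat T A \<tau>)) (phase_space T closure_of K_minus T A B U)
     \<oplus>\<^sub>f center_bundle T A \<oplus>\<^sub>f fiber_image (Y_mat T A) (K_plus T A B U)"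
    using 1 2 3 unfolding p xabc fiber_sum_def by blast
qed

lemma bounded_J1: "bounded (J \<tau> 1)"
proof -
  obtain c where c0: "c \<ge> 0" and c: "\<And>t s x u. u \<in> controls U \<Longrightarrow> \<bar>t - s\<bar> \<le> T \<Longrightarrow> norm (\<phi> t s x u) \<le> c * (norm x + 1)"
    by (rule traj_bounded[of T]) (rule that)
  have "norm x \<le> c" if "x \<in> J \<tau> 1" for x
  proof -
    obtain u where u: "u \<in> controls U" "x = \<phi> (\<tau> + T) \<tau> 0 u" using \<open>x \<in> J \<tau> 1\<close> by (auto simp: J_def)
    then show ?thesis using c[OF u(1), of "\<tau> + T" \<tau> 0] T_pos by simp
  qed
  then show ?thesis by (auto simp: bounded_iff)
qed

lemma bounded_fiber:
  assumes "E_zero T A \<tau> = {0}"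
  shows "bounded (closure (RF \<tau>) \<inter> CF \<tau>)"
proof -
  let ?M = "X (T + \<tau>) \<tau>" and ?N = "X \<tau> (T + \<tau>)"
  have inv: "transpose ?M ** transpose ?N = mat 1" "transpose ?N ** transpose ?M = mat 1"
    by (simp_all add: fund_sol_mult flip: matrix_transpose_mul)
  \<comment> \<open>Functionals are decomposed instead of points, since each part is bounded on a
    different one of the two fibers. Applied to the standard basis, the bounds control the
    norm.\<close>
  have bdd: "\<exists>h. \<forall>x\<in>closure (RF \<tau>) \<inter> CF \<tau>. \<bar>p \<bullet> x\<bar> \<le> h" for p
  proof -
    obtain a b c where abc: "a \<in> spectral_subspace (\<lambda>r. r < 1) (transpose ?M)"
      "b \<in> spectral_subspace (\<lambda>r. r = 1) (transpose ?M)"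
      "c \<in> spectral_subspace (\<lambda>r. r > 1) (transpose ?M)" and p: "p = a + b + c"
      by (rule spectral_decomposition)
    have "spectral_subspace (\<lambda>r. r = 1) (transpose ?M) = {0}"
      using assms by (intro spectral_subspace_transpose_trivial) (simp add: E_zero_def)
    then have b: "b = 0" using abc(2) by blast
    \<comment> \<open>An unstable functional of the forward step is a stable one of the backward
      step, so the same boundedness lemma applies to it.\<close>
    have "c \<in> spectral_subspace (\<lambda>r. r > 0 \<and> inverse r > 1) (transpose ?N)"
      using spectral_subspace_inverse[OF inv abc(3)] .
    moreover have "spectral_subspace (\<lambda>r. r > 0 \<and> inverse r > 1) (transpose ?N)
        \<subseteq> spectral_subspace (\<lambda>r. r < 1) (transpose ?N)"
      by (intro spectral_subspace_mono) (simp add: one_less_inverse_iff)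
    ultimately have c: "c \<in> spectral_subspace (\<lambda>r. r < 1) (transpose ?N)" by blast
    have "summable (\<lambda>k. \<bar>a \<bullet> (fwd_step \<tau> ^^ k) y\<bar>)" "summable (\<lambda>k. \<bar>c \<bullet> (bwd_step \<tau> ^^ k) y\<bar>)" for y
      unfolding fwd_step_matrix bwd_step_matrix
      by (rule summable_functional[OF abc(1)] summable_functional[OF c])+
    note summable = this
    have "bounded ((\<lambda>x. - (bwd_step \<tau> ^^ 1) x) ` J \<tau> 1)"
      by (intro bounded_linear_image bounded_J1 linear_conv_bounded_linear[THEN iffD1]
          linear_compose_neg fwd.lin_pow(2))
    moreover have "(\<lambda>x. - (bwd_step \<tau> ^^ 1) x) ` J \<tau> 1 = {- (bwd_step \<tau> ^^ 1) x |x. x \<in> J \<tau> 1}" by blast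
    ultimately have bounded_I: "bounded {- (bwd_step \<tau> ^^ 1) x |x. x \<in> J \<tau> 1}" by (simp only:)
    obtain h1 where h1: "\<And>x. x \<in> closure (fwd.R \<tau>) \<Longrightarrow> \<bar>a \<bullet> x\<bar> \<le> h1"
      by (rule fwd.bounded_functional_on_R[OF bounded_J1 summable(1)]) (rule that)
    obtain h2 where h2: "\<And>x. x \<in> closure (bwd.R \<tau>) \<Longrightarrow> \<bar>c \<bullet> x\<bar> \<le> h2"
      by (rule bwd.bounded_functional_on_R[OF bounded_I summable(2)]) (rule that)
    have "\<bar>p \<bullet> x\<bar> \<le> h1 + h2" if "x \<in> closure (RF \<tau>) \<inter> CF \<tau>" for x
    proof -
      have "\<bar>a \<bullet> x\<bar> \<le> h1" "\<bar>c \<bullet> x\<bar> \<le> h2"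
        using that h1 h2 closure_subset[of "bwd.R \<tau>"] by (auto simp: fwd_R bwd_R)
      then show ?thesis by (simp add: p b inner_add_left)
    qed
    then show ?thesis by blast
  qed
  then obtain h where h: "\<And>p x. x \<in> closure (RF \<tau>) \<inter> CF \<tau> \<Longrightarrow> \<bar>p \<bullet> x\<bar> \<le> h p" by metis
  have "norm x \<le> (\<Sum>i\<in>Basis. h i)" if "x \<in> closure (RF \<tau>) \<inter> CF \<tau>" for x
    using norm_le_l1[of x] sum_mono[of Basis "\<lambda>i. \<bar>x \<bullet> i\<bar>" h] h[OF that]
    by (metis (no_types, lifting) inner_commute order_trans)
  then show ?thesis by (auto simp: bounded_iff)
qed

text \<open>Every point of \<open>D0\<close> can be steered within \<open>D0\<close> to the fiber over \<open>0\<close> in time at most \<open>T\<close>.\<close>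

lemma bounded_D0:
  assumes "E_zero T A 0 = {0}"
  shows "bounded D0"
proof -
  obtain b where b: "\<And>x. x \<in> closure (RF 0) \<inter> CF 0 \<Longrightarrow> norm x \<le> b"
    using bounded_fiber[OF assms] by (auto simp: bounded_iff)
  obtain c where c: "c \<ge> 0" "\<And>t s x u. u \<in> controls U \<Longrightarrow> \<bar>t - s\<bar> \<le> T \<Longrightarrow> norm (\<phi> t s x u) \<le> c * (norm x + 1)"
    by (rule traj_bounded[of T]) (rule that)
  have "norm x \<le> c * (b + 1)" if x: "(\<tau>, x) \<in> D0" for \<tau> x
  proof -
    have \<tau>: "\<tau> \<in> {0..<T}" using x by (simp add: mem_D0')
    obtain u where u: "u \<in> controls U" "\<And>t. t \<ge> 0 \<Longrightarrow> traj_aut T A B t (\<tau>, x) u \<in> D0"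
      using D0_steer[OF x] by blast
    then have "(0, \<phi> T \<tau> x u) \<in> D0" using u(2)[of "T - \<tau>"] \<tau> by (simp add: traj_aut_def)
    then have "norm (\<phi> T \<tau> x u) \<le> b" by (intro b) (simp add: mem_D0')
    moreover have "x = \<phi> \<tau> T (\<phi> T \<tau> x u) u" using u(1) by (simp add: traj_traj controls_Linf)
    then have "norm x \<le> c * (norm (\<phi> T \<tau> x u) + 1)" using c(2)[OF u(1), of \<tau> T "\<phi> T \<tau> x u"] \<tau> by simp
    ultimately show ?thesis using c(1) by (meson add_right_mono mult_left_mono order_trans)
  qed
  then have "D0 \<subseteq> {0..T} \<times> cball 0 (c * (b + 1))" using D0_subset by force
  moreover have "bounded ({0..T} \<times> cball (0::real^'n) (c * (b + 1)))" by (intro bounded_Times) auto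
  ultimately show ?thesis using bounded_subset by blast
qed

lemma unbounded_iff:
  "\<not> bounded (phase_space T interior_of D0) \<longleftrightarrow> nontrivial_bundle T (center_bundle T A)"
proof
  assume unb: "\<not> bounded (phase_space T interior_of D0)"
  show "nontrivial_bundle T (center_bundle T A)"
  proof (rule ccontr)
    assume "\<not> nontrivial_bundle T (center_bundle T A)"
    then have eq: "center_bundle T A = {0..<T} \<times> {0}" by (simp add: nontrivial_bundle_def)
    \<comment> \<open>The fiber over 0 suffices, since \<open>bounded_D0\<close> starts from
      there.\<close>
    have "E_zero T A 0 = {0}"
    proof (intro set_eqI)
      fix x have "x \<in> E_zero T A 0 \<longleftrightarrow> (0, x) \<in> center_bundle T A"
        using T_pos by (simp add: center_bundle_def)
      then show "x \<in> E_zero T A 0 \<longleftrightarrow> x \<in> {0}" using T_pos by (simp add: eq)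
    qed
    then have "bounded (phase_space T interior_of D0)"
      using bounded_D0 bounded_subset interior_of_subset by metis
    with unb show False by blast
  qed
next
  assume "nontrivial_bundle T (center_bundle T A)"
  moreover have "0 \<in> E_zero T A \<tau>" for \<tau>
    unfolding E_zero_def by (rule subspace_0[OF subspace_spectral_subspace])
  ultimately obtain \<tau> v where \<tau>: "\<tau> \<in> {0..<T}" and v: "v \<in> E_zero T A \<tau>" "v \<noteq> 0"
    by (force simp: nontrivial_bundle_def center_bundle_def)
  \<comment> \<open>The center subspace lies in \<open>V\<close> of both the forward and the
    backward system, so the whole line through \<open>v\<close> is interior to both fibers.\<close>
  have mem: "(\<tau>, a *\<^sub>R v) \<in> phase_space T interior_of D0" for a
  proof (rule interior_D0[OF \<tau>])
    have "a *\<^sub>R v \<in> E_zero T A \<tau>"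
      using v(1) unfolding E_zero_def by (rule subspace_scale[OF subspace_spectral_subspace])
    then show "a *\<^sub>R v \<in> interior (RF \<tau>)" "a *\<^sub>R v \<in> interior (CF \<tau>)"
      unfolding fwd_R[symmetric] bwd_R[symmetric]
      by (rule subsetD[OF fwd.V_subset_interior_R subsetD[OF E_subset_V(1)]]
          subsetD[OF bwd.V_subset_interior_R subsetD[OF E_subset_V(3)]])+
  qed
  show "\<not> bounded (phase_space T interior_of D0)"
  proof
    assume "bounded (phase_space T interior_of D0)"
    then obtain b where b: "\<And>p. p \<in> phase_space T interior_of D0 \<Longrightarrow> norm p \<le> b" by (auto simp: bounded_iff)
    define a where "a = (\<bar>b\<bar> + 1) / norm v"
    have "norm (a *\<^sub>R v) \<le> norm (\<tau>, a *\<^sub>R v)" by (rule norm_snd_le)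
    also have "\<dots> \<le> b" by (rule b[OF mem])
    finally show False using v(2) by (simp add: a_def)
  qed
qed

end

theorem theorem4p6:
  fixes T :: real
    and A :: "real \<Rightarrow> real^'n^'n"
    and B :: "real \<Rightarrow> real^'m^'n"
    and U :: "(real^'m) set"
  assumes "T > 0"
    and "Linf_on UNIV A" and "ae_periodic T A"
    and "Linf_on UNIV B" and "ae_periodic T B"
    and "bounded U" and "convex U" and "0 \<in> interior U"
    and "controllable A B"
  shows "(\<exists>!D. control_set T A B U D \<and> phase_space T interior_of D \<noteq> {}) \<and>
    (\<forall>D. control_set T A B U D \<and> phase_space T interior_of D \<noteq> {} \<longrightarrow>
       D = (phase_space T closure_of reach_aut T A B U (0, 0)) \<inter> contr_aut T A B U (0, 0) \<and>
       {0..<T} \<times> {0} \<subseteq> phase_space T interior_of D \<and>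
       fiber_image (Y_mat T A) (K_minus T A B U)
         \<oplus>\<^sub>f center_bundle T A
         \<oplus>\<^sub>f fiber_image (\<lambda>\<tau>. matrix_inv (Y_mat T A \<tau>)) (K_plus T A B U)
         \<subseteq> phase_space T interior_of D \<and>
       phase_space T interior_of D \<subseteq> D \<and>
       D \<subseteq> fiber_image (\<lambda>\<tau>. matrix_inv (Y_mat T A \<tau>)) (phase_space T closure_of K_minus T A B U)
         \<oplus>\<^sub>f center_bundle T A
         \<oplus>\<^sub>f fiber_image (Y_mat T A) (K_plus T A B U) \<and>
       (\<not> bounded (phase_space T interior_of D) \<longleftrightarrow> nontrivial_bundle T (center_bundle T A)))"
proof -
  obtain K where K: "K > 0" "AE s in lebesgue. \<forall>x. norm (A s *v x) \<le> K * norm x"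
    using Linf_on_prod_bound[OF bounded_bilinear_matrix_vector_mult assms(2)] .
  obtain K' where K': "K' > 0" "AE s in lebesgue. \<forall>w. norm (B s *v w) \<le> K' * norm w"
    using Linf_on_prod_bound[OF bounded_bilinear_matrix_vector_mult assms(4)] .
  obtain b where b: "\<And>w. w \<in> U \<Longrightarrow> norm w \<le> b" using assms(6) by (auto simp: bounded_iff)
  have "AE s in lebesgue. \<forall>w\<in>U. norm (B s *v w) \<le> K' * \<bar>b\<bar>"
    using K'(2)
  proof eventually_elim
    case (elim s)
    have "norm (B s *v w) \<le> K' * \<bar>b\<bar>" if "w \<in> U" for w
    proof -
      have "K' * norm w \<le> K' * \<bar>b\<bar>" using b[OF that] K'(1) by (intro mult_left_mono) auto
      then show ?thesis using elim order_trans by blast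
    qed
    then show ?case by blast
  qed
  moreover have "K' * \<bar>b\<bar> \<ge> 0" using K'(1) by simp
  \<comment> \<open>The uniform constants of the locale come from the essential bounds of
    \<open>A\<close> and \<open>B\<close> and from the norm bound of \<open>U\<close>.\<close>
  ultimately interpret controllable_system T A B U K "K' * \<bar>b\<bar>"
    by (intro controllable_system.intro periodic_control_system.intro controllable_system_axioms.intro assms K)
  have D0: "control_set T A B U D0 \<and> phase_space T interior_of D0 \<noteq> {}"
    using control_set_D0 zero_in_interior_D0[of 0] assms(1) by auto
  have "{0..<T} \<times> {0} \<subseteq> phase_space T interior_of D0" using zero_in_interior_D0 by auto
  then have props: "D0 = (phase_space T closure_of Ra (0, 0)) \<inter> Ca (0, 0) \<and>
       {0..<T} \<times> {0} \<subseteq> phase_space T interior_of D0 \<and>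
       fiber_image (Y_mat T A) (K_minus T A B U)
         \<oplus>\<^sub>f center_bundle T A
         \<oplus>\<^sub>f fiber_image (\<lambda>\<tau>. matrix_inv (Y_mat T A \<tau>)) (K_plus T A B U)
         \<subseteq> phase_space T interior_of D0 \<and>
       phase_space T interior_of D0 \<subseteq> D0 \<and>
       D0 \<subseteq> fiber_image (\<lambda>\<tau>. matrix_inv (Y_mat T A \<tau>)) (phase_space T closure_of K_minus T A B U)
         \<oplus>\<^sub>f center_bundle T A
         \<oplus>\<^sub>f fiber_image (Y_mat T A) (K_plus T A B U) \<and>
       (\<not> bounded (phase_space T interior_of D0) \<longleftrightarrow> nontrivial_bundle T (center_bundle T A))"
    using inner_subset outer_subset unbounded_iff interior_of_subset[of "phase_space T" D0]
    by (intro conjI D0_def) assumption+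
  have unique: "D = D0" if "control_set T A B U D \<and> phase_space T interior_of D \<noteq> {}" for D
    using control_set_unique that by blast
  have "\<exists>!D. control_set T A B U D \<and> phase_space T interior_of D \<noteq> {}"
    using D0 unique by blast
  with props unique show ?thesis by blast
qed

end
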